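(* Let $k\ge 2$ and let $f$ be a nonnegative, nondegenerate real-valued $k$-regular sequence with canonical linear representation $(\mathbf u,\mathcal A,\mathbf v)$, and assume that all matrices $\widetilde{\mathbf A}_i$ ($0\le i\le k-1$) are nonnegative. Let $p$ be the period of $\widetilde{\mathbf A}$. Then there are probability measures $\mu_{f,0},\dots,\mu_{f,p-1}$ on $\mathbb T$ such that $$\lim_{n\to\infty}\mu_{pn+j}=\mu_{f,j}$$ for all $0\le j\le p-1$, in the sense of weak convergence.
   Context: Regular sequences. Fix an integer $k\ge2$. For $n\ge1$ let $(n)_k=i_s\cdots i_0$ be the base-$k$ expansion ($i_s\ne0$), and for $d\times d$ matrices $\mathbf A_0,\dots,\mathbf A_{k-1}$ put $\mathbf A_{(n)_k}=\mathbf A_{i_s}\cdots\mathbf A_{i_0}$, with $\mathbf A_{(0)_k}$ the identity. A real sequence $f=(f(n))_{n\ge0}$ is $k$-regular if its $k$-kernel $\ker_k(f)=\{(f(k^\ell n+r))_{n\ge 0}:\ell\ge0,\ 0\le r<k^\ell\}$ spans a finite-dimensional real vector space $V_k(f)$. A linear representation of $f$ of degree $d$ is a tuple $(\mathbf u,\mathcal A,\mathbf v)$ with $\mathbf u,\mathbf v\in\mathbb R^{d}$, $\mathcal A=\{\mathbf A_0,\dots,\mathbf A_{k-1}\}\subset\mathbb R^{d\times d}$ and $f(n)=\mathbf u^T\mathbf A_{(n)_k}\mathbf v$ for all $n\ge 0$; it is minimal if $d=\dim V_k(f)$. It is canonical if it arises as follows: $\{f_1,\dots,f_d\}\subset\ker_k(f)$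 is a basis of $V_k(f)$, $\mathbf f(n)=(f_1(n),\dots,f_d(n))^T$, the $\mathbf A_j$ satisfy $\mathbf f(kn+j)^T=\mathbf f(n)^T\mathbf A_j$ for all $n\ge0$ and $0\le j\le k-1$, $\mathbf u=\mathbf f(0)$, and $f(n)=\mathbf u^T\mathbf A_{(n)_k}\mathbf v$ for all $n\ge 0$. Put $\mathbf A=\sum_{j=0}^{k-1}\mathbf A_j$. Ghost measure approximants. For nonnegative $f$ put $\Sigma_f(N)=\sum_{m=k^N}^{k^{N+1}-1}f(m)$ and, when $\Sigma_f(N)\neq0$, $\mu_N=\frac1{\Sigma_f(N)}\sum_{m=0}^{k^{N+1}-k^N-1}f(k^N+m)\,\delta_{m/(k^N(k-1))}$, a probability measure on $\mathbb T=[0,1)$ with addition mod $1$. Restrictions and nondegeneracy. Given a linear representation, let $V\subset\mathbb R^d$ be the subspace with $V^T=\mathrm{span}\{\mathbf u^T\mathbf A_{(n)_k}:n\ge1\}$, $\mathbf P_V$ the orthogonal projection onto $V$, $\widetilde{\mathbf A}_i=\mathbf P_V\mathbf A_i\mathbf P_V$, $\widetilde{\mathbf A}=\mathbf P_V\mathbf A\mathbf P_V$, $\rho=\rho(\widetilde{\mathbf A})$ the spectral radius, $\{g_1\rho,\dots,g_s\rho\}$ ($|g_i|=1$) the eigenvalues of $\widetilde{\mathbf A}$ of modulus $\rho$, $g=(g_1,\dots,g_s)$ and $G=\overline{\{g^n:n\in\mathbb N\}}$ (closure in the $s$-fold product of the complex unit circle). For $h\in G$ let $\mathbf R_h$ be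 multiplication by $h_m$ on the generalised eigenspace in $V$ (complexified) of $\widetilde{\mathbf A}$ for $g_m\rho$, and the identity on the other generalised eigenspaces in $V$ and on $V^\perp$; $\mathbf R=\mathbf R_{g^{-1}}$. Let $r$ be the maximal size of a Jordan block of $\widetilde{\mathbf A}$ for an eigenvalue of modulus $\rho$, $c_n=\frac{(r-1)!}{n^{r-1}\rho^{n-r+1}}$, $\mathbf P=\lim_{n\to\infty}c_n\mathbf R^n\widetilde{\mathbf A}^n$ (the limit exists). The representation is nondegenerate if $\rho>0$ and $\mathbf u^T(\mathbf A-\mathbf A_0)\mathbf R_h\mathbf P\mathbf v>0$ for all $h\in G$; $f$ is nondegenerate if it has a minimal nondegenerate linear representation. Then $\mu_N$ is defined for all large $N$. Period. The period of a nonnegative matrix $\mathbf M$ with $\rho(\mathbf M)>0$ is the smallest $n\in\mathbb N$ such that $\lambda^n$ is a positive real number for every eigenvalue $\lambda$ of $\mathbf M$ with $|\lambda|=\rho(\mathbf M)$. *)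

theory Defs
  imports
    "HOL-Probability.Probability_Measure"
    "HOL-Library.Function_Algebras"
    "Jordan_Normal_Form.Spectral_Radius"
begin

section \<open>Regular sequences and linear representations\<close>

text \<open>Real sequences are not an instance of \<^class>\<open>real_vector\<close>; pointwise addition is the one of
  \<^theory>\<open>HOL-Library.Function_Algebras\<close> and the scalar multiplication is supplied here, so that
  \<open>seq.span\<close>, \<open>seq.dependent\<close> and \<open>seq.dim\<close> are the notions of \<^locale>\<open>vector_space\<close>.\<close>

definition seq_scale :: "real \<Rightarrow> (nat \<Rightarrow> real) \<Rightarrow> nat \<Rightarrow> real" where
  "seq_scale c f = (\<lambda>n. c * f n)"

global_interpretation seq: vector_space seq_scale
  by unfold_locales (auto simp: seq_scale_def fun_eq_iff algebra_simps)

definition kernel_seqs :: "nat \<Rightarrow> (nat \<Rightarrow> real) \<Rightarrow> (nat \<Rightarrow> real) set" where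
  "kernel_seqs k f = {(\<lambda>n. f (k ^ l * n + r)) | l r. r < k ^ l}"

definition kernel_space :: "nat \<Rightarrow> (nat \<Rightarrow> real) \<Rightarrow> (nat \<Rightarrow> real) set" where
  "kernel_space k f = seq.span (kernel_seqs k f)"

definition regular_seq :: "nat \<Rightarrow> (nat \<Rightarrow> real) \<Rightarrow> bool" where
  "regular_seq k f \<longleftrightarrow> (\<exists>B. finite B \<and> kernel_space k f = seq.span B)"

text \<open>The last base-\<open>k\<close> digit of \<open>n\<close> indexes the rightmost factor, and \<open>n = 0\<close> is the empty word.
  The guard \<open>k < 2\<close> only serves termination.\<close>

function digit_mat :: "nat \<Rightarrow> nat \<Rightarrow> (nat \<Rightarrow> real mat) \<Rightarrow> nat \<Rightarrow> real mat" where
  "digit_mat k d A n =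
     (if n = 0 \<or> k < 2 then 1\<^sub>m d else digit_mat k d A (n div k) * A (n mod k))"
  by pat_completeness auto
termination
  by (relation "Wellfounded.measure (\<lambda>(k, d, A, n). n)") auto

declare digit_mat.simps [simp del]

definition linear_rep ::
    "nat \<Rightarrow> (nat \<Rightarrow> real) \<Rightarrow> nat \<Rightarrow> real vec \<Rightarrow> (nat \<Rightarrow> real mat) \<Rightarrow> real vec \<Rightarrow> bool" where
  "linear_rep k f d u A v \<longleftrightarrow>
     u \<in> carrier_vec d \<and> v \<in> carrier_vec d \<and> (\<forall>i<k. A i \<in> carrier_mat d d) \<and>
     (\<forall>n. f n = scalar_prod u (digit_mat k d A n *\<^sub>v v))"

definition minimal_rep ::
    "nat \<Rightarrow> (nat \<Rightarrow> real) \<Rightarrow> nat \<Rightarrow> real vec \<Rightarrow> (nat \<Rightarrow> real mat) \<Rightarrow> real vec \<Rightarrow> bool" where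
  "minimal_rep k f d u A v \<longleftrightarrow> linear_rep k f d u A v \<and> d = seq.dim (kernel_space k f)"

text \<open>The row vector identity \<open>F(kn+j)\<^sup>T = F(n)\<^sup>T A\<^sub>j\<close> is written in transposed form.\<close>

definition canonical_rep ::
    "nat \<Rightarrow> (nat \<Rightarrow> real) \<Rightarrow> nat \<Rightarrow> real vec \<Rightarrow> (nat \<Rightarrow> real mat) \<Rightarrow> real vec \<Rightarrow> bool" where
  "canonical_rep k f d u A v \<longleftrightarrow>
     linear_rep k f d u A v \<and>
     (\<exists>F :: nat \<Rightarrow> nat \<Rightarrow> real.
        inj_on F {..<d} \<and> F ` {..<d} \<subseteq> kernel_seqs k f \<and>
        seq.independent (F ` {..<d}) \<and> seq.span (F ` {..<d}) = kernel_space k f \<and>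
        (\<forall>n. \<forall>j<k. Matrix.vec d (\<lambda>i. F i (k * n + j)) =
                    transpose_mat (A j) *\<^sub>v Matrix.vec d (\<lambda>i. F i n)) \<and>
        u = Matrix.vec d (\<lambda>i. F i 0))"

definition total_mat :: "nat \<Rightarrow> nat \<Rightarrow> (nat \<Rightarrow> real mat) \<Rightarrow> real mat" where
  "total_mat k d A = Matrix.mat d d (\<lambda>(i, j). \<Sum>l<k. A l $$ (i, j))"


section \<open>Restriction to the reachable subspace\<close>

definition reach_space :: "nat \<Rightarrow> nat \<Rightarrow> real vec \<Rightarrow> (nat \<Rightarrow> real mat) \<Rightarrow> real vec set" where
  "reach_space k d u A =
     LinearCombinations.module.span class_ring (module_vec TYPE(real) d)
       {transpose_mat (digit_mat k d A n) *\<^sub>v u | n. n \<ge> 1}"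

abbreviation orth_compl :: "nat \<Rightarrow> real vec set \<Rightarrow> real vec set" where
  "orth_compl d V \<equiv> vec_module.orthogonal_complement d V"

definition orth_proj :: "nat \<Rightarrow> real vec set \<Rightarrow> real mat" where
  "orth_proj d V = (THE P. P \<in> carrier_mat d d \<and>
     (\<forall>x\<in>carrier_vec d. P *\<^sub>v x \<in> V \<and> x - P *\<^sub>v x \<in> orth_compl d V))"

definition restr_mat ::
    "nat \<Rightarrow> nat \<Rightarrow> real vec \<Rightarrow> (nat \<Rightarrow> real mat) \<Rightarrow> real mat \<Rightarrow> real mat" where
  "restr_mat k d u A M =
     orth_proj d (reach_space k d u A) * M * orth_proj d (reach_space k d u A)"


section \<open>Peripheral spectrum\<close>

abbreviation cmat :: "real mat \<Rightarrow> complex mat" where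
  "cmat \<equiv> map_mat complex_of_real"

abbreviation cvec :: "real vec \<Rightarrow> complex vec" where
  "cvec \<equiv> map_vec complex_of_real"

definition complexify :: "real vec set \<Rightarrow> complex vec set" where
  "complexify V = {x. map_vec Re x \<in> V \<and> map_vec Im x \<in> V}"

definition gen_eigenspace :: "nat \<Rightarrow> complex mat \<Rightarrow> complex \<Rightarrow> complex vec set" where
  "gen_eigenspace d M ev =
     {x \<in> carrier_vec d. \<exists>m. (char_matrix M ev ^\<^sub>m m) *\<^sub>v x = 0\<^sub>v d}"

definition phases :: "complex mat \<Rightarrow> complex set" where
  "phases M = {g. cmod g = 1 \<and> eigenvalue M (g * complex_of_real (spectral_radius M))}"

text \<open>The tuple \<open>(g\<^sub>1, \<dots>, g\<^sub>s)\<close> is indexed by the phases themselves: a tuple is a function that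
  equals \<open>1\<close> off \<^term>\<open>phases M\<close>, and the closure is in the product topology.\<close>

definition phase_power :: "complex mat \<Rightarrow> nat \<Rightarrow> complex \<Rightarrow> complex" where
  "phase_power M n = (\<lambda>g. if g \<in> phases M then g ^ n else 1)"

definition phase_inverse :: "complex mat \<Rightarrow> complex \<Rightarrow> complex" where
  "phase_inverse M = (\<lambda>g. if g \<in> phases M then inverse g else 1)"

definition phase_group :: "complex mat \<Rightarrow> (complex \<Rightarrow> complex) set" where
  "phase_group M = closure {phase_power M n | n. n \<ge> 1}"

definition phase_rotation ::
    "nat \<Rightarrow> real vec set \<Rightarrow> complex mat \<Rightarrow> (complex \<Rightarrow> complex) \<Rightarrow> complex mat" where
  "phase_rotation d V M h = (THE R. R \<in> carrier_mat d d \<and>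
     (\<forall>g\<in>phases M. \<forall>x\<in>gen_eigenspace d M (g * complex_of_real (spectral_radius M)) \<inter> complexify V.
        R *\<^sub>v x = h g \<cdot>\<^sub>v x) \<and>
     (\<forall>ev\<in>spectrum M. cmod ev \<noteq> spectral_radius M \<longrightarrow>
        (\<forall>x\<in>gen_eigenspace d M ev \<inter> complexify V. R *\<^sub>v x = x)) \<and>
     (\<forall>x\<in>complexify (orth_compl d V). R *\<^sub>v x = x))"

definition peripheral_block_size :: "complex mat \<Rightarrow> nat" where
  "peripheral_block_size M =
     Max {m. \<exists>n_as ev. jordan_nf M n_as \<and> (m, ev) \<in> set n_as \<and> cmod ev = spectral_radius M}"

definition growth_normalizer :: "complex mat \<Rightarrow> nat \<Rightarrow> real" where
  "growth_normalizer M n =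
     (let r = peripheral_block_size M in
      fact (r - 1) / (real n ^ (r - 1) * spectral_radius M powi (int n - int r + 1)))"

text \<open>The matrix limit is taken entrywise.\<close>

definition leading_part :: "nat \<Rightarrow> real vec set \<Rightarrow> complex mat \<Rightarrow> complex mat" where
  "leading_part d V M =
     (let R = phase_rotation d V M (phase_inverse M) in
      Matrix.mat d d (\<lambda>(i, j). lim (\<lambda>n.
        complex_of_real (growth_normalizer M n) * (R ^\<^sub>m n * M ^\<^sub>m n) $$ (i, j))))"

definition nondegenerate_rep ::
    "nat \<Rightarrow> nat \<Rightarrow> real vec \<Rightarrow> (nat \<Rightarrow> real mat) \<Rightarrow> real vec \<Rightarrow> bool" where
  "nondegenerate_rep k d u A v \<longleftrightarrow>
     (let V = reach_space k d u A;
          M = cmat (restr_mat k d u A (total_mat k d A))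
      in 0 < spectral_radius M \<and>
         (\<forall>h\<in>phase_group M.
            let z = scalar_prod (cvec u)
                      ((cmat (total_mat k d A - A 0) * phase_rotation d V M h * leading_part d V M)
                        *\<^sub>v cvec v)
            in z \<in> \<real> \<and> 0 < Re z))"

definition nondegenerate_seq :: "nat \<Rightarrow> (nat \<Rightarrow> real) \<Rightarrow> bool" where
  "nondegenerate_seq k f \<longleftrightarrow>
     (\<exists>d u A v. minimal_rep k f d u A v \<and> nondegenerate_rep k d u A v)"

definition nonneg_entries :: "real mat \<Rightarrow> bool" where
  "nonneg_entries M \<longleftrightarrow> (\<forall>i<dim_row M. \<forall>j<dim_col M. 0 \<le> M $$ (i, j))"

definition mat_period :: "real mat \<Rightarrow> nat" where
  "mat_period M = (LEAST n. n \<ge> 1 \<and>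
     (\<forall>ev\<in>spectrum (cmat M). cmod ev = spectral_radius (cmat M) \<longrightarrow>
        ev ^ n \<in> \<real> \<and> 0 < Re (ev ^ n)))"


section \<open>Measures on the circle\<close>

text \<open>The circle is the set \<open>[0,1)\<close>. Its Borel sets as a circle are those it inherits from the
  line, but its topology is not: the continuous functions on the circle are the continuous
  \<open>1\<close>-periodic functions on the line.\<close>

definition circle_borel :: "real measure" where
  "circle_borel = restrict_space borel {0..<1}"

definition circle_prob :: "real measure \<Rightarrow> bool" where
  "circle_prob M \<longleftrightarrow> prob_space M \<and> sets M = sets circle_borel"

definition circle_weak_conv :: "(nat \<Rightarrow> real measure) \<Rightarrow> real measure \<Rightarrow> bool" where
  "circle_weak_conv M L \<longleftrightarrow>
     (\<forall>\<phi> :: real \<Rightarrow> real. continuous_on UNIV \<phi> \<longrightarrow> (\<forall>x. \<phi> (x + 1) = \<phi> x) \<longrightarrow>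
        (\<lambda>n. integral\<^sup>L (M n) \<phi>) \<longlonglongrightarrow> integral\<^sup>L L \<phi>)"

definition block_sum :: "nat \<Rightarrow> (nat \<Rightarrow> real) \<Rightarrow> nat \<Rightarrow> real" where
  "block_sum k f N = (\<Sum>m = k ^ N..k ^ (N + 1) - 1. f m)"

text \<open>If \<^term>\<open>block_sum k f N = 0\<close>, this is the zero measure.\<close>

definition ghost_approx :: "nat \<Rightarrow> (nat \<Rightarrow> real) \<Rightarrow> nat \<Rightarrow> real measure" where
  "ghost_approx k f N =
     distr (point_measure {0..k ^ (N + 1) - k ^ N - 1}
              (\<lambda>m. ennreal (f (k ^ N + m) / block_sum k f N)))
       circle_borel (\<lambda>m. real m / (real (k ^ N) * (real k - 1)))"

end

theory Submission
  imports
    Defs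
    "HOL-Probability.Helly_Selection"
    "Jordan_Normal_Form.Jordan_Normal_Form_Uniqueness"
begin

text \<open>Write \<open>y\<^sub>n\<close> for the row vector \<open>u\<^sup>T A\<^bsub>(n)\<^esub>\<close> and \<open>M\<close> for the restricted total matrix. For
  \<open>n \<ge> 1\<close> the number \<open>y\<^sub>n M\<^sup>N v\<close> is the sum of \<open>f\<close> over all indices whose expansion is that of \<open>n\<close> followed
  by \<open>N\<close> digits, so it is the unnormalised mass of a \<open>k\<close>-adic arc. Nondegeneracy of some minimal
  representation bounds the block sums of \<open>f\<close> above and below by multiples of \<open>N\<^sup>s \<rho>\<^sup>N\<close>; this bound no
  longer mentions the representation, and it carries over to the canonical one because the canonical
  basis consists of kernel sequences: by nonnegativity of \<open>f\<close>, all entries seen by the \<open>y\<^sub>n\<close>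
  are dominated by block sums, so \<open>M\<close> has spectral radius \<open>\<rho>\<close>. By Perron--Frobenius the
  peripheral eigenvalues of \<open>M\<close> become positive after raising to the period \<open>p\<close>, so along a residue
  class modulo \<open>p\<close> each arc mass divided by \<open>\<rho>\<^sup>N\<close> is a polynomial plus a null sequence. The polynomial
  has degree at most \<open>s\<close>, the normalised arc masses converge, and uniform continuity of the
  test function turns this into convergence of integrals. A limit measure exists by tightness on
  the line, transported to the circle by the fractional part.\<close>

text \<open>Several notions are given by \<open>THE\<close>, \<open>lim\<close>, \<open>Max\<close>
  or \<open>LEAST\<close> and say nothing until existence is proved: \<open>orth_proj\<close> comes
  from a maximal orthonormal family, \<open>phase_rotation\<close> turns out to be a diagonal matrix
  conjugated by a Jordan basis, and the limit in \<open>leading_part\<close> exists because the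
  rotation cancels the oscillation of each peripheral Jordan block. Nondegeneracy gives positivity
  separately for each h in the phase group. A uniform lower bound needs compactness, used here
  through subsequences along which all phases converge. Two facts tie sums of f to the spectrum of
  M. Rows with n >= 1 lie in V and do not see the projections inside M; conversely, no eigenvector
  of M with nonzero eigenvalue is orthogonal to all these rows. So an eigenvalue beyond \<rho> would
  show up in sums that the block sums dominate. The degree bound s is obtained in the same spirit,
  not from the Jordan blocks of M: an arc mass is at most one block sum, hence O(N^s
  \<rho>^N).\<close>

no_notation vec_nth (infixl "$" 90)
no_notation inner (infix "\<bullet>" 70)


section \<open>Orthogonal projection onto the reachable subspace\<close>

text \<open>Bessel's inequality for each unit vector bounds the sum of the squared i-th coordinates
  by 1. Summing over i < d gives d on the right and the n squared norms on the left.\<close>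

lemma orthonormal_family_card:
  fixes w :: "nat \<Rightarrow> nat \<Rightarrow> real"
  assumes on: "\<And>m l. m < n \<Longrightarrow> l < n \<Longrightarrow> (\<Sum>j<d. w m j * w l j) = (if m = l then 1 else 0)"
  shows "n \<le> d"
proof -
  have bessel: "(\<Sum>m<n. (w m i)\<^sup>2) \<le> 1" if i: "i < d" for i
  proof -
    \<comment> \<open>The projection of the i-th unit vector onto the span of the family. Bessel's
      inequality is the nonnegativity of the squared distance between the two.\<close>
    define S where "S j = (\<Sum>m<n. w m i * w m j)" for j
    have A: "(\<Sum>j<d. (if j = i then 1 else 0) * S j) = (\<Sum>m<n. (w m i)\<^sup>2)"
      using i by (simp add: if_distrib[of "\<lambda>x. x * _"] S_def power2_eq_square cong: if_cong)
    have "(\<Sum>j<d. S j * S j) = (\<Sum>j<d. \<Sum>m<n. \<Sum>l<n. w m i * w l i * (w m j * w l j))"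
      by (simp add: S_def sum_product algebra_simps)
    also have "\<dots> = (\<Sum>m<n. \<Sum>l<n. w m i * w l i * (\<Sum>j<d. w m j * w l j))"
      unfolding sum_distrib_left
      by (subst sum.swap, rule sum.cong[OF refl], subst sum.swap, rule refl)
    also have "\<dots> = (\<Sum>m<n. \<Sum>l<n. if m = l then w m i * w l i else 0)"
      by (intro sum.cong refl) (simp add: on)
    also have "\<dots> = (\<Sum>m<n. (w m i)\<^sup>2)"
      by (simp add: power2_eq_square)
    finally have B: "(\<Sum>j<d. S j * S j) = (\<Sum>m<n. (w m i)\<^sup>2)" .
    have "0 \<le> (\<Sum>j<d. ((if j = i then 1 else 0) - S j)\<^sup>2)"
      by (intro sum_nonneg) auto
    also have "\<dots> = (\<Sum>j<d. (if j = i then 1 else 0)) - 2 * (\<Sum>j<d. (if j = i then 1 else 0) * S j)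
        + (\<Sum>j<d. S j * S j)"
      unfolding sum_distrib_left sum_subtractf[symmetric] sum.distrib[symmetric]
      by (intro sum.cong refl) (auto simp: power2_eq_square algebra_simps)
    also have "\<dots> = 1 - (\<Sum>m<n. (w m i)\<^sup>2)"
      unfolding A B using i by simp
    finally show ?thesis by simp
  qed
  have "real n = (\<Sum>m<n. \<Sum>j<d. (w m j)\<^sup>2)"
    using on by (simp add: power2_eq_square)
  also have "\<dots> = (\<Sum>j<d. \<Sum>m<n. (w m j)\<^sup>2)" by (rule sum.swap)
  also have "\<dots> \<le> (\<Sum>j<d. 1)" by (intro sum_mono bessel) auto
  finally show ?thesis by simp
qed

lemma scalar_prod_self_eq_0:
  fixes x :: "real vec"
  assumes "x \<in> carrier_vec d" "x \<bullet> x = 0"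
  shows "x = 0\<^sub>v d"
proof -
  have "\<forall>i\<in>{0..<d}. x $ i * x $ i = 0"
    using assms unfolding scalar_prod_def by (subst sum_nonneg_eq_0_iff[symmetric]) auto
  then show ?thesis using assms(1) by (intro eq_vecI) auto
qed

text \<open>Orthonormal families in V have at most d members, so a longest one exists, and P is the
  sum of the matrices w w^T over it. Maximality makes P the identity on V: otherwise the normalised
  residual of some x in V would extend the family.\<close>

lemma orth_proj_exists:
  fixes V :: "real vec set"
  assumes V: "V \<subseteq> carrier_vec d" "0\<^sub>v d \<in> V"
    and add: "\<And>x y. x \<in> V \<Longrightarrow> y \<in> V \<Longrightarrow> x + y \<in> V"
    and smult: "\<And>c x. x \<in> V \<Longrightarrow> c \<cdot>\<^sub>v x \<in> V"
  shows "\<exists>P\<in>carrier_mat d d. \<forall>x\<in>carrier_vec d. P *\<^sub>v x \<in> V \<and> x - P *\<^sub>v x \<in> orth_compl d V"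
proof -
  define ON where "ON n w \<longleftrightarrow> (\<forall>m<n. w m \<in> V) \<and>
    (\<forall>m<n. \<forall>l<n. w m \<bullet> w l = (if m = l then 1 else 0))" for n and w :: "nat \<Rightarrow> real vec"
  have bound: "n \<le> d" if "ON n w" for n w
  proof (rule orthonormal_family_card[where w = "\<lambda>m j. w m $ j"])
    fix m l assume ml: "m < n" "l < n"
    then have "dim_vec (w l) = d" using that V by (auto simp: ON_def)
    then have "w m \<bullet> w l = (\<Sum>j<d. w m $ j * w l $ j)" by (simp add: scalar_prod_def lessThan_atLeast0)
    then show "(\<Sum>j<d. w m $ j * w l $ j) = (if m = l then 1 else 0)"
      using that ml by (simp add: ON_def)
  qed
  define n where "n = (GREATEST n. \<exists>w. ON n w)"
  have ex0: "\<exists>w. ON 0 w" by (auto simp: ON_def)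
  have "\<exists>w. ON n w" unfolding n_def
    by (rule GreatestI_nat[of "\<lambda>n. \<exists>w. ON n w" 0 d]) (use ex0 bound in auto)
  then obtain w where w: "ON n w" by blast
  have max: "\<not> ON (Suc n) w'" for w'
  proof
    assume "ON (Suc n) w'"
    then have "Suc n \<le> n" unfolding n_def
      using Greatest_le_nat[of "\<lambda>n. \<exists>w. ON n w" "Suc n" d] bound by (auto simp: n_def)
    then show False by simp
  qed
  have wV: "w m \<in> V" "w m \<in> carrier_vec d" if "m < n" for m
    using w that V by (auto simp: ON_def)
  have won: "w m \<bullet> w l = (if m = l then 1 else 0)" if "m < n" "l < n" for m l
    using w that by (auto simp: ON_def)
  have comb: "Matrix.vec d (\<lambda>i. \<Sum>m<l. c m * w m $ i) \<in> V" if "l \<le> n" for l and c :: "nat \<Rightarrow> real"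
    using that
  proof (induction l)
    case 0 then show ?case using V by (simp add: zero_vec_def)
  next
    case (Suc l)
    have "Matrix.vec d (\<lambda>i. \<Sum>m<Suc l. c m * w m $ i)
        = Matrix.vec d (\<lambda>i. \<Sum>m<l. c m * w m $ i) + c l \<cdot>\<^sub>v w l"
      using wV(2)[of l] Suc.prems by (intro eq_vecI) auto
    then show ?case using Suc add smult wV by auto
  qed
  define P where "P = Matrix.mat d d (\<lambda>(i, j). \<Sum>m<n. w m $ i * w m $ j)"
  have P: "P \<in> carrier_mat d d" by (simp add: P_def)
  have Px: "P *\<^sub>v x = Matrix.vec d (\<lambda>i. \<Sum>m<n. (w m \<bullet> x) * w m $ i)" if "x \<in> carrier_vec d" for x
  proof (rule eq_vecI)
    fix i assume "i < dim_vec (Matrix.vec d (\<lambda>i. \<Sum>m<n. (w m \<bullet> x) * w m $ i))"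
    then have i: "i < d" by simp
    have "(P *\<^sub>v x) $ i = (\<Sum>j<d. (\<Sum>m<n. w m $ i * w m $ j) * x $ j)"
      using i that by (simp add: P_def scalar_prod_def lessThan_atLeast0)
    also have "\<dots> = (\<Sum>m<n. \<Sum>j<d. w m $ i * w m $ j * x $ j)"
      by (simp add: sum_distrib_right) (rule sum.swap)
    also have "\<dots> = (\<Sum>m<n. (w m \<bullet> x) * w m $ i)"
      using that by (simp add: scalar_prod_def sum_distrib_left sum_distrib_right lessThan_atLeast0 mult_ac)
    finally show "(P *\<^sub>v x) $ i = Matrix.vec d (\<lambda>i. \<Sum>m<n. (w m \<bullet> x) * w m $ i) $ i" using i by simp
  qed (simp add: P_def)
  have PV: "P *\<^sub>v x \<in> V" if "x \<in> carrier_vec d" for x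
    unfolding Px[OF that] by (rule comb) simp
  have perp: "w l \<bullet> (x - P *\<^sub>v x) = 0" if x: "x \<in> carrier_vec d" and l: "l < n" for x l
  proof -
    have "w l \<bullet> (P *\<^sub>v x) = (\<Sum>i<d. w l $ i * (\<Sum>m<n. (w m \<bullet> x) * w m $ i))"
      unfolding Px[OF x] by (simp add: scalar_prod_def lessThan_atLeast0)
    also have "\<dots> = (\<Sum>m<n. \<Sum>i<d. w l $ i * ((w m \<bullet> x) * w m $ i))"
      unfolding sum_distrib_left by (rule sum.swap)
    also have "\<dots> = (\<Sum>m<n. (w m \<bullet> x) * (w l \<bullet> w m))"
    proof (rule sum.cong[OF refl])
      fix m assume "m \<in> {..<n}"
      then have "w m \<in> carrier_vec d" using wV by simp
      then have "w l \<bullet> w m = (\<Sum>i<d. w l $ i * w m $ i)" by (simp add: scalar_prod_def lessThan_atLeast0)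
      then show "(\<Sum>i<d. w l $ i * ((w m \<bullet> x) * w m $ i)) = (w m \<bullet> x) * (w l \<bullet> w m)"
        by (simp add: sum_distrib_left mult_ac)
    qed
    also have "\<dots> = w l \<bullet> x" using l by (simp add: won if_distrib[of "\<lambda>c. _ * c"] cong: if_cong)
    finally show ?thesis
      using x l wV P by (subst scalar_prod_minus_distrib[of _ d]) auto
  qed
  have fixV: "P *\<^sub>v x = x" if x: "x \<in> V" for x
  proof (rule ccontr)
    assume ne: "P *\<^sub>v x \<noteq> x"
    have xc: "x \<in> carrier_vec d" using x V by auto
    define z where "z = x - P *\<^sub>v x"
    have zc: "z \<in> carrier_vec d" using xc P by (simp add: z_def)
    have "z = x + (-1) \<cdot>\<^sub>v (P *\<^sub>v x)" using xc P by (intro eq_vecI) (auto simp: z_def)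
    then have zV: "z \<in> V" using add smult PV xc x by auto
    have "z \<noteq> 0\<^sub>v d"
    proof
      assume z0: "z = 0\<^sub>v d"
      have "P *\<^sub>v x = x"
      proof (rule eq_vecI)
        fix i assume "i < dim_vec x"
        then have "i < d" "z $ i = 0" using xc z0 by auto
        then show "(P *\<^sub>v x) $ i = x $ i" using xc P by (simp add: z_def)
      qed (use xc P in auto)
      with ne show False by simp
    qed
    then have "z \<bullet> z \<noteq> 0" using scalar_prod_self_eq_0 zc by blast
    moreover have "0 \<le> z \<bullet> z" by (auto simp: scalar_prod_def intro!: sum_nonneg)
    ultimately have pos: "0 < z \<bullet> z" by simp
    define w' where "w' = w(n := (1 / sqrt (z \<bullet> z)) \<cdot>\<^sub>v z)"
    have "ON (Suc n) w'"
      unfolding ON_def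
    proof (intro conjI allI impI)
      fix m assume "m < Suc n" then show "w' m \<in> V"
        using wV zV smult by (auto simp: w'_def less_Suc_eq)
    next
      fix m l assume ml: "m < Suc n" "l < Suc n"
      have wz: "w m \<bullet> z = 0" "z \<bullet> w m = 0" if "m < n" for m
        using perp[OF xc that] wV(2)[OF that] zc comm_scalar_prod[of z d "w m"] by (auto simp: z_def)
      have n1: "((1 / sqrt (z \<bullet> z)) \<cdot>\<^sub>v z) \<bullet> ((1 / sqrt (z \<bullet> z)) \<cdot>\<^sub>v z) = 1"
        using zc pos by (simp add: real_div_sqrt)
      show "w' m \<bullet> w' l = (if m = l then 1 else 0)"
        using ml wz wV(2) zc won n1
        by (auto simp: w'_def less_Suc_eq)
    qed
    then show False using max by blast
  qed
  have aux: "(\<Sum>i<d. c * w m $ i * q $ i) = c * (w m \<bullet> q)" if "q \<in> carrier_vec d" for c m q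
    using that by (simp add: scalar_prod_def sum_distrib_left lessThan_atLeast0 mult.assoc)
  have "x - P *\<^sub>v x \<in> orth_compl d V" if x: "x \<in> carrier_vec d" for x
  proof -
    have "(x - P *\<^sub>v x) \<bullet> y = 0" if y: "y \<in> V" for y
    proof -
      have yc: "y \<in> carrier_vec d" using y V by auto
      have c: "x - P *\<^sub>v x \<in> carrier_vec d" using x P by simp
      have "y \<bullet> (x - P *\<^sub>v x) = (P *\<^sub>v y) \<bullet> (x - P *\<^sub>v x)" using fixV[OF y] by simp
      also have "\<dots> = (\<Sum>i<d. (\<Sum>m<n. (w m \<bullet> y) * w m $ i) * (x - P *\<^sub>v x) $ i)"
        unfolding Px[OF yc] using x P by (simp add: scalar_prod_def lessThan_atLeast0)
      also have "\<dots> = (\<Sum>m<n. \<Sum>i<d. (w m \<bullet> y) * w m $ i * (x - P *\<^sub>v x) $ i)"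
        unfolding sum_distrib_right by (rule sum.swap)
      also have "\<dots> = (\<Sum>m<n. (w m \<bullet> y) * (w m \<bullet> (x - P *\<^sub>v x)))"
        using aux[OF c] by simp
      also have "\<dots> = 0" using perp[OF x] by simp
      finally show ?thesis using comm_scalar_prod[OF c yc] by simp
    qed
    then show ?thesis using x P by (auto simp: vec_module.orthogonal_complement_def)
  qed
  then show ?thesis using P PV by blast
qed

text \<open>The difference of the two images of x lies both in V and in its orthogonal complement.
  Together with existence this makes the \<open>THE\<close> in \<open>orth_proj\<close>
  meaningful.\<close>

lemma orth_proj_unique:
  fixes V :: "real vec set"
  assumes V: "V \<subseteq> carrier_vec d"
    and add: "\<And>x y. x \<in> V \<Longrightarrow> y \<in> V \<Longrightarrow> x + y \<in> V"
    and smult: "\<And>c x. x \<in> V \<Longrightarrow> c \<cdot>\<^sub>v x \<in> V"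
    and P: "P \<in> carrier_mat d d" "\<And>x. x \<in> carrier_vec d \<Longrightarrow> P *\<^sub>v x \<in> V \<and> x - P *\<^sub>v x \<in> orth_compl d V"
    and Q: "Q \<in> carrier_mat d d" "\<And>x. x \<in> carrier_vec d \<Longrightarrow> Q *\<^sub>v x \<in> V \<and> x - Q *\<^sub>v x \<in> orth_compl d V"
  shows "P = Q"
proof (rule eq_matI)
  fix i j assume "i < dim_row Q" "j < dim_col Q"
  then have ij: "i < d" "j < d" using Q by auto
  define x :: "real vec" where "x = unit_vec d j"
  have x: "x \<in> carrier_vec d" by (simp add: x_def)
  define z where "z = P *\<^sub>v x - Q *\<^sub>v x"
  have zc: "z \<in> carrier_vec d" using P Q x by (simp add: z_def)
  have "z = P *\<^sub>v x + (-1) \<cdot>\<^sub>v (Q *\<^sub>v x)" using P(1) Q(1) x by (intro eq_vecI) (auto simp: z_def)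
  then have zV: "z \<in> V" using P(2) Q(2) x add smult by simp
  have o: "(x - P *\<^sub>v x) \<bullet> z = 0" "(x - Q *\<^sub>v x) \<bullet> z = 0"
    using P(2)[OF x] Q(2)[OF x] zV by (auto simp: vec_module.orthogonal_complement_def)
  have "z = (x - Q *\<^sub>v x) - (x - P *\<^sub>v x)"
    using P(1) Q(1) x by (intro eq_vecI) (auto simp: z_def)
  then have "z \<bullet> z = ((x - Q *\<^sub>v x) - (x - P *\<^sub>v x)) \<bullet> z" by simp
  also have "\<dots> = 0"
    using o P(1) Q(1) x zc by (subst minus_scalar_prod_distrib[of _ d]) auto
  finally have "z = 0\<^sub>v d" using scalar_prod_self_eq_0 zc by blast
  then have "z $ i = 0" using ij by simp
  then show "P $$ (i, j) = Q $$ (i, j)"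
    using ij P(1) Q(1) by (simp add: z_def x_def)
qed (use P Q in auto)

section \<open>Rows attached to digit prefixes, and sums over blocks\<close>

lemma pow_mat_Suc_left:
  "B \<in> carrier_mat d d \<Longrightarrow> B ^\<^sub>m Suc n = B * B ^\<^sub>m n"
proof (induction n)
  case (Suc n)
  then show ?case by (simp add: assoc_mult_mat[of _ d d _ d _ d])
qed auto

text \<open>Integers are sorted by their quotient by q. With q = k^N the quotient is the prefix of
  the expansion and r collects the last N digits.\<close>

lemma sum_prefix_blocks:
  fixes g :: "nat \<Rightarrow> real"
  assumes "a \<le> b"
  shows "sum g {a * q..<b * q} = (\<Sum>n\<in>{a..<b}. \<Sum>r<q. g (n * q + r))"
  using assms
proof (induction b rule: dec_induct)
  case base then show ?case by simp
next
  case (step b)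
  have "sum g {a * q..<Suc b * q} = sum g {a * q..<b * q} + sum g {b * q..<b * q + q}"
    using step.hyps by (subst sum.atLeastLessThan_concat) (auto simp: add.commute)
  also have "sum g {b * q..<b * q + q} = (\<Sum>r<q. g (b * q + r))"
    using sum.shift_bounds_nat_ivl[of g 0 "b * q" q] by (simp add: lessThan_atLeast0 add.commute)
  finally show ?case using step by simp
qed

lemma block_sum_interval:
  assumes "2 \<le> k" shows "block_sum k f N = sum f {k ^ N..<k ^ (N + 1)}"
proof -
  have "{c..b - 1} = {c..<b}" if "0 < b" for c b :: nat using that by auto
  moreover have "0 < k ^ (N + 1)" using assms by simp
  ultimately show ?thesis by (simp add: block_sum_def)
qed

locale lin_rep =
  fixes k d :: nat and f :: "nat \<Rightarrow> real" and u v :: "real vec" and A :: "nat \<Rightarrow> real mat"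
  assumes k2: "k \<ge> 2" and lr: "linear_rep k f d u A v"
begin

lemma u_carrier [simp]: "u \<in> carrier_vec d" and v_carrier [simp]: "v \<in> carrier_vec d"
  and A_carrier [simp]: "j < k \<Longrightarrow> A j \<in> carrier_mat d d"
  using lr by (auto simp: linear_rep_def)

lemma digit_mat_carrier [simp]: "digit_mat k d A n \<in> carrier_mat d d"
proof (induction n rule: less_induct)
  case (less n)
  show ?case
  proof (cases "n = 0")
    case True then show ?thesis by (simp add: digit_mat.simps)
  next
    case False
    then have "n div k < n" "n mod k < k" using k2 by auto
    then show ?thesis using less[of "n div k"] A_carrier[of "n mod k"]
      by (subst digit_mat.simps) auto
  qed
qed

definition row_vec :: "nat \<Rightarrow> real vec" where
  "row_vec n = transpose_mat (digit_mat k d A n) *\<^sub>v u"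

lemma row_vec_carrier [simp]: "row_vec n \<in> carrier_vec d"
  unfolding row_vec_def by (rule mult_mat_vec_carrier[of _ d d]) auto

text \<open>Appending a digit to the expansion of n. The case n = j = 0 is excluded because the
  expansion of 0 is the empty word and not the one-letter word 0.\<close>

lemma row_vec_step:
  assumes "j < k" "0 < k * n + j"
  shows "row_vec (k * n + j) = transpose_mat (A j) *\<^sub>v row_vec n"
proof -
  have "(k * n + j) div k = n" "(k * n + j) mod k = j" using assms by auto
  then have "digit_mat k d A (k * n + j) = digit_mat k d A n * A j"
    using assms k2 by (subst digit_mat.simps) auto
  then show ?thesis unfolding row_vec_def
    using transpose_mult[OF digit_mat_carrier[of n] A_carrier[OF assms(1)]] assms digit_mat_carrier[of n] A_carrier[OF assms(1)]
    by (simp add: assoc_mult_mat_vec[of _ d d _ d])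
qed

lemma seq_eq_row_vec: "f n = row_vec n \<bullet> v"
proof -
  have "f n = u \<bullet> (digit_mat k d A n *\<^sub>v v)" using lr by (simp add: linear_rep_def)
  also have "\<dots> = row_vec n \<bullet> v"
    unfolding row_vec_def
    by (rule transpose_vec_mult_scalar[symmetric, of _ d d]) auto
  finally show ?thesis .
qed

abbreviation V where "V \<equiv> reach_space k d u A"
abbreviation Prj where "Prj \<equiv> orth_proj d V"
abbreviation T where "T \<equiv> total_mat k d A"
abbreviation M where "M \<equiv> restr_mat k d u A T"

lemma reach_space_eq: "V = LinearCombinations.module.span class_ring (module_vec TYPE(real) d) (row_vec ` {1..})"
  by (auto simp: reach_space_def row_vec_def intro!: arg_cong[where f = "LinearCombinations.module.span _ _"])

lemma reach_space_carrier: "V \<subseteq> carrier_vec d"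
  and reach_space_add: "\<And>x y. x \<in> V \<Longrightarrow> y \<in> V \<Longrightarrow> x + y \<in> V"
  and reach_space_smult: "\<And>c x. x \<in> V \<Longrightarrow> c \<cdot>\<^sub>v x \<in> V"
  and reach_space_zero: "0\<^sub>v d \<in> V"
  and orth_compl_reach_space: "orth_compl d V = {x \<in> carrier_vec d. \<forall>n\<ge>1. row_vec n \<bullet> x = 0}"
proof -
  interpret W: vec_space "TYPE(real)" d .
  have c: "row_vec ` {1..} \<subseteq> carrier_vec d" by auto
  have VV: "V = W.span (row_vec ` {1..})" by (simp add: reach_space_eq)
  show "V \<subseteq> carrier_vec d" using c unfolding VV by (rule W.span_closed[THEN subsetI])
  show "x + y \<in> V" if "x \<in> V" "y \<in> V" for x y
    using that c unfolding VV by (intro W.span_add1) auto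
  show "c \<cdot>\<^sub>v x \<in> V" if "x \<in> V" for c x
    using that c unfolding VV by (intro W.smult_in_span) auto
  show "0\<^sub>v d \<in> V"
    using W.span_zero unfolding VV by simp
  show "orth_compl d V = {x \<in> carrier_vec d. \<forall>n\<ge>1. row_vec n \<bullet> x = 0}"
    unfolding VV W.in_orthogonal_complement_span[OF c]
    by (auto simp: W.orthogonal_complement_def comm_scalar_prod[of _ d])
qed

lemma orth_proj_props:
  shows orth_proj_carrier [simp]: "Prj \<in> carrier_mat d d"
    and orth_proj_in: "\<And>x. x \<in> carrier_vec d \<Longrightarrow> Prj *\<^sub>v x \<in> V"
    and orth_proj_perp: "\<And>x. x \<in> carrier_vec d \<Longrightarrow> x - Prj *\<^sub>v x \<in> orth_compl d V"
proof -
  let ?Q = "\<lambda>P. P \<in> carrier_mat d d \<and>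
     (\<forall>x\<in>carrier_vec d. P *\<^sub>v x \<in> V \<and> x - P *\<^sub>v x \<in> orth_compl d V)"
  obtain P where P: "?Q P"
    using orth_proj_exists[OF reach_space_carrier reach_space_zero reach_space_add reach_space_smult] by blast
  have "?Q Prj" unfolding orth_proj_def
  proof (rule theI[of ?Q, OF P])
    fix Q assume "?Q Q"
    then show "Q = P"
      using orth_proj_unique[OF reach_space_carrier reach_space_add reach_space_smult, of Q P] P by blast
  qed
  then show "Prj \<in> carrier_mat d d" "\<And>x. x \<in> carrier_vec d \<Longrightarrow> Prj *\<^sub>v x \<in> V"
    "\<And>x. x \<in> carrier_vec d \<Longrightarrow> x - Prj *\<^sub>v x \<in> orth_compl d V" by blast+
qed

lemma orth_compl_Int: "x \<in> V \<Longrightarrow> x \<in> orth_compl d V \<Longrightarrow> x = 0\<^sub>v d"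
  by (rule scalar_prod_self_eq_0[of _ d]) (auto simp: vec_module.orthogonal_complement_def)

lemma orth_compl_closed:
  assumes "x \<in> orth_compl d V" "y \<in> orth_compl d V"
  shows "x + y \<in> orth_compl d V" "x - y \<in> orth_compl d V"
  using assms unfolding orth_compl_reach_space
  by (auto simp: scalar_prod_add_distrib[of _ d] scalar_prod_minus_distrib[of _ d])

lemma orth_proj_fix:
  assumes "x \<in> V" shows "Prj *\<^sub>v x = x"
proof -
  have x: "x \<in> carrier_vec d" using assms reach_space_carrier by auto
  have "x - Prj *\<^sub>v x = x + (-1) \<cdot>\<^sub>v (Prj *\<^sub>v x)" using x orth_proj_carrier by (intro eq_vecI) auto
  then have "x - Prj *\<^sub>v x \<in> V"
    using reach_space_add[OF assms reach_space_smult[OF orth_proj_in[OF x]], of "-1"] by simp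
  then have z: "x - Prj *\<^sub>v x = 0\<^sub>v d" using orth_compl_Int orth_proj_perp[OF x] by blast
  show ?thesis
  proof (rule eq_vecI)
    fix i assume i: "i < dim_vec x"
    then have "(x - Prj *\<^sub>v x) $ i = 0" using z x by auto
    moreover have "dim_row Prj = d" using orth_proj_carrier by blast
    ultimately show "(Prj *\<^sub>v x) $ i = x $ i" using i x by (simp del: index_mult_mat_vec)
  qed (use x carrier_matD(1)[OF orth_proj_carrier] in auto)
qed

lemma orth_proj_zero:
  assumes "x \<in> orth_compl d V" shows "Prj *\<^sub>v x = 0\<^sub>v d"
proof -
  have x: "x \<in> carrier_vec d" using assms by (simp add: orth_compl_reach_space)
  have "Prj *\<^sub>v x = x - (x - Prj *\<^sub>v x)" using x orth_proj_carrier by (intro eq_vecI) auto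
  then have "Prj *\<^sub>v x \<in> orth_compl d V"
    using orth_compl_closed(2)[OF assms orth_proj_perp[OF x]] by simp
  then show ?thesis using orth_compl_Int orth_proj_in[OF x] by blast
qed

text \<open>Rows with n >= 1 span V, so the component removed by the projection is orthogonal to
  them. The row of n = 0 need not lie in V, hence the condition on n in everything that
  follows.\<close>

lemma row_vec_orth_proj:
  assumes "n \<ge> 1" "x \<in> carrier_vec d"
  shows "row_vec n \<bullet> (Prj *\<^sub>v x) = row_vec n \<bullet> x"
proof -
  have "row_vec n \<bullet> (x - Prj *\<^sub>v x) = 0"
    using orth_proj_perp[OF assms(2)] assms(1) by (simp add: orth_compl_reach_space)
  moreover have "Prj *\<^sub>v x \<in> carrier_vec d"
    using orth_proj_carrier assms(2) by (rule mult_mat_vec_carrier)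
  ultimately show ?thesis
    using assms(2) by (simp add: scalar_prod_minus_distrib[of _ d])
qed

lemma total_mat_carrier [simp]: "T \<in> carrier_mat d d" by (simp add: total_mat_def)

lemma restr_carrier [simp]: "X \<in> carrier_mat d d \<Longrightarrow> restr_mat k d u A X \<in> carrier_mat d d"
  unfolding restr_mat_def using orth_proj_carrier by (intro mult_carrier_mat)

lemma row_vec_total:
  assumes "y \<in> carrier_vec d" "x \<in> carrier_vec d"
  shows "y \<bullet> (T *\<^sub>v x) = (\<Sum>j<k. y \<bullet> (A j *\<^sub>v x))"
proof -
  have "(T *\<^sub>v x) $ i = (\<Sum>j<k. (A j *\<^sub>v x) $ i)" if "i < d" for i
  proof -
    have "(T *\<^sub>v x) $ i = (\<Sum>l<d. (\<Sum>j<k. A j $$ (i, l)) * x $ l)"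
      using that assms by (simp add: total_mat_def scalar_prod_def lessThan_atLeast0)
    also have "\<dots> = (\<Sum>j<k. \<Sum>l<d. A j $$ (i, l) * x $ l)"
      unfolding sum_distrib_right by (rule sum.swap)
    also have "\<dots> = (\<Sum>j<k. (A j *\<^sub>v x) $ i)"
    proof (rule sum.cong[OF refl])
      fix j assume "j \<in> {..<k}"
      then have "A j \<in> carrier_mat d d" by simp
      then show "(\<Sum>l<d. A j $$ (i, l) * x $ l) = (A j *\<^sub>v x) $ i"
        using that assms by (simp add: scalar_prod_def lessThan_atLeast0)
    qed
    finally show ?thesis .
  qed
  then have "y \<bullet> (T *\<^sub>v x) = (\<Sum>i<d. \<Sum>j<k. y $ i * (A j *\<^sub>v x) $ i)"
    by (simp add: scalar_prod_def lessThan_atLeast0 sum_distrib_left total_mat_def)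
  also have "\<dots> = (\<Sum>j<k. \<Sum>i<d. y $ i * (A j *\<^sub>v x) $ i)" by (rule sum.swap)
  also have "\<dots> = (\<Sum>j<k. y \<bullet> (A j *\<^sub>v x))"
  proof (rule sum.cong[OF refl])
    fix j assume "j \<in> {..<k}"
    then have "A j \<in> carrier_mat d d" by simp
    then show "(\<Sum>i<d. y $ i * (A j *\<^sub>v x) $ i) = y \<bullet> (A j *\<^sub>v x)"
      using assms by (simp add: scalar_prod_def lessThan_atLeast0)
  qed
  finally show ?thesis .
qed

lemma row_vec_A:
  assumes "j < k" "0 < k * n + j" "x \<in> carrier_vec d"
  shows "row_vec n \<bullet> (A j *\<^sub>v x) = row_vec (k * n + j) \<bullet> x"
  unfolding row_vec_step[OF assms(1,2)]
  by (rule transpose_vec_mult_scalar[symmetric, of _ d d]) (use assms in auto)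

text \<open>Both projections in \<open>M\<close> disappear: the left one because row n lies in V,
  the right one because the rows of all kn + j lie in V. What remains is the sum over all ways to
  append one digit.\<close>

lemma row_vec_restr:
  assumes n: "n \<ge> 1" and x: "x \<in> carrier_vec d"
  shows "row_vec n \<bullet> (M *\<^sub>v x) = (\<Sum>j<k. row_vec (k * n + j) \<bullet> x)"
proof -
  have Px: "Prj *\<^sub>v x \<in> carrier_vec d" using orth_proj_carrier x by (rule mult_mat_vec_carrier)
  have TPx: "T *\<^sub>v (Prj *\<^sub>v x) \<in> carrier_vec d" using total_mat_carrier Px by (rule mult_mat_vec_carrier)
  have "M *\<^sub>v x = Prj *\<^sub>v (T *\<^sub>v (Prj *\<^sub>v x))"
    unfolding restr_mat_def
    using assoc_mult_mat_vec[OF mult_carrier_mat[OF orth_proj_carrier total_mat_carrier] orth_proj_carrier x]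
      assoc_mult_mat_vec[OF orth_proj_carrier total_mat_carrier Px] by simp
  then have "row_vec n \<bullet> (M *\<^sub>v x) = row_vec n \<bullet> (T *\<^sub>v (Prj *\<^sub>v x))"
    using row_vec_orth_proj[OF n TPx] by simp
  also have "\<dots> = (\<Sum>j<k. row_vec n \<bullet> (A j *\<^sub>v (Prj *\<^sub>v x)))"
    by (rule row_vec_total) (use Px in auto)
  also have "\<dots> = (\<Sum>j<k. row_vec (k * n + j) \<bullet> x)"
  proof (rule sum.cong[OF refl])
    fix j assume "j \<in> {..<k}"
    moreover have "k * n + j \<ge> 1" using n k2 by (metis One_nat_def Suc_le_eq add_gr_0 le_trans nat_0_less_mult_iff pos2)
    ultimately show "row_vec n \<bullet> (A j *\<^sub>v (Prj *\<^sub>v x)) = row_vec (k * n + j) \<bullet> x"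
      using row_vec_A[OF _ _ Px, of j n] row_vec_orth_proj[of "k * n + j" x] x by (simp del: add_gr_0)
  qed
  finally show ?thesis .
qed

lemma pow_mult_vec_carrier: "x \<in> carrier_vec d \<Longrightarrow> M ^\<^sub>m N *\<^sub>v x \<in> carrier_vec d"
  by (intro mult_mat_vec_carrier pow_carrier_mat restr_carrier) auto

text \<open>One factor \<open>M\<close> is split off on the left, next to the row, so that the new
  digit j joins the prefix and the induction hypothesis applies to kn + j. The pair (j, r) then runs
  through all words of \<open>Suc N\<close> digits.\<close>

lemma row_vec_pow:
  assumes n: "n \<ge> 1" and x: "x \<in> carrier_vec d"
  shows "row_vec n \<bullet> (M ^\<^sub>m N *\<^sub>v x) = (\<Sum>r<k ^ N. row_vec (n * k ^ N + r) \<bullet> x)"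
  using n
proof (induction N arbitrary: n)
  case 0
  have "dim_row M = d" using restr_carrier[OF total_mat_carrier] by blast
  then show ?case using x by simp
next
  case (Suc N)
  have Mc: "M \<in> carrier_mat d d" by simp
  have "M ^\<^sub>m Suc N *\<^sub>v x = M *\<^sub>v (M ^\<^sub>m N *\<^sub>v x)"
    using Mc x pow_carrier_mat[OF Mc]
    by (simp only: pow_mat_Suc_left[OF Mc] assoc_mult_mat_vec[of _ d d _ d])
  then have "row_vec n \<bullet> (M ^\<^sub>m Suc N *\<^sub>v x) = (\<Sum>j<k. row_vec (k * n + j) \<bullet> (M ^\<^sub>m N *\<^sub>v x))"
    using row_vec_restr[OF Suc.prems pow_mult_vec_carrier[OF x]] by simp
  also have "\<dots> = (\<Sum>j<k. \<Sum>r<k ^ N. row_vec (n * k ^ Suc N + (j * k ^ N + r)) \<bullet> x)"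
  proof (rule sum.cong[OF refl])
    fix j
    have "k * n + j \<ge> 1" using Suc.prems k2 by (metis One_nat_def Suc_le_eq add_gr_0 le_trans nat_0_less_mult_iff pos2)
    from Suc.IH[OF this] show "row_vec (k * n + j) \<bullet> (M ^\<^sub>m N *\<^sub>v x)
      = (\<Sum>r<k ^ N. row_vec (n * k ^ Suc N + (j * k ^ N + r)) \<bullet> x)"
      by (simp add: algebra_simps)
  qed
  also have "\<dots> = (\<Sum>r<k ^ Suc N. row_vec (n * k ^ Suc N + r) \<bullet> x)"
    using sum_prefix_blocks[of 0 k "\<lambda>r. row_vec (n * k ^ Suc N + r) \<bullet> x" "k ^ N"] by (simp add: lessThan_atLeast0)
  finally show ?case .
qed

lemma row_vec_pow_v:
  "n \<ge> 1 \<Longrightarrow> row_vec n \<bullet> (M ^\<^sub>m N *\<^sub>v v) = (\<Sum>r<k ^ N. f (n * k ^ N + r))"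
  by (simp add: row_vec_pow seq_eq_row_vec)

end


section \<open>Powers of Jordan matrices\<close>

text \<open>Induction over the list of blocks. The first alternative covers positions off the blocks
  or below the diagonal; in the second, j - i < m links the binomial degree to a block size. For N <
  j - i the subtraction in the exponent truncates, but then the binomial coefficient is 0.\<close>

lemma jordan_matrix_entries:
  fixes n_as :: "(nat \<times> complex) list"
  defines "J \<equiv> jordan_matrix n_as" and "n \<equiv> sum_list (map fst n_as)"
  assumes "i < n" "j < n"
  shows "(\<forall>N. (J ^\<^sub>m N) $$ (i, j) = 0) \<or>
    (\<exists>m. (m, J $$ (j, j)) \<in> set n_as \<and> J $$ (i, i) = J $$ (j, j) \<and> i \<le> j \<and> j - i < m \<and>
      (\<forall>N. (J ^\<^sub>m N) $$ (i, j) = of_nat (N choose (j - i)) * J $$ (j, j) ^ (N + i - j)))"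
  using assms(3,4) unfolding J_def n_def
proof (induction n_as arbitrary: i j)
  case Nil then show ?case by simp
next
  case (Cons na n_as)
  obtain m a where na: "na = (m, a)" by (cases na)
  define J' where "J' = jordan_matrix n_as"
  define n' where "n' = sum_list (map fst n_as)"
  have J': "J' ^\<^sub>m N \<in> carrier_mat n' n'" for N unfolding J'_def n'_def by simp
  have pow: "jordan_matrix (na # n_as) ^\<^sub>m N = four_block_mat (jordan_block m a ^\<^sub>m N) (0\<^sub>m m n') (0\<^sub>m n' m) (J' ^\<^sub>m N)" for N
  proof -
    have dims: "dim_row (diag_block_mat (map (\<lambda>(n, a). jordan_block n a ^\<^sub>m N) n_as)) = n'"
      "dim_col (diag_block_mat (map (\<lambda>(n, a). jordan_block n a ^\<^sub>m N) n_as)) = n'"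
      using J'[of N] unfolding J'_def jordan_matrix_pow by auto
    show ?thesis
      unfolding jordan_matrix_pow J'_def na by (simp add: Let_def dims)
  qed
  have diag: "jordan_matrix (na # n_as) = four_block_mat (jordan_block m a) (0\<^sub>m m n') (0\<^sub>m n' m) J'"
    unfolding na J'_def n'_def by (rule jordan_matrix_Cons)
  have J'1: "dim_row J' = n'" "dim_col J' = n'" unfolding J'_def n'_def by simp_all
  have ent: "(jordan_matrix (na # n_as) ^\<^sub>m N) $$ (i, j) =
      (if i < m then if j < m then (jordan_block m a ^\<^sub>m N) $$ (i, j) else 0
       else if j < m then 0 else (J' ^\<^sub>m N) $$ (i - m, j - m))" for N
    using Cons.prems carrier_matD[OF J'[of N]] J'1 unfolding pow by (auto simp: na n'_def[symmetric])
  have dg: "jordan_matrix (na # n_as) $$ (l, l) = (if l < m then a else J' $$ (l - m, l - m))"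
    if "l < m + n'" for l
    using that J'1 unfolding diag by auto
  have ij: "i < m + n'" "j < m + n'" using Cons.prems by (auto simp: na n'_def)
  consider "i < m" "j < m" | "i < m" "\<not> j < m" | "\<not> i < m" "j < m" | "\<not> i < m" "\<not> j < m" by blast
  then show ?case
  proof cases
    case 1
    show ?thesis
    proof (cases "i \<le> j")
      case True
      then show ?thesis
        using 1 by (intro disjI2 exI[of _ m]) (auto simp: ent[unfolded na] dg[unfolded na] na jordan_block_pow)
    next
      case False
      then show ?thesis using 1 by (intro disjI1) (auto simp: ent jordan_block_pow)
    qed
  next
    case 4
    then have "i - m < n'" "j - m < n'" using ij by auto
    from Cons.IH[of "i - m" "j - m"] this
    have "(\<forall>N. (J' ^\<^sub>m N) $$ (i - m, j - m) = 0) \<or>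
      (\<exists>m'. (m', J' $$ (j - m, j - m)) \<in> set n_as \<and> J' $$ (i - m, i - m) = J' $$ (j - m, j - m) \<and>
        i - m \<le> j - m \<and> j - m - (i - m) < m' \<and>
       (\<forall>N. (J' ^\<^sub>m N) $$ (i - m, j - m) =
          of_nat (N choose (j - m - (i - m))) * J' $$ (j - m, j - m) ^ (N + (i - m) - (j - m))))"
      unfolding J'_def n'_def by blast
    then show ?thesis
    proof
      assume "\<forall>N. (J' ^\<^sub>m N) $$ (i - m, j - m) = 0"
      then show ?thesis using 4 by (intro disjI1) (simp add: ent)
    next
      assume "\<exists>m'. (m', J' $$ (j - m, j - m)) \<in> set n_as \<and> J' $$ (i - m, i - m) = J' $$ (j - m, j - m) \<and>
        i - m \<le> j - m \<and> j - m - (i - m) < m' \<and>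
       (\<forall>N. (J' ^\<^sub>m N) $$ (i - m, j - m) =
          of_nat (N choose (j - m - (i - m))) * J' $$ (j - m, j - m) ^ (N + (i - m) - (j - m)))"
      then obtain m' where m': "(m', J' $$ (j - m, j - m)) \<in> set n_as" "J' $$ (i - m, i - m) = J' $$ (j - m, j - m)"
        "i - m \<le> j - m" "j - m - (i - m) < m'"
        "\<And>N. (J' ^\<^sub>m N) $$ (i - m, j - m) =
          of_nat (N choose (j - m - (i - m))) * J' $$ (j - m, j - m) ^ (N + (i - m) - (j - m))" by blast
      have "j - m - (i - m) = j - i" "\<And>N. N + (i - m) - (j - m) = N + i - j" using 4 m'(3) by auto
      then show ?thesis
        using 4 m' ij by (intro disjI2 exI[of _ m']) (auto simp: ent dg)
    qed
  qed (simp_all add: ent)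
qed

lemma jordan_matrix_diag_mem:
  assumes "i < sum_list (map fst n_as)"
  shows "\<exists>m. (m, jordan_matrix n_as $$ (i, i)) \<in> set n_as"
  using assms
proof (induction n_as arbitrary: i)
  case (Cons na n_as)
  obtain m a where na: "na = (m, a)" by (cases na)
  have e: "jordan_matrix (na # n_as) $$ (i, i) = (if i < m then a else jordan_matrix n_as $$ (i - m, i - m))"
    using Cons.prems unfolding na jordan_matrix_Cons by auto
  show ?case
  proof (cases "i < m")
    case True then show ?thesis using e by (auto simp: na)
  next
    case False
    then have "i - m < sum_list (map fst n_as)" using Cons.prems by (auto simp: na)
    from Cons.IH[OF this] obtain m' where "(m', jordan_matrix n_as $$ (i - m, i - m)) \<in> set n_as" by blast
    then show ?thesis using False unfolding e by (intro exI[of _ m']) simp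
  qed
qed simp

lemma jordan_nf_eigenvalue:
  fixes B :: "complex mat"
  assumes B: "B \<in> carrier_mat d d" and J: "jordan_nf B n_as" and m: "(m, a) \<in> set n_as"
  shows "eigenvalue B a" "0 < m"
proof -
  show m0: "0 < m" using J m by (force simp: jordan_nf_def intro: gr0I)
  have "\<And>xs. (m, a) \<in> set xs \<Longrightarrow> poly (\<Prod>(n, a)\<leftarrow>xs. [:- a, 1:] ^ n) a = 0"
  proof -
    fix xs show "(m, a) \<in> set xs \<Longrightarrow> poly (\<Prod>(n, a)\<leftarrow>xs. [:- a, 1:] ^ n) a = 0"
      using m0 by (induction xs) auto
  qed
  from this[OF m] show "eigenvalue B a"
    using jordan_nf_char_poly[OF J] eigenvalue_root_char_poly[OF B] by simp
qed

section \<open>Asymptotics of matrix powers along residue classes\<close>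

lemma triple_product_entry:
  fixes S X Q :: "'a :: comm_semiring_0 mat"
  assumes "S \<in> carrier_mat d d" "X \<in> carrier_mat d d" "Q \<in> carrier_mat d d" "a < d" "b < d"
  shows "(S * X * Q) $$ (a, b) = (\<Sum>j<d. \<Sum>i<d. S $$ (a, i) * X $$ (i, j) * Q $$ (j, b))"
proof -
  have "(S * X * Q) $$ (a, b) = (\<Sum>j<d. (S * X) $$ (a, j) * Q $$ (j, b))"
    using assms by (simp add: times_mat_def scalar_prod_def lessThan_atLeast0)
  also have "\<dots> = (\<Sum>j<d. \<Sum>i<d. S $$ (a, i) * X $$ (i, j) * Q $$ (j, b))"
    using assms by (intro sum.cong refl) (simp add: times_mat_def scalar_prod_def lessThan_atLeast0 sum_distrib_right)
  finally show ?thesis .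
qed

text \<open>With y the e-th root of x, the sequence is the e-th power of n y^n, which is a null
  sequence.\<close>

lemma power_times_geometric_tendsto_0:
  fixes x :: real
  assumes "0 \<le> x" "x < 1"
  shows "(\<lambda>n. real n ^ e * x ^ n) \<longlonglongrightarrow> 0"
proof (cases "e = 0")
  case True then show ?thesis using assms by (simp add: LIMSEQ_power_zero)
next
  case False
  define y where "y = root e x"
  have y: "0 \<le> y" "y < 1" "y ^ e = x" using assms False by (auto simp: y_def)
  have "(\<lambda>n. real n * y ^ n) \<longlonglongrightarrow> 0"
    using powser_times_n_limit_0[of y] y by simp
  then have "(\<lambda>n. (real n * y ^ n) ^ e) \<longlonglongrightarrow> 0 ^ e" by (rule tendsto_power)
  moreover have "(real n * y ^ n) ^ e = real n ^ e * x ^ n" for n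
    by (simp add: y(3)[symmetric] power_mult_distrib power_mult[symmetric] mult.commute)
  ultimately show ?thesis using False by (simp add: power_0_left)
qed

lemma binomial_geometric_tendsto_0:
  fixes z :: complex
  assumes "cmod z < \<rho>"
  shows "(\<lambda>N. of_nat (N choose e) * z ^ (N - e) / of_real \<rho> ^ N) \<longlonglongrightarrow> 0"
proof -
  have \<rho>: "0 < \<rho>" using assms norm_ge_zero[of z] by linarith
  \<comment> \<open>The second argument keeps x positive when z = 0, so that x^(N-e) can be written
    as x^N / x^e.\<close>
  define x where "x = max (cmod z) (\<rho> / 2)"
  have x: "0 < x" "x < \<rho>" "cmod z \<le> x" using assms \<rho> by (auto simp: x_def)
  show ?thesis
  proof (rule Lim_null_comparison)
    show "\<forall>\<^sub>F N in sequentially. cmod (of_nat (N choose e) * z ^ (N - e) / of_real \<rho> ^ N)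
      \<le> (1 / x ^ e) * (real N ^ e * (x / \<rho>) ^ N)"
      using eventually_ge_at_top[of e]
    proof eventually_elim
      case (elim N)
      have "real (N choose e) \<le> real N ^ e"
        using binomial_le_pow[OF elim] by (metis of_nat_le_iff of_nat_power)
      moreover have "cmod z ^ (N - e) \<le> x ^ (N - e)" using x by (intro power_mono) auto
      ultimately have "real (N choose e) * cmod z ^ (N - e) / \<rho> ^ N \<le> real N ^ e * x ^ (N - e) / \<rho> ^ N"
        using \<rho> x by (intro divide_right_mono mult_mono) auto
      also have "x ^ (N - e) = x ^ N / x ^ e" using x elim by (simp add: power_diff)
      finally show ?case using \<rho> by (simp add: norm_mult norm_divide norm_power power_divide field_simps)
    qed
    have "(\<lambda>N. (1 / x ^ e) * (real N ^ e * (x / \<rho>) ^ N)) \<longlonglongrightarrow> (1 / x ^ e) * 0"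
      using x \<rho> by (intro tendsto_mult tendsto_const power_times_geometric_tendsto_0) auto
    then show "(\<lambda>N. (1 / x ^ e) * (real N ^ e * (x / \<rho>) ^ N)) \<longlonglongrightarrow> 0" by simp
  qed
qed

lemma power_ratio_tendsto:
  "i \<le> s \<Longrightarrow> (\<lambda>n. of_nat n ^ i / of_nat n ^ s :: complex) \<longlonglongrightarrow> (if i = s then 1 else 0)"
proof (cases "i = s")
  case True
  have "\<forall>\<^sub>F n in sequentially. (of_nat n ^ i / of_nat n ^ s :: complex) = 1"
    using eventually_gt_at_top[of 0] by eventually_elim (simp add: True)
  then show ?thesis using True by (simp add: tendsto_eventually)
next
  case False
  assume "i \<le> s"
  with False obtain e where e: "s = i + Suc e" by (metis add_Suc_right le_neq_implies_less less_imp_Suc_add)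
  have "(\<lambda>n. (inverse (of_nat n) :: complex) ^ Suc e) \<longlonglongrightarrow> 0 ^ Suc e"
    by (intro tendsto_power lim_inverse_n)
  moreover have "\<forall>\<^sub>F n in sequentially. (inverse (of_nat n) :: complex) ^ Suc e = of_nat n ^ i / of_nat n ^ s"
    using eventually_gt_at_top[of 0] by eventually_elim (simp add: e power_add field_simps)
  ultimately show ?thesis using False by (simp add: tendsto_cong)
qed

lemma poly_ratio_tendsto:
  fixes q :: "complex poly"
  assumes "degree q \<le> s"
  shows "(\<lambda>n. poly q (of_nat n) / of_nat n ^ s) \<longlonglongrightarrow> coeff q s"
proof -
  have "(\<lambda>n. \<Sum>i\<le>s. coeff q i * (of_nat n ^ i / of_nat n ^ s)) \<longlonglongrightarrow> (\<Sum>i\<le>s. coeff q i * (if i = s then 1 else 0))"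
    by (intro tendsto_sum tendsto_mult tendsto_const power_ratio_tendsto) auto
  moreover have "(\<Sum>i\<le>s. coeff q i * (of_nat n ^ i / of_nat n ^ s)) = poly q (of_nat n) / of_nat n ^ s" for n
  proof -
    have "poly q (of_nat n) = (\<Sum>i\<le>s. coeff q i * of_nat n ^ i)"
      unfolding poly_altdef using assms
      by (intro sum.mono_neutral_left) (auto simp: coeff_eq_0)
    then show ?thesis by (simp add: sum_divide_distrib)
  qed
  ultimately show ?thesis by (simp add: if_distrib cong: if_cong)
qed

text \<open>If the degree D exceeded s, division by n^D would send the values both to the leading
  coefficient and, by the bound, to 0.\<close>

lemma poly_bounded_ratio_convergent:
  fixes q :: "complex poly"
  assumes "\<forall>\<^sub>F n in sequentially. cmod (poly q (of_nat n)) \<le> C * real n ^ s"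
  shows "convergent (\<lambda>n. poly q (of_nat n) / of_nat n ^ s)"
proof -
  have "degree q \<le> s"
  proof (rule ccontr)
    assume "\<not> degree q \<le> s"
    then have D: "s < degree q" by simp
    have "(\<lambda>n. poly q (of_nat n) / of_nat n ^ degree q) \<longlonglongrightarrow> 0"
    proof (rule Lim_null_comparison)
      show "\<forall>\<^sub>F n in sequentially. cmod (poly q (of_nat n) / of_nat n ^ degree q) \<le> C * cmod (of_nat n ^ s / of_nat n ^ degree q)"
        using assms by eventually_elim (simp add: norm_divide norm_power divide_right_mono)
      have "(\<lambda>n. C * cmod (of_nat n ^ s / of_nat n ^ degree q)) \<longlonglongrightarrow> C * cmod 0"
        using power_ratio_tendsto[of s "degree q"] D by (intro tendsto_mult tendsto_const tendsto_norm) auto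
      then show "(\<lambda>n. C * cmod (of_nat n ^ s / of_nat n ^ degree q)) \<longlonglongrightarrow> 0" by simp
    qed
    with poly_ratio_tendsto[of q "degree q"] have "lead_coeff q = 0" using LIMSEQ_unique by blast
    then show False using D by simp
  qed
  then show ?thesis using poly_ratio_tendsto convergent_def by blast
qed

text \<open>The product formula for the generalised binomial coefficient holds for every n,
  including those with pn + j < e.\<close>

lemma binomial_poly:
  "\<exists>q :: complex poly. \<forall>n. of_nat ((p * n + j) choose e) = poly q (of_nat n)"
proof -
  define q :: "complex poly" where
    "q = Polynomial.smult (1 / fact e) (\<Prod>i = 0..<e. [:of_nat j - of_nat i, of_nat p:])"
  have "of_nat ((p * n + j) choose e) = poly q (of_nat n)" for n
    by (simp add: q_def binomial_gbinomial gbinomial_prod_rev poly_prod algebra_simps)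
  then show ?thesis by blast
qed

lemma divide_ge_1_le: "1 \<le> c \<Longrightarrow> 0 \<le> a \<Longrightarrow> a / c \<le> (a :: real)"
  using mult_left_mono[of 1 c a] by (simp add: divide_le_eq)

text \<open>Polynomials up to a null sequence: once such a sequence is known to be bounded by
  \<open>n\<^sup>s\<close>, the polynomial has degree at most \<open>s\<close> and division by \<open>n\<^sup>s\<close> gives convergence.\<close>

definition poly_asymp :: "(nat \<Rightarrow> complex) \<Rightarrow> bool" where
  "poly_asymp g \<longleftrightarrow> (\<exists>q. (\<lambda>n. g n - poly q (of_nat n)) \<longlonglongrightarrow> 0)"

lemma poly_asymp_0: "g \<longlonglongrightarrow> 0 \<Longrightarrow> poly_asymp g"
  unfolding poly_asymp_def by (rule exI[of _ 0]) simp

lemma poly_asymp_cmult: "poly_asymp g \<Longrightarrow> poly_asymp (\<lambda>n. c * g n)"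
  unfolding poly_asymp_def
proof (elim exE)
  fix q assume "(\<lambda>n. g n - poly q (of_nat n)) \<longlonglongrightarrow> 0"
  from tendsto_mult_left[OF this, of c]
  show "\<exists>q. (\<lambda>n. c * g n - poly q (of_nat n)) \<longlonglongrightarrow> 0"
    by (intro exI[of _ "Polynomial.smult c q"]) (simp add: algebra_simps)
qed

lemma poly_asymp_add: "poly_asymp g \<Longrightarrow> poly_asymp h \<Longrightarrow> poly_asymp (\<lambda>n. g n + h n)"
  unfolding poly_asymp_def
proof (elim exE)
  fix q q' assume "(\<lambda>n. g n - poly q (of_nat n)) \<longlonglongrightarrow> 0" "(\<lambda>n. h n - poly q' (of_nat n)) \<longlonglongrightarrow> 0"
  from tendsto_add[OF this]
  show "\<exists>q. (\<lambda>n. g n + h n - poly q (of_nat n)) \<longlonglongrightarrow> 0"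
    by (intro exI[of _ "q + q'"]) (simp add: algebra_simps)
qed

lemma poly_asymp_sum: "finite I \<Longrightarrow> (\<And>i. i \<in> I \<Longrightarrow> poly_asymp (g i)) \<Longrightarrow> poly_asymp (\<lambda>n. \<Sum>i\<in>I. g i n)"
  by (induction I rule: finite_induct) (auto intro: poly_asymp_add poly_asymp_0)

lemma poly_asymp_convergent:
  assumes "poly_asymp g" "\<forall>\<^sub>F n in sequentially. cmod (g n) \<le> C * real n ^ s"
  shows "convergent (\<lambda>n. g n / of_nat n ^ s)"
proof -
  obtain q where q: "(\<lambda>n. g n - poly q (of_nat n)) \<longlonglongrightarrow> 0" using assms(1) by (auto simp: poly_asymp_def)
  have one: "(0 :: real) < 1" by simp
  have "\<forall>\<^sub>F n in sequentially. cmod (poly q (of_nat n)) \<le> (C + 1) * real n ^ s"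
    using assms(2) tendstoD[OF q one] eventually_ge_at_top[of 1]
  proof eventually_elim
    case (elim n)
    have "cmod (poly q (of_nat n)) \<le> cmod (g n) + cmod (g n - poly q (of_nat n))"
      using norm_triangle_sub[of "poly q (of_nat n)" "g n"] by (simp add: norm_minus_commute)
    also have "\<dots> \<le> C * real n ^ s + 1 * real n ^ s"
    proof -
      have "1 \<le> real n ^ s" using elim(3) by (intro one_le_power) simp
      moreover have "cmod (g n - poly q (of_nat n)) < 1" using elim(2) by (simp add: dist_norm)
      ultimately show ?thesis using elim(1) by linarith
    qed
    finally show ?case by (simp add: algebra_simps)
  qed
  then obtain l where l: "(\<lambda>n. poly q (of_nat n) / of_nat n ^ s) \<longlonglongrightarrow> l"
    using poly_bounded_ratio_convergent convergent_def by blast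
  have "(\<lambda>n. (g n - poly q (of_nat n)) / of_nat n ^ s) \<longlonglongrightarrow> 0"
  proof (rule Lim_null_comparison)
    show "\<forall>\<^sub>F n in sequentially. cmod ((g n - poly q (of_nat n)) / of_nat n ^ s) \<le> cmod (g n - poly q (of_nat n))"
      using eventually_ge_at_top[of 1]
    proof eventually_elim
      case (elim n)
      then have "1 \<le> real n ^ s" by simp
      then show ?case using divide_ge_1_le[of "real n ^ s"] by (simp add: norm_divide norm_power)
    qed
    show "(\<lambda>n. cmod (g n - poly q (of_nat n))) \<longlonglongrightarrow> 0" using q tendsto_norm_zero by blast
  qed
  from tendsto_add[OF this l] have "(\<lambda>n. g n / of_nat n ^ s) \<longlonglongrightarrow> l"
    by (simp add: diff_divide_distrib)
  then show ?thesis by (auto simp: convergent_def)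
qed

text \<open>Inside the circle of radius \<rho> the term is a null sequence. On the circle, z^p =
  \<rho>^p makes z^(pn) cancel against \<rho>^(pn), and the binomial coefficient times the constant
  z^j / z^e remains.\<close>

lemma binomial_geometric_poly_asymp:
  fixes z :: complex
  assumes \<rho>: "0 < \<rho>" and p: "0 < p" and z: "cmod z \<le> \<rho>" "cmod z = \<rho> \<Longrightarrow> z ^ p = of_real \<rho> ^ p"
  shows "poly_asymp (\<lambda>n. of_nat ((p * n + j) choose e) * z ^ (p * n + j - e) / of_real \<rho> ^ (p * n))"
proof (cases "cmod z = \<rho>")
  case False
  have "(\<lambda>N. of_nat (N choose e) * z ^ (N - e) / of_real \<rho> ^ N) \<longlonglongrightarrow> 0"
    using z(1) False by (intro binomial_geometric_tendsto_0) auto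
  moreover have "filterlim (\<lambda>n. p * n + j) sequentially sequentially"
    using p by (intro filterlim_subseq) (auto simp: strict_mono_def)
  ultimately have "(\<lambda>n. of_nat ((p * n + j) choose e) * z ^ (p * n + j - e) / of_real \<rho> ^ (p * n + j)) \<longlonglongrightarrow> 0"
    by (rule filterlim_compose)
  from tendsto_mult_left[OF this, of "of_real \<rho> ^ j"] show ?thesis
    using \<rho> by (intro poly_asymp_0) (simp add: power_add field_simps)
next
  case True
  then have z0: "z \<noteq> 0" using \<rho> by auto
  obtain q :: "complex poly" where q: "\<And>n. of_nat ((p * n + j) choose e) = poly q (of_nat n)"
    using binomial_poly by blast
  have "\<forall>\<^sub>F n in sequentially. of_nat ((p * n + j) choose e) * z ^ (p * n + j - e) / of_real \<rho> ^ (p * n)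
      - poly (Polynomial.smult (z ^ j / z ^ e) q) (of_nat n) = 0"
    using eventually_ge_at_top[of e]
  proof eventually_elim
    case (elim n)
    have "n \<le> p * n" using p by simp
    then have "e \<le> p * n + j" using elim by linarith
    then have "z ^ (p * n + j - e) = z ^ (p * n) * (z ^ j / z ^ e)" using z0 by (simp add: power_diff power_add)
    moreover have "z ^ (p * n) = of_real \<rho> ^ (p * n)" by (simp add: power_mult z(2)[OF True])
    ultimately show ?case using \<rho> by (simp add: q)
  qed
  then show ?thesis unfolding poly_asymp_def by (intro exI) (rule tendsto_eventually)
qed

lemma matrix_power_poly_asymp:
  fixes B :: "complex mat"
  assumes B: "B \<in> carrier_mat d d" and \<rho>: "0 < \<rho>" and p: "0 < p"
    and ev: "\<And>z. eigenvalue B z \<Longrightarrow> cmod z \<le> \<rho> \<and> (cmod z = \<rho> \<longrightarrow> z ^ p = of_real \<rho> ^ p)"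
    and ab: "a < d" "b < d"
  shows "poly_asymp (\<lambda>n. (B ^\<^sub>m (p * n + j)) $$ (a, b) / of_real \<rho> ^ (p * n))"
proof -
  obtain n_as where J: "jordan_nf B n_as"
    using jordan_nf_exists[OF B] char_poly_factorized[OF B] by blast
  define J' where "J' = jordan_matrix n_as"
  obtain S Q where w: "similar_mat_wit B J' S Q"
    using J unfolding jordan_nf_def similar_mat_def J'_def by blast
  note wd = similar_mat_witD2[OF B w]
  have dd: "d = sum_list (map fst n_as)" using wd(5) by (auto simp: J'_def)
  have Bp: "B ^\<^sub>m N = S * J' ^\<^sub>m N * Q" for N
    using similar_mat_wit_pow[OF w, of N] similar_mat_witD2[OF pow_carrier_mat[OF B]] by blast
  have ent: "poly_asymp (\<lambda>n. (J' ^\<^sub>m (p * n + j)) $$ (x, y) / of_real \<rho> ^ (p * n))" if "x < d" "y < d" for x y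
  proof -
    from jordan_matrix_entries[of x n_as y] that
    consider "\<And>N. (J' ^\<^sub>m N) $$ (x, y) = 0"
      | m where "(m, J' $$ (y, y)) \<in> set n_as" "x \<le> y"
       "\<And>N. (J' ^\<^sub>m N) $$ (x, y) = of_nat (N choose (y - x)) * J' $$ (y, y) ^ (N + x - y)"
      unfolding J'_def dd by blast
    then show ?thesis
    proof cases
      case 1 then show ?thesis by (intro poly_asymp_0) simp
    next
      case 2
      from ev[OF jordan_nf_eigenvalue(1)[OF B J 2(1)]]
      show ?thesis using binomial_geometric_poly_asymp[OF \<rho> p, of "J' $$ (y, y)" j "y - x"] 2(2,3) by simp
    qed
  qed
  have "(B ^\<^sub>m (p * n + j)) $$ (a, b) / of_real \<rho> ^ (p * n) =
     (\<Sum>y<d. \<Sum>x<d. (S $$ (a, x) * Q $$ (y, b)) * ((J' ^\<^sub>m (p * n + j)) $$ (x, y) / of_real \<rho> ^ (p * n)))" for n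
    unfolding Bp using triple_product_entry[of S d "J' ^\<^sub>m (p * n + j)" Q a b] wd ab
    by (simp add: sum_divide_distrib mult_ac)
  then show ?thesis
    by (simp only:) (intro poly_asymp_sum poly_asymp_cmult ent; simp)
qed


section \<open>Phase rotations in Jordan coordinates\<close>

text \<open>A fixed Jordan basis of \<open>B\<close>. The radius is a free parameter: besides the
  spectral radius it is also instantiated with a number above the moduli of all eigenvalues.\<close>

locale jordan_wit =
  fixes d :: nat and B S Q :: "complex mat" and n_as :: "(nat \<times> complex) list" and \<rho> :: real
  assumes B [simp]: "B \<in> carrier_mat d d"
    and jnf: "jordan_nf B n_as"
    and wit: "similar_mat_wit B (jordan_matrix n_as) S Q"
    and \<rho>_pos: "0 < \<rho>"
begin

abbreviation J where "J \<equiv> jordan_matrix n_as"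
definition ev where "ev i = J $$ (i, i)"

lemmas witD = similar_mat_witD2[OF B wit]
lemmas carriers [simp] = witD(5,6,7)

lemma dim_eq: "d = sum_list (map fst n_as)"
  using carrier_matD(1)[OF carriers(1)] by simp

lemma pow_eq: "B ^\<^sub>m N = S * J ^\<^sub>m N * Q"
  by (rule similar_mat_wit_pow_id[OF wit])

lemma J_entries:
  assumes "i < d" "j < d"
  shows "(\<forall>N. (J ^\<^sub>m N) $$ (i, j) = 0) \<or>
    (\<exists>m. (m, ev j) \<in> set n_as \<and> ev i = ev j \<and> i \<le> j \<and> j - i < m \<and>
      (\<forall>N. (J ^\<^sub>m N) $$ (i, j) = of_nat (N choose (j - i)) * ev j ^ (N + i - j)))"
  using jordan_matrix_entries[of i n_as j] assms unfolding ev_def dim_eq by blast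

lemma ev_eigenvalue: assumes "i < d" shows "eigenvalue B (ev i)"
  using jordan_matrix_diag_mem[of i n_as] assms jordan_nf_eigenvalue(1)[OF B jnf]
  unfolding ev_def dim_eq by blast

lemma J_nonzero:
  assumes "i < d" "j < d" "J $$ (i, j) \<noteq> 0"
  shows "ev i = ev j" "i \<le> j"
proof -
  have "J ^\<^sub>m 1 = J" using carriers(1) by simp
  then have "(J ^\<^sub>m 1) $$ (i, j) \<noteq> 0" using assms(3) by simp
  then show "ev i = ev j" "i \<le> j" using J_entries[OF assms(1,2)] by blast+
qed

lemma char_J_mult:
  assumes y: "y \<in> carrier_vec d" and i: "i < d"
  shows "(char_matrix J z *\<^sub>v y) $ i = (ev i - z) * y $ i + (\<Sum>j\<in>{..<d} - {i}. J $$ (i, j) * y $ j)"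
proof -
  have dJ: "dim_row J = d" "dim_col J = d" using carriers(1) by blast+
  have "(char_matrix J z *\<^sub>v y) $ i = (\<Sum>j<d. char_matrix J z $$ (i, j) * y $ j)"
    using i y dJ by (auto simp: char_matrix_def scalar_prod_def lessThan_atLeast0 intro!: sum.cong)
  also have "\<dots> = char_matrix J z $$ (i, i) * y $ i + (\<Sum>j\<in>{..<d} - {i}. char_matrix J z $$ (i, j) * y $ j)"
    using i by (subst sum.remove[of _ i]) auto
  also have "char_matrix J z $$ (i, i) = ev i - z" using i dJ by (simp add: char_matrix_def ev_def)
  also have "(\<Sum>j\<in>{..<d} - {i}. char_matrix J z $$ (i, j) * y $ j) = (\<Sum>j\<in>{..<d} - {i}. J $$ (i, j) * y $ j)"
    using i dJ by (intro sum.cong) (auto simp: char_matrix_def)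
  finally show ?thesis .
qed

lemma char_J_closed: "char_matrix J z \<in> carrier_mat d d" by simp

text \<open>The induction on the exponent shows that J - z maps y to a vector with the same
  property. Since J is upper triangular and couples only positions with equal eigenvalue, the
  coordinates with eigenvalue other than z then vanish one by one, from the last upwards.\<close>

lemma char_J_kernel_support:
  assumes "y \<in> carrier_vec d" "char_matrix J z ^\<^sub>m m *\<^sub>v y = 0\<^sub>v d" "i < d" "ev i \<noteq> z"
  shows "y $ i = 0"
  using assms
proof (induction m arbitrary: y i)
  case 0
  have "char_matrix J z ^\<^sub>m 0 *\<^sub>v y = y" using 0(1) char_J_closed[of z] by (simp add: carrier_matD[OF char_J_closed])
  then have "y = 0\<^sub>v d" using 0(2) by simp
  then show ?case using 0(3) by simp
next
  case (Suc m)
  let ?K = "char_matrix J z"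
  have Ky: "?K *\<^sub>v y \<in> carrier_vec d" using Suc.prems(1) char_J_closed by (rule mult_mat_vec_carrier[rotated])
  have "?K ^\<^sub>m Suc m *\<^sub>v y = ?K ^\<^sub>m m *\<^sub>v (?K *\<^sub>v y)"
    using Suc.prems(1) by (simp add: assoc_mult_mat_vec[OF pow_carrier_mat[OF char_J_closed] char_J_closed])
  then have "?K ^\<^sub>m m *\<^sub>v (?K *\<^sub>v y) = 0\<^sub>v d" using Suc.prems(2) by simp
  then have Kyi: "(?K *\<^sub>v y) $ i = 0" if "i < d" "ev i \<noteq> z" for i
    using Suc.IH[OF Ky] that by blast
  show ?case using Suc.prems(3,4)
  proof (induction "d - i" arbitrary: i rule: less_induct)
    case less
    have "(\<Sum>j\<in>{..<d} - {i}. J $$ (i, j) * y $ j) = 0"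
    proof (rule sum.neutral, intro ballI)
      fix j assume j: "j \<in> {..<d} - {i}"
      show "J $$ (i, j) * y $ j = 0"
      proof (cases "J $$ (i, j) = 0")
        case False
        have "ev j = ev i" "i < j" using J_nonzero[OF _ _ False] j less.prems(1) by auto
        then have "y $ j = 0" using less.hyps[of j] less.prems j by auto
        then show ?thesis by simp
      qed simp
    qed
    then have "(ev i - z) * y $ i = 0"
      using Kyi[OF less.prems] char_J_mult[OF Suc.prems(1) less.prems(1), of z] by simp
    then show ?case using less.prems by simp
  qed
qed

text \<open>Where the eigenvalue is z, the diagonal of J - z is 0 and the other entries only use
  coordinates further down. Each application therefore clears one more trailing coordinate.\<close>

lemma char_J_nilpotent:
  assumes "y \<in> carrier_vec d" "\<And>j. j < d \<Longrightarrow> c \<le> j \<or> ev j \<noteq> z \<Longrightarrow> y $ j = 0"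
  shows "char_matrix J z ^\<^sub>m c *\<^sub>v y = 0\<^sub>v d"
  using assms
proof (induction c arbitrary: y)
  case 0
  have "char_matrix J z ^\<^sub>m 0 *\<^sub>v y = y" using 0(1) char_J_closed[of z] by (simp add: carrier_matD[OF char_J_closed])
  moreover have "y = 0\<^sub>v d" using 0 by (intro eq_vecI) auto
  ultimately show ?case by simp
next
  case (Suc c)
  let ?K = "char_matrix J z"
  have Ky: "?K *\<^sub>v y \<in> carrier_vec d" using Suc.prems(1) char_J_closed by (rule mult_mat_vec_carrier[rotated])
  have e: "?K ^\<^sub>m Suc c *\<^sub>v y = ?K ^\<^sub>m c *\<^sub>v (?K *\<^sub>v y)"
    using Suc.prems(1) by (simp add: assoc_mult_mat_vec[OF pow_carrier_mat[OF char_J_closed] char_J_closed])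
  have "(?K *\<^sub>v y) $ i = 0" if i: "i < d" and c: "c \<le> i \<or> ev i \<noteq> z" for i
  proof -
    have "(ev i - z) * y $ i = 0"
      using Suc.prems(2)[OF i] c by (cases "ev i = z") auto
    moreover have "(\<Sum>j\<in>{..<d} - {i}. J $$ (i, j) * y $ j) = 0"
    proof (rule sum.neutral, intro ballI)
      fix j assume j: "j \<in> {..<d} - {i}"
      show "J $$ (i, j) * y $ j = 0"
      proof (cases "J $$ (i, j) = 0")
        case False
        have "ev j = ev i" "i < j" using J_nonzero[OF _ _ False] j i by auto
        then have "y $ j = 0" using Suc.prems(2)[of j] c j by auto
        then show ?thesis by simp
      qed simp
    qed
    ultimately show ?thesis using char_J_mult[OF Suc.prems(1) i, of z] by simp
  qed
  then show ?case unfolding e by (intro Suc.IH Ky)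
qed

lemma char_B_pow_mult:
  assumes "x \<in> carrier_vec d"
  shows "char_matrix B z ^\<^sub>m m *\<^sub>v x = S *\<^sub>v (char_matrix J z ^\<^sub>m m *\<^sub>v (Q *\<^sub>v x))"
proof -
  have "char_matrix B z ^\<^sub>m m = S * char_matrix J z ^\<^sub>m m * Q"
    using similar_mat_wit_char_matrix[OF wit] by (rule similar_mat_wit_pow_id)
  then show ?thesis using assms
    assoc_mult_mat_vec[OF mult_carrier_mat[OF carriers(2) pow_carrier_mat[OF char_J_closed]] carriers(3) assms]
    assoc_mult_mat_vec[OF carriers(2) pow_carrier_mat[OF char_J_closed] mult_mat_vec_carrier[OF carriers(3) assms]]
    by simp
qed

lemma QS: "x \<in> carrier_vec d \<Longrightarrow> Q *\<^sub>v (S *\<^sub>v x) = x"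
  and SQ: "x \<in> carrier_vec d \<Longrightarrow> S *\<^sub>v (Q *\<^sub>v x) = x"
  using assoc_mult_mat_vec[OF carriers(3,2), of x] assoc_mult_mat_vec[OF carriers(2,3), of x] witD(1,2) by simp_all

lemma gen_eigenspace_support:
  assumes "x \<in> gen_eigenspace d B z" "i < d" "ev i \<noteq> z"
  shows "(Q *\<^sub>v x) $ i = 0"
proof -
  obtain m where x: "x \<in> carrier_vec d" "char_matrix B z ^\<^sub>m m *\<^sub>v x = 0\<^sub>v d"
    using assms(1) by (auto simp: gen_eigenspace_def)
  have c: "char_matrix J z ^\<^sub>m m *\<^sub>v (Q *\<^sub>v x) \<in> carrier_vec d"
    by (intro mult_mat_vec_carrier[OF pow_carrier_mat[OF char_J_closed]] mult_mat_vec_carrier[OF carriers(3) x(1)])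
  have "char_matrix J z ^\<^sub>m m *\<^sub>v (Q *\<^sub>v x) = Q *\<^sub>v 0\<^sub>v d"
    using QS[OF c] x(2) unfolding char_B_pow_mult[OF x(1)] by simp
  also have "\<dots> = 0\<^sub>v d"
  proof (rule eq_vecI)
    fix i assume "i < dim_vec (0\<^sub>v d :: complex vec)"
    then show "(Q *\<^sub>v 0\<^sub>v d) $ i = 0\<^sub>v d $ i" using carrier_matD[OF carriers(3)] by (simp add: scalar_prod_def)
  qed (use carrier_matD[OF carriers(3)] in simp)
  finally show ?thesis
    using char_J_kernel_support[OF mult_mat_vec_carrier[OF carriers(3) x(1)] _ assms(2,3)] by blast
qed

text \<open>The columns of \<open>S\<close> form a basis of generalised eigenvectors. The exponent
  \<open>Suc i\<close> suffices because the i-th unit vector vanishes beyond position i.\<close>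

lemma S_unit_gen_eigenspace:
  assumes "i < d"
  shows "S *\<^sub>v unit_vec d i \<in> gen_eigenspace d B (ev i)"
proof -
  have c: "S *\<^sub>v unit_vec d i \<in> carrier_vec d" by (rule mult_mat_vec_carrier[OF carriers(2)]) simp
  have "char_matrix J (ev i) ^\<^sub>m Suc i *\<^sub>v unit_vec d i = 0\<^sub>v d"
    by (rule char_J_nilpotent) (use assms in auto)
  then have "char_matrix B (ev i) ^\<^sub>m Suc i *\<^sub>v (S *\<^sub>v unit_vec d i) = S *\<^sub>v 0\<^sub>v d"
    unfolding char_B_pow_mult[OF c] using QS[of "unit_vec d i"] by simp
  also have "\<dots> = 0\<^sub>v d"
  proof (rule eq_vecI)
    fix i assume "i < dim_vec (0\<^sub>v d :: complex vec)"
    then show "(S *\<^sub>v 0\<^sub>v d) $ i = 0\<^sub>v d $ i" using carrier_matD[OF carriers(2)] by (simp add: scalar_prod_def)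
  qed (use carrier_matD[OF carriers(2)] in simp)
  finally show ?thesis using c unfolding gen_eigenspace_def by blast
qed

text \<open>The scalar by which the rotation of h is to act on the generalised eigenspace of
  z.\<close>

definition phase_val :: "(complex \<Rightarrow> complex) \<Rightarrow> complex \<Rightarrow> complex" where
  "phase_val h z = (if cmod z = \<rho> then h (z / of_real \<rho>) else 1)"

definition diag_phase :: "(complex \<Rightarrow> complex) \<Rightarrow> complex mat" where
  "diag_phase h = Matrix.mat d d (\<lambda>(i, j). if i = j then phase_val h (ev i) else 0)"

definition rot :: "(complex \<Rightarrow> complex) \<Rightarrow> complex mat" where
  "rot h = S * diag_phase h * Q"

lemma diag_phase_carrier [simp]: "diag_phase h \<in> carrier_mat d d" by (simp add: diag_phase_def)
lemma rot_carrier [simp]: "rot h \<in> carrier_mat d d"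
  unfolding rot_def by (rule mult_carrier_mat[OF mult_carrier_mat[OF carriers(2) diag_phase_carrier] carriers(3)])

lemma diag_phase_mult:
  assumes "y \<in> carrier_vec d" "i < d"
  shows "(diag_phase h *\<^sub>v y) $ i = phase_val h (ev i) * y $ i"
  using assms by (simp add: diag_phase_def scalar_prod_def if_distrib[of "\<lambda>x. x * _"] cong: if_cong)

lemma rot_mult: "x \<in> carrier_vec d \<Longrightarrow> rot h *\<^sub>v x = S *\<^sub>v (diag_phase h *\<^sub>v (Q *\<^sub>v x))"
  unfolding rot_def
  by (simp add: assoc_mult_mat_vec[OF mult_carrier_mat[OF carriers(2) diag_phase_carrier] carriers(3)]
      assoc_mult_mat_vec[OF carriers(2) diag_phase_carrier mult_mat_vec_carrier[OF carriers(3)]])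

lemma rot_gen_eigenspace:
  assumes x: "x \<in> gen_eigenspace d B z"
  shows "rot h *\<^sub>v x = phase_val h z \<cdot>\<^sub>v x"
proof -
  have xc: "x \<in> carrier_vec d" using x by (simp add: gen_eigenspace_def)
  have Qx: "Q *\<^sub>v x \<in> carrier_vec d" by (rule mult_mat_vec_carrier[OF carriers(3) xc])
  have "diag_phase h *\<^sub>v (Q *\<^sub>v x) = phase_val h z \<cdot>\<^sub>v (Q *\<^sub>v x)"
  proof (rule eq_vecI)
    fix i assume "i < dim_vec (phase_val h z \<cdot>\<^sub>v (Q *\<^sub>v x))"
    then have i: "i < d" using carrier_matD(1)[OF carriers(3)] by simp
    have sm: "(phase_val h z \<cdot>\<^sub>v (Q *\<^sub>v x)) $ i = phase_val h z * (Q *\<^sub>v x) $ i"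
      using i carrier_matD(1)[OF carriers(3)] by (intro index_smult_vec) simp
    show "(diag_phase h *\<^sub>v (Q *\<^sub>v x)) $ i = (phase_val h z \<cdot>\<^sub>v (Q *\<^sub>v x)) $ i"
    proof (cases "ev i = z")
      case True then show ?thesis using diag_phase_mult[OF Qx i] sm by (simp only:)
    next
      case False
      then have "(Q *\<^sub>v x) $ i = 0" by (rule gen_eigenspace_support[OF x i])
      then show ?thesis using diag_phase_mult[OF Qx i, of h] sm by (simp only: mult_zero_right)
    qed
  qed (use carrier_vecD[OF Qx] carrier_matD[OF diag_phase_carrier] in simp)
  then have "rot h *\<^sub>v x = S *\<^sub>v (phase_val h z \<cdot>\<^sub>v (Q *\<^sub>v x))" using rot_mult[OF xc] by simp
  also have "\<dots> = phase_val h z \<cdot>\<^sub>v (S *\<^sub>v (Q *\<^sub>v x))"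
    by (rule mult_mat_vec[OF carriers(2) Qx])
  finally show ?thesis using SQ[OF xc] by simp
qed

text \<open>The columns of the invertible matrix \<open>S\<close> form a basis. These are the
  vectors on which the defining conditions of \<open>phase_rotation\<close> can be
  evaluated.\<close>

lemma rot_unique:
  assumes R: "R \<in> carrier_mat d d"
    and eq: "\<And>i. i < d \<Longrightarrow> R *\<^sub>v (S *\<^sub>v unit_vec d i) = rot h *\<^sub>v (S *\<^sub>v unit_vec d i)"
  shows "R = rot h"
proof -
  have "R * S = rot h * S"
  proof (rule eq_matI)
    fix i j assume "i < dim_row (rot h * S)" "j < dim_col (rot h * S)"
    then have ij: "i < d" "j < d" using carrier_matD[OF rot_carrier] carrier_matD[OF carriers(2)] by auto
    have cS: "S *\<^sub>v unit_vec d j = col S j" using ij carrier_matD[OF carriers(2)]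
      by (intro eq_vecI) auto
    have "(R *\<^sub>v col S j) $ i = (rot h *\<^sub>v col S j) $ i" using eq[OF ij(2)] cS by simp
    then show "(R * S) $$ (i, j) = (rot h * S) $$ (i, j)"
      using ij R carrier_matD[OF rot_carrier] carrier_matD[OF carriers(2)] by simp
  qed (use R carrier_matD[OF rot_carrier] in auto)
  then have "R * S * Q = rot h * S * Q" by simp
  then show ?thesis
    using assoc_mult_mat[OF R carriers(2,3)] assoc_mult_mat[OF rot_carrier carriers(2,3)] witD(1) R
     right_mult_one_mat[OF R] right_mult_one_mat[OF rot_carrier] by simp
qed

lemma conjugate_mult:
  assumes X: "X \<in> carrier_mat d d" and Y: "Y \<in> carrier_mat d d"
  shows "S * X * Q * (S * Y * Q) = S * (X * Y) * Q"
proof -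
  note c = carriers(2,3)
  have YQ: "Y * Q \<in> carrier_mat d d" and SX: "S * X \<in> carrier_mat d d"
    using mult_carrier_mat[OF Y c(2)] mult_carrier_mat[OF c(1) X] by blast+
  have "Q * (S * Y * Q) = Q * S * (Y * Q)"
    unfolding assoc_mult_mat[OF c(1) Y c(2)] by (rule assoc_mult_mat[OF c(2,1) YQ, symmetric])
  also have "\<dots> = Y * Q" unfolding witD(2) by (rule left_mult_one_mat[OF YQ])
  finally have "S * X * Q * (S * Y * Q) = S * X * (Y * Q)"
    using assoc_mult_mat[OF SX c(2) mult_carrier_mat[OF mult_carrier_mat[OF c(1) Y] c(2)]] by simp
  also have "\<dots> = S * (X * Y) * Q"
    unfolding assoc_mult_mat[OF SX Y c(2), symmetric] assoc_mult_mat[OF c(1) X Y] ..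
  finally show ?thesis .
qed

text \<open>Rotation and \<open>B\<close> are read in the same coordinates, where the rotation is
  diagonal and multiplies row i by a scalar.\<close>

lemma rot_pow_mult:
  "rot h ^\<^sub>m n * B ^\<^sub>m n = S * Matrix.mat d d (\<lambda>(i, j). phase_val h (ev i) ^ n * (J ^\<^sub>m n) $$ (i, j)) * Q"
proof -
  have Dn: "diag_phase h ^\<^sub>m n = Matrix.mat d d (\<lambda>(i, j). if i = j then phase_val h (ev i) ^ n else 0)" for n
  proof (induction n)
    case 0 then show ?case by (intro eq_matI) (auto simp: diag_phase_def)
  next
    case (Suc n)
    show ?case unfolding pow_mat.simps Suc
      by (intro eq_matI) (auto simp: diag_phase_def scalar_prod_def if_distrib[of "\<lambda>x. x * _"] if_distrib[of "\<lambda>x. _ * x"] cong: if_cong)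
  qed
  have w: "similar_mat_wit (rot h) (diag_phase h) S Q"
    by (rule similar_mat_witI[OF witD(1,2) rot_def rot_carrier diag_phase_carrier carriers(2,3)])
  have Rn: "rot h ^\<^sub>m n = S * diag_phase h ^\<^sub>m n * Q" by (rule similar_mat_wit_pow_id[OF w])
  have c: "diag_phase h ^\<^sub>m n \<in> carrier_mat d d" "J ^\<^sub>m n \<in> carrier_mat d d" by simp_all
  have "rot h ^\<^sub>m n * B ^\<^sub>m n = S * (diag_phase h ^\<^sub>m n * J ^\<^sub>m n) * Q"
    unfolding Rn pow_eq by (rule conjugate_mult[OF c])
  also have "diag_phase h ^\<^sub>m n * J ^\<^sub>m n = Matrix.mat d d (\<lambda>(i, j). phase_val h (ev i) ^ n * (J ^\<^sub>m n) $$ (i, j))"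
    unfolding Dn using carrier_matD[OF c(2)]
    by (intro eq_matI) (auto simp: scalar_prod_def if_distrib[of "\<lambda>x. x * _"] cong: if_cong)
  finally show ?thesis .
qed

lemma convergent_bounded_binomial:
  "e \<le> s \<Longrightarrow> convergent (\<lambda>n. of_nat (n choose e) / of_nat n ^ s :: complex)"
proof -
  assume e: "e \<le> s"
  obtain q :: "complex poly" where q: "\<And>n. of_nat ((1 * n + 0) choose e) = poly q (of_nat n)"
    using binomial_poly by blast
  have "\<forall>\<^sub>F n in sequentially. cmod (poly q (of_nat n)) \<le> 1 * real n ^ s"
    using eventually_ge_at_top[of "Suc e"]
  proof eventually_elim
    case (elim n)
    then have "real (n choose e) \<le> real n ^ e"
      using binomial_le_pow[of e n] by (metis Suc_leD of_nat_le_iff of_nat_power)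
    also have "\<dots> \<le> real n ^ s" using elim e by (intro power_increasing) auto
    finally show ?case unfolding q[symmetric] by simp
  qed
  from poly_bounded_ratio_convergent[OF this] show ?thesis unfolding q[symmetric] by simp
qed

text \<open>This convergence is what makes the \<^const>\<open>lim\<close> in \<^const>\<open>leading_part\<close> meaningful.\<close>

lemma rotated_growth_convergent:
  assumes h: "\<And>i. i < d \<Longrightarrow> cmod (ev i) = \<rho> \<Longrightarrow> h (ev i / of_real \<rho>) = inverse (ev i / of_real \<rho>)"
    and bound: "\<And>i. i < d \<Longrightarrow> cmod (ev i) \<le> \<rho>"
    and size: "\<And>m z. (m, z) \<in> set n_as \<Longrightarrow> cmod z = \<rho> \<Longrightarrow> m \<le> Suc s"
    and ij: "i < d" "j < d"
  shows "convergent (\<lambda>n. (rot h ^\<^sub>m n * B ^\<^sub>m n) $$ (i, j) / (of_nat n ^ s * of_real \<rho> ^ n))"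
proof -
  let ?X = "\<lambda>n. Matrix.mat d d (\<lambda>(i, j). phase_val h (ev i) ^ n * (J ^\<^sub>m n) $$ (i, j))"
  have conv: "convergent (\<lambda>n. phase_val h (ev x) ^ n * (J ^\<^sub>m n) $$ (x, y) / (of_nat n ^ s * of_real \<rho> ^ n))"
    if xy: "x < d" "y < d" for x y
  proof -
    from J_entries[OF xy] consider "\<And>N. (J ^\<^sub>m N) $$ (x, y) = 0"
      | m where "(m, ev y) \<in> set n_as" "ev x = ev y" "x \<le> y" "y - x < m"
        "\<And>N. (J ^\<^sub>m N) $$ (x, y) = of_nat (N choose (y - x)) * ev y ^ (N + x - y)" by blast
    then show ?thesis
    proof cases
      case 1 then show ?thesis by (simp add: convergent_const)
    next
      case 2
      define e where "e = y - x"
      have NE: "N + x - y = N - e" for N using 2(3) by (simp add: e_def)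
      show ?thesis
      proof (cases "cmod (ev y) = \<rho>")
        case True
        have e: "e \<le> s" using size[OF 2(1) True] 2(4) by (simp add: e_def)
        have y0: "ev y \<noteq> 0" using True \<rho>_pos by auto
        \<comment> \<open>The power of this factor turns ev^n into \<rho>^n. Without the rotation
          the peripheral entries would keep oscillating.\<close>
        have pv: "phase_val h (ev x) = of_real \<rho> / ev y" using True h[OF xy(2)] 2(2) by (simp add: phase_val_def)
        have "\<forall>\<^sub>F n in sequentially. (of_nat (n choose e) / of_nat n ^ s) * (1 / ev y ^ e)
            = phase_val h (ev x) ^ n * (J ^\<^sub>m n) $$ (x, y) / (of_nat n ^ s * of_real \<rho> ^ n)"
          using eventually_ge_at_top[of e]
        proof eventually_elim
          case (elim n)
          then have "ev y ^ (n - e) = ev y ^ n / ev y ^ e" using y0 by (simp add: power_diff)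
          then show ?case unfolding 2(5) NE pv e_def[symmetric] using y0 \<rho>_pos by (simp add: power_divide)
        qed
        moreover have "convergent (\<lambda>n. (of_nat (n choose e) / of_nat n ^ s) * (1 / ev y ^ e))"
          by (intro convergent_mult convergent_bounded_binomial e convergent_const)
        ultimately show ?thesis using convergent_cong by fast
      next
        case False
        then have lt: "cmod (ev y) < \<rho>" using bound[OF xy(2)] by simp
        have "(\<lambda>n. phase_val h (ev x) ^ n * (J ^\<^sub>m n) $$ (x, y) / (of_nat n ^ s * of_real \<rho> ^ n)) \<longlonglongrightarrow> 0"
        proof (rule Lim_null_comparison)
          show "\<forall>\<^sub>F n in sequentially. cmod (phase_val h (ev x) ^ n * (J ^\<^sub>m n) $$ (x, y) / (of_nat n ^ s * of_real \<rho> ^ n))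
            \<le> cmod (of_nat (n choose e) * ev y ^ (n - e) / of_real \<rho> ^ n)"
            using eventually_ge_at_top[of 1]
          proof eventually_elim
            case (elim n)
            have "1 \<le> real n ^ s" using elim by simp
            then have "a / (real n ^ s * \<rho> ^ n) \<le> a / \<rho> ^ n" if "0 \<le> a" for a
              using divide_ge_1_le[of "real n ^ s" "a / \<rho> ^ n"] that \<rho>_pos by (simp add: field_simps)
            then show ?case using False 2(2) \<rho>_pos
              unfolding 2(5) NE e_def[symmetric] by (simp add: phase_val_def norm_mult norm_divide norm_power)
          qed
          show "(\<lambda>n. cmod (of_nat (n choose e) * ev y ^ (n - e) / of_real \<rho> ^ n)) \<longlonglongrightarrow> 0"
            using binomial_geometric_tendsto_0[OF lt] by (rule tendsto_norm_zero)
        qed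
        then show ?thesis by (rule convergentI)
      qed
    qed
  qed
  have "(rot h ^\<^sub>m n * B ^\<^sub>m n) $$ (i, j) / (of_nat n ^ s * of_real \<rho> ^ n) =
     (\<Sum>y<d. \<Sum>x<d. (S $$ (i, x) * Q $$ (y, j)) *
        (phase_val h (ev x) ^ n * (J ^\<^sub>m n) $$ (x, y) / (of_nat n ^ s * of_real \<rho> ^ n)))" for n
    unfolding rot_pow_mult using triple_product_entry[of S d "?X n" Q i j] ij
    by (simp add: sum_divide_distrib mult_ac)
  then show ?thesis
    by (simp only:) (intro convergent_sum convergent_mult convergent_const conv; simp)
qed

end

section \<open>Limits of phase tuples, and the rotation of the restricted matrix\<close>

lemma tendsto_funI:
  fixes f :: "'b \<Rightarrow> 'a \<Rightarrow> 'c :: topological_space"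
  assumes "\<And>x. ((\<lambda>n. f n x) \<longlongrightarrow> l x) F"
  shows "(f \<longlongrightarrow> l) F"
  using limitin_componentwise[of "\<lambda>_. euclidean" UNIV f l F] assms
  by (simp add: euclidean_product_topology limitin_canonical_iff)

text \<open>Bolzano-Weierstrass, applied to one index after the other. It supplies the sequential
  compactness of the finite-dimensional torus of phases.\<close>

lemma finite_family_convergent_subseq:
  fixes x :: "'i \<Rightarrow> nat \<Rightarrow> complex"
  assumes "finite I" "\<And>i. i \<in> I \<Longrightarrow> bounded (range (x i))"
  shows "\<exists>r. strict_mono (r :: nat \<Rightarrow> nat) \<and> (\<forall>i\<in>I. convergent (x i \<circ> r))"
  using assms
proof (induction I rule: finite_induct)
  case empty then show ?case by (intro exI[of _ id]) (auto simp: strict_mono_def)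
next
  case (insert i I)
  then obtain r :: "nat \<Rightarrow> nat" where r: "strict_mono r" "\<forall>i\<in>I. convergent (x i \<circ> r)" by blast
  have "bounded (range (x i \<circ> r))"
    using insert.prems[of i] by (rule bounded_subset) auto
  then obtain l r' where r': "strict_mono (r' :: nat \<Rightarrow> nat)" "((x i \<circ> r) \<circ> r') \<longlonglongrightarrow> l"
    using bounded_imp_convergent_subsequence by blast
  have "convergent (x j \<circ> (r \<circ> r'))" if "j \<in> I" for j
  proof -
    obtain l' where "(x j \<circ> r) \<longlonglongrightarrow> l'" using r(2) \<open>j \<in> I\<close> by (auto simp: convergent_def)
    from LIMSEQ_subseq_LIMSEQ[OF this r'(1)] show ?thesis by (auto simp: convergent_def o_assoc)
  qed
  moreover have "convergent (x i \<circ> (r \<circ> r'))" using r'(2) by (auto simp: convergent_def o_assoc)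
  ultimately show ?case using strict_mono_o[OF r(1) r'(1)] by blast
qed

lemma jordan_nf_root_mem:
  fixes B :: "complex mat"
  assumes B: "B \<in> carrier_mat d d" and J: "jordan_nf B n_as" and z: "eigenvalue B z"
  shows "\<exists>m. (m, z) \<in> set n_as"
proof -
  have "\<And>xs. poly (\<Prod>(n, a)\<leftarrow>xs. [:- a, 1:] ^ n) z = 0 \<Longrightarrow> \<exists>m. (m, z) \<in> set xs"
  proof -
    fix xs show "poly (\<Prod>(n, a)\<leftarrow>xs. [:- a, 1:] ^ n) z = 0 \<Longrightarrow> \<exists>m. (m, z) \<in> set xs"
      by (induction xs) auto
  qed
  moreover have "poly (char_poly B) z = 0" using eigenvalue_root_char_poly[OF B] z by simp
  ultimately show ?thesis using jordan_nf_char_poly[OF J] by metis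
qed

lemma eigenvalue_le_spectral_radius:
  assumes B: "B \<in> carrier_mat d d" and z: "eigenvalue B z"
  shows "cmod z \<le> spectral_radius B"
  using spectral_radius_mem_max(2)[OF B eigenvalue_imp_nonzero_dim[OF B z]] z
  by (auto simp: spectrum_def)

text \<open>Block sizes are at most d, so the set in \<open>peripheral_block_size\<close> is finite
  and its \<open>Max\<close> bounds the peripheral blocks of whichever Jordan form is chosen. It is
  at least 1 because some eigenvalue attains the spectral radius.\<close>

lemma peripheral_jordan_nf:
  assumes B: "B \<in> carrier_mat d d" and d: "0 < d"
  shows "\<exists>n_as. jordan_nf B n_as \<and> 1 \<le> peripheral_block_size B \<and>
    (\<forall>m z. (m, z) \<in> set n_as \<longrightarrow> cmod z = spectral_radius B \<longrightarrow> m \<le> peripheral_block_size B)"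
proof -
  let ?O = "{m. \<exists>n_as ev. jordan_nf B n_as \<and> (m, ev) \<in> set n_as \<and> cmod ev = spectral_radius B}"
  have "?O \<subseteq> {..d}"
  proof
    fix m assume "m \<in> ?O"
    then obtain n_as ev where J: "jordan_nf B n_as" and m: "(m, ev) \<in> set n_as" by blast
    obtain S Q where "similar_mat_wit B (jordan_matrix n_as) S Q"
      using J unfolding jordan_nf_def similar_mat_def by blast
    from similar_mat_witD2(5)[OF B this] have "sum_list (map fst n_as) = d"
      by (metis carrier_matD(1) jordan_matrix_dim(1))
    moreover have "m \<le> sum_list (map fst n_as)" by (rule member_le_sum_list) (use m in force, simp)
    ultimately show "m \<in> {..d}" by simp
  qed
  then have fin: "finite ?O" using finite_subset by blast
  obtain n_as where J: "jordan_nf B n_as" using jordan_nf_exists[OF B] char_poly_factorized[OF B] by blast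
  obtain z where z: "eigenvalue B z" "cmod z = spectral_radius B"
    using spectral_radius_mem_max(1)[OF B d] by (auto simp: spectrum_def)
  obtain m where m: "(m, z) \<in> set n_as" using jordan_nf_root_mem[OF B J z(1)] by blast
  have le: "m' \<le> peripheral_block_size B" if "(m', z') \<in> set n_as" "cmod z' = spectral_radius B" for m' z'
    unfolding peripheral_block_size_def using that J by (intro Max_ge[OF fin]) blast
  have "1 \<le> peripheral_block_size B"
    using le[OF m z(2)] jordan_nf_eigenvalue(2)[OF B J m] by simp
  then show ?thesis using J le by blast
qed

lemma map_vec_Re_mult: "x \<in> carrier_vec d \<Longrightarrow> X \<in> carrier_mat d d \<Longrightarrow> map_vec Re (cmat X *\<^sub>v x) = X *\<^sub>v map_vec Re x"
  and map_vec_Im_mult: "x \<in> carrier_vec d \<Longrightarrow> X \<in> carrier_mat d d \<Longrightarrow> map_vec Im (cmat X *\<^sub>v x) = X *\<^sub>v map_vec Im x"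
  by (intro eq_vecI; auto simp: scalar_prod_def)+

lemma cvec_ReIm_0:
  assumes "x \<in> carrier_vec d" "map_vec Re x = 0\<^sub>v d" "map_vec Im x = 0\<^sub>v d"
  shows "x = 0\<^sub>v d"
proof (rule eq_vecI)
  fix i assume "i < dim_vec (0\<^sub>v d :: complex vec)"
  then have i: "i < d" by simp
  have "map_vec Re x $ i = 0" "map_vec Im x $ i = 0" using assms(2,3) i by simp_all
  then show "x $ i = 0\<^sub>v d $ i" using i assms(1) by (simp add: complex_eq_iff)
qed (use assms in simp)

lemma cmat_mult: "X \<in> carrier_mat d d \<Longrightarrow> Y \<in> carrier_mat d d \<Longrightarrow> cmat (X * Y) = cmat X * cmat Y"
  by (rule of_real_hom.mat_hom_mult)

lemma cmat_pow: "X \<in> carrier_mat d d \<Longrightarrow> cmat (X ^\<^sub>m n) = cmat X ^\<^sub>m n"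
  by (rule of_real_hom.mat_hom_pow)

lemma cvec_scalar_prod:
  "x \<in> carrier_vec d \<Longrightarrow> y \<in> carrier_vec d \<Longrightarrow> scalar_prod (cvec x) (cvec y) = of_real (scalar_prod x y)"
  by (simp add: scalar_prod_def)

lemma cmat_mult_vec:
  "X \<in> carrier_mat d d \<Longrightarrow> y \<in> carrier_vec d \<Longrightarrow> cmat X *\<^sub>v cvec y = cvec (X *\<^sub>v y)"
  by (intro eq_vecI) (auto simp: scalar_prod_def)

context lin_rep
begin

abbreviation cM where "cM \<equiv> cmat M"
abbreviation cP where "cP \<equiv> cmat Prj"

lemma cM_carrier [simp]: "cM \<in> carrier_mat d d" by simp
lemma cP_carrier [simp]: "cP \<in> carrier_mat d d" by simp

lemma Prj_idem: "Prj * Prj = Prj"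
proof (rule eq_matI)
  fix i j assume "i < dim_row Prj" "j < dim_col Prj"
  then have ij: "i < d" "j < d" using carrier_matD[OF orth_proj_carrier] by auto
  have u: "(unit_vec d j :: real vec) \<in> carrier_vec d" by simp
  have c: "Prj *\<^sub>v unit_vec d j = col Prj j" using ij carrier_matD[OF orth_proj_carrier] by (intro eq_vecI) auto
  have "Prj *\<^sub>v (Prj *\<^sub>v unit_vec d j) = Prj *\<^sub>v unit_vec d j"
    using orth_proj_fix[OF orth_proj_in[OF u]] .
  then have "(Prj *\<^sub>v col Prj j) $ i = col Prj j $ i" unfolding c by simp
  then show "(Prj * Prj) $$ (i, j) = Prj $$ (i, j)"
    using ij carrier_matD[OF orth_proj_carrier] by simp
qed (use carrier_matD[OF orth_proj_carrier] in auto)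

lemma Prj_M: "Prj * M = M" and M_Prj: "M * Prj = M"
proof -
  note P = orth_proj_carrier and Tc = total_mat_carrier
  have PT: "Prj * T \<in> carrier_mat d d" by (rule mult_carrier_mat[OF P Tc])
  have "Prj * (Prj * T) = Prj * T" using assoc_mult_mat[OF P P Tc] Prj_idem by simp
  then show "Prj * M = M" unfolding restr_mat_def using assoc_mult_mat[OF P PT P] by simp
  show "M * Prj = M" unfolding restr_mat_def using assoc_mult_mat[OF PT P P] Prj_idem by simp
qed

lemma cP_cM: "cP * cM = cM" and cM_cP: "cM * cP = cM"
  using cmat_mult[OF orth_proj_carrier restr_carrier[OF total_mat_carrier]]
    cmat_mult[OF restr_carrier[OF total_mat_carrier] orth_proj_carrier] Prj_M M_Prj by simp_all

lemma cP_complexify: "x \<in> carrier_vec d \<Longrightarrow> cP *\<^sub>v x \<in> complexify V"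
  by (simp add: complexify_def map_vec_Re_mult[of _ d] map_vec_Im_mult[of _ d] orth_proj_in)

lemma cP_complexify_perp:
  assumes x: "x \<in> carrier_vec d" shows "x - cP *\<^sub>v x \<in> complexify (orth_compl d V)"
proof -
  have c: "cP *\<^sub>v x \<in> carrier_vec d" by (rule mult_mat_vec_carrier[OF cP_carrier x])
  have "map_vec Re (x - cP *\<^sub>v x) = map_vec Re x - map_vec Re (cP *\<^sub>v x)"
    "map_vec Im (x - cP *\<^sub>v x) = map_vec Im x - map_vec Im (cP *\<^sub>v x)"
    using x c carrier_matD[OF cP_carrier] by (auto intro!: eq_vecI simp del: index_mult_mat_vec)
  then show ?thesis using x
    by (simp add: complexify_def map_vec_Re_mult[of _ d] map_vec_Im_mult[of _ d] orth_proj_perp)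
qed

lemma complexify_perp_kernel:
  assumes "x \<in> complexify (orth_compl d V)"
  shows "x \<in> carrier_vec d" "cM *\<^sub>v x = 0\<^sub>v d"
proof -
  have R: "map_vec Re x \<in> orth_compl d V" "map_vec Im x \<in> orth_compl d V"
    using assms by (auto simp: complexify_def)
  then have "map_vec Re x \<in> carrier_vec d" by (simp add: orth_compl_reach_space)
  then show x: "x \<in> carrier_vec d" by auto
  have "cP *\<^sub>v x = 0\<^sub>v d"
    using R x by (intro cvec_ReIm_0 mult_mat_vec_carrier[OF cP_carrier x])
      (simp_all add: map_vec_Re_mult[of _ d] map_vec_Im_mult[of _ d] orth_proj_zero)
  then have "cM *\<^sub>v x = cM *\<^sub>v 0\<^sub>v d"
    using assoc_mult_mat_vec[OF cM_carrier cP_carrier x] cM_cP by simp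
  also have "\<dots> = 0\<^sub>v d" by (intro eq_vecI) (auto simp: scalar_prod_def carrier_matD[OF restr_carrier[OF total_mat_carrier]])
  finally show "cM *\<^sub>v x = 0\<^sub>v d" .
qed

text \<open>A vector invisible to all rows lies in the complexified complement of V, where
  \<open>M\<close> is zero. This contradicts an eigenvalue z other than 0.\<close>

lemma eigenvector_detected:
  assumes x: "x \<in> carrier_vec d" "x \<noteq> 0\<^sub>v d" and e: "cM *\<^sub>v x = z \<cdot>\<^sub>v x" and z: "z \<noteq> 0"
  shows "\<exists>n\<ge>1. scalar_prod (cvec (row_vec n)) x \<noteq> 0"
proof (rule ccontr)
  assume "\<not> ?thesis"
  then have n: "scalar_prod (cvec (row_vec n)) x = 0" if "n \<ge> 1" for n using that by blast
  have sp: "scalar_prod (cvec (row_vec n)) x = (\<Sum>i<d. of_real (row_vec n $ i) * x $ i)" for n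
  proof -
    have "cvec (row_vec n) $ i = of_real (row_vec n $ i)" if "i < d" for i
      using index_map_vec(1)[of i "row_vec n" complex_of_real] that
      unfolding carrier_vecD[OF row_vec_carrier[of n]] by blast
    then show ?thesis using x(1) by (auto simp: scalar_prod_def lessThan_atLeast0 intro!: sum.cong)
  qed
  have "row_vec n \<bullet> map_vec Re x = Re (scalar_prod (cvec (row_vec n)) x)"
    "row_vec n \<bullet> map_vec Im x = Im (scalar_prod (cvec (row_vec n)) x)" for n
    unfolding sp using x(1) by (auto simp: scalar_prod_def lessThan_atLeast0 intro!: sum.cong)
  then have "x \<in> complexify (orth_compl d V)"
    using n x(1) by (simp add: complexify_def orth_compl_reach_space)
  then have "z \<cdot>\<^sub>v x = 0\<^sub>v d" using complexify_perp_kernel(2) e by simp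
  then have "\<forall>i<d. z * x $ i = 0" using x(1) by (metis carrier_vecD index_smult_vec(1) index_zero_vec(1))
  then have "x = 0\<^sub>v d" using z x(1) by (intro eq_vecI) auto
  then show False using x(2) by simp
qed

text \<open>\<open>M\<close> absorbs the projection on either side and therefore commutes with it.
  The lemma is needed because \<open>phase_rotation\<close> prescribes values only on the part of a
  generalised eigenspace inside V.\<close>

lemma cP_gen_eigenspace:
  assumes x: "x \<in> gen_eigenspace d cM z"
  shows "cP *\<^sub>v x \<in> gen_eigenspace d cM z"
proof -
  let ?K = "char_matrix cM z"
  have K: "?K \<in> carrier_mat d d" by simp
  have KP: "?K * cP = cP * ?K"
  proof -
    have "?K * cP = cM * cP + (- z) \<cdot>\<^sub>m (1\<^sub>m d * cP)"
      unfolding char_matrix_def using carrier_matD[OF cM_carrier]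
      by (simp add: add_mult_distrib_mat[of _ d d _ _ d] mult_smult_assoc_mat[of _ d d _ d])
    also have "\<dots> = cP * cM + (- z) \<cdot>\<^sub>m (cP * 1\<^sub>m d)"
      unfolding cP_cM cM_cP left_mult_one_mat[OF cP_carrier] right_mult_one_mat[OF cP_carrier] ..
    also have "\<dots> = cP * ?K"
      unfolding char_matrix_def using carrier_matD[OF cM_carrier]
      by (simp add: mult_add_distrib_mat[of _ d d _ d] mult_smult_distrib[of _ d d _ d])
    finally show ?thesis .
  qed
  have comm: "?K ^\<^sub>m m *\<^sub>v (cP *\<^sub>v y) = cP *\<^sub>v (?K ^\<^sub>m m *\<^sub>v y)" if "y \<in> carrier_vec d" for m y
    using that
  proof (induction m arbitrary: y)
    case 0
    have "?K ^\<^sub>m 0 = 1\<^sub>m d" using carrier_matD[OF K] by simp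
    then show ?case using 0 mult_mat_vec_carrier[OF cP_carrier 0] by simp
  next
    case (Suc m)
    note y = Suc.prems
    have Ky: "?K *\<^sub>v y \<in> carrier_vec d" by (rule mult_mat_vec_carrier[OF K y])
    have "?K ^\<^sub>m Suc m *\<^sub>v (cP *\<^sub>v y) = ?K ^\<^sub>m m *\<^sub>v (?K *\<^sub>v (cP *\<^sub>v y))"
      by (simp add: assoc_mult_mat_vec[OF pow_carrier_mat[OF K] K mult_mat_vec_carrier[OF cP_carrier y]])
    also have "?K *\<^sub>v (cP *\<^sub>v y) = cP *\<^sub>v (?K *\<^sub>v y)"
      using assoc_mult_mat_vec[OF K cP_carrier y] assoc_mult_mat_vec[OF cP_carrier K y] KP by simp
    also have "?K ^\<^sub>m m *\<^sub>v (cP *\<^sub>v (?K *\<^sub>v y)) = cP *\<^sub>v (?K ^\<^sub>m m *\<^sub>v (?K *\<^sub>v y))" by (rule Suc.IH[OF Ky])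
    also have "?K ^\<^sub>m m *\<^sub>v (?K *\<^sub>v y) = ?K ^\<^sub>m Suc m *\<^sub>v y"
      by (simp add: assoc_mult_mat_vec[OF pow_carrier_mat[OF K] K y])
    finally show ?case .
  qed
  obtain m where m: "x \<in> carrier_vec d" "?K ^\<^sub>m m *\<^sub>v x = 0\<^sub>v d" using x by (auto simp: gen_eigenspace_def)
  have "cP *\<^sub>v 0\<^sub>v d = 0\<^sub>v d"
    by (intro eq_vecI) (auto simp: scalar_prod_def carrier_matD[OF orth_proj_carrier])
  then show ?thesis
    using comm[OF m(1), of m] m mult_mat_vec_carrier[OF cP_carrier m(1)] unfolding gen_eigenspace_def by auto
qed

text \<open>Existence: \<open>rot\<close> acts by the right scalars on generalised eigenspaces, and
  the complement of V lies in the one for 0, where the scalar is 1 because \<rho> is positive.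
  Uniqueness: each basis vector \<open>S\<close> e_i splits into its projection, which stays in the
  same generalised eigenspace, and a part in the complement; the conditions determine the value on
  both.\<close>

lemma phase_rotation_eq:
  assumes jw: "jordan_wit d cM S Q n_as (spectral_radius cM)"
  shows "phase_rotation d V cM h = jordan_wit.rot d S Q n_as (spectral_radius cM) h"
proof -
  interpret jw: jordan_wit d cM S Q n_as "spectral_radius cM" by (rule jw)
  let ?\<rho> = "spectral_radius cM"
  let ?Prop = "\<lambda>R. R \<in> carrier_mat d d \<and>
     (\<forall>g\<in>phases cM. \<forall>x\<in>gen_eigenspace d cM (g * complex_of_real ?\<rho>) \<inter> complexify V.
        R *\<^sub>v x = h g \<cdot>\<^sub>v x) \<and>
     (\<forall>ev\<in>spectrum cM. cmod ev \<noteq> ?\<rho> \<longrightarrow>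
        (\<forall>x\<in>gen_eigenspace d cM ev \<inter> complexify V. R *\<^sub>v x = x)) \<and>
     (\<forall>x\<in>complexify (orth_compl d V). R *\<^sub>v x = x)"
  have per: "jw.phase_val h (g * of_real ?\<rho>) = h g" if "g \<in> phases cM" for g
    using that jw.\<rho>_pos by (simp add: jw.phase_val_def phases_def norm_mult)
  have one: "jw.phase_val h z \<cdot>\<^sub>v x = x" if "cmod z \<noteq> ?\<rho>" for z and x :: "complex vec"
    using that by (simp add: jw.phase_val_def)
  have perp: "jw.rot h *\<^sub>v x = x" if "x \<in> complexify (orth_compl d V)" for x
  proof -
    have "char_matrix cM 0 = cM"
      unfolding char_matrix_def using carrier_matD[OF cM_carrier] by (intro eq_matI) auto
    then have "char_matrix cM 0 ^\<^sub>m 1 *\<^sub>v x = 0\<^sub>v d"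
      using complexify_perp_kernel[OF that] by (simp add: carrier_matD[OF restr_carrier[OF total_mat_carrier]])
    then have "x \<in> gen_eigenspace d cM 0"
      using complexify_perp_kernel(1)[OF that] unfolding gen_eigenspace_def by blast
    from jw.rot_gen_eigenspace[OF this, of h] show ?thesis using one[of 0 x] jw.\<rho>_pos by simp
  qed
  have rot: "?Prop (jw.rot h)"
    using jw.rot_gen_eigenspace per one perp by auto
  show ?thesis unfolding phase_rotation_def
  proof (rule the_equality[of ?Prop, OF rot])
    fix R assume R: "?Prop R"
    show "R = jw.rot h"
    proof (rule jw.rot_unique)
      show "R \<in> carrier_mat d d" using R by blast
      fix i assume i: "i < d"
      define x where "x = S *\<^sub>v unit_vec d i"
      have xg: "x \<in> gen_eigenspace d cM (jw.ev i)" unfolding x_def by (rule jw.S_unit_gen_eigenspace[OF i])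
      then have xc: "x \<in> carrier_vec d" by (simp add: gen_eigenspace_def)
      define y w where "y = cP *\<^sub>v x" and "w = x - cP *\<^sub>v x"
      have y: "y \<in> gen_eigenspace d cM (jw.ev i) \<inter> complexify V"
        using cP_gen_eigenspace[OF xg] cP_complexify[OF xc] by (simp add: y_def)
      have w: "w \<in> complexify (orth_compl d V)" unfolding w_def by (rule cP_complexify_perp[OF xc])
      have c: "y \<in> carrier_vec d" "w \<in> carrier_vec d"
        using mult_mat_vec_carrier[OF cP_carrier xc] xc by (auto simp: y_def w_def)
      have xyw: "x = y + w" using xc c carrier_vecD[OF c(1)] unfolding y_def w_def
        by (intro eq_vecI) (auto simp del: index_mult_mat_vec)
      have "R *\<^sub>v y = jw.rot h *\<^sub>v y"
      proof (cases "cmod (jw.ev i) = ?\<rho>")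
        case True
        define g where "g = jw.ev i / of_real ?\<rho>"
        have e: "jw.ev i = g * of_real ?\<rho>" using jw.\<rho>_pos by (simp add: g_def)
        have g: "g \<in> phases cM"
          using jw.ev_eigenvalue[OF i, unfolded e] True jw.\<rho>_pos by (simp add: phases_def) (simp add: g_def norm_divide)
        have "R *\<^sub>v y = h g \<cdot>\<^sub>v y" using R g y unfolding e by blast
        moreover have "jw.rot h *\<^sub>v y = h g \<cdot>\<^sub>v y" using rot g y unfolding e by blast
        ultimately show ?thesis by simp
      next
        case False
        have "jw.ev i \<in> spectrum cM" using jw.ev_eigenvalue[OF i] by (simp add: spectrum_def)
        then have "R *\<^sub>v y = y" "jw.rot h *\<^sub>v y = y" using R rot y False by blast+
        then show ?thesis by simp
      qed
      moreover have "R *\<^sub>v w = jw.rot h *\<^sub>v w" using R rot w by simp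
      ultimately show "R *\<^sub>v (S *\<^sub>v unit_vec d i) = jw.rot h *\<^sub>v (S *\<^sub>v unit_vec d i)"
        unfolding x_def[symmetric] xyw
        using mult_add_distrib_mat_vec[OF _ c, of R d] mult_add_distrib_mat_vec[OF jw.rot_carrier c] R by simp
    qed
  qed
qed

lemma block_sum_eq: "block_sum k f N = (\<Sum>i=1..<k. row_vec i \<bullet> (M ^\<^sub>m N *\<^sub>v v))"
proof -
  have "1 \<le> k" using k2 by simp
  from sum_prefix_blocks[OF this, of f "k ^ N"]
  have "block_sum k f N = (\<Sum>i=1..<k. \<Sum>r<k ^ N. f (i * k ^ N + r))"
    using block_sum_interval[OF k2, of f N] by simp
  also have "\<dots> = (\<Sum>i=1..<k. row_vec i \<bullet> (M ^\<^sub>m N *\<^sub>v v))"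
    by (intro sum.cong refl row_vec_pow_v[symmetric]) simp
  finally show ?thesis .
qed

text \<open>The leading digit of an index in a block runs through 1, ..., k-1, so \<open>A 0\<close>
  is removed from the total matrix. This is the shape of the expression in the nondegeneracy
  condition.\<close>

lemma block_sum_total: "block_sum k f N = u \<bullet> ((T - A 0) *\<^sub>v (M ^\<^sub>m N *\<^sub>v v))"
proof -
  define x where "x = M ^\<^sub>m N *\<^sub>v v"
  have x: "x \<in> carrier_vec d" unfolding x_def by (rule pow_mult_vec_carrier) simp
  have A0: "A 0 \<in> carrier_mat d d" using k2 by simp
  have "u \<bullet> (A j *\<^sub>v x) = row_vec j \<bullet> x" if "j \<in> {1..<k}" for j
  proof -
    have "digit_mat k d A j = A j"
      using that k2 left_mult_one_mat[OF A_carrier[of j]] by (simp add: digit_mat.simps[of k d A j] digit_mat.simps[of k d A 0])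
    then show ?thesis unfolding row_vec_def using that x
      by (intro transpose_vec_mult_scalar[symmetric, of _ d d, THEN trans]) auto
  qed
  then have "(\<Sum>i=1..<k. row_vec i \<bullet> x) = (\<Sum>i=1..<k. u \<bullet> (A i *\<^sub>v x))" by simp
  also have "\<dots> = (\<Sum>i<k. u \<bullet> (A i *\<^sub>v x)) - u \<bullet> (A 0 *\<^sub>v x)"
    using k2 by (simp add: lessThan_atLeast0 sum.atLeast_Suc_lessThan)
  also have "\<dots> = u \<bullet> (T *\<^sub>v x) - u \<bullet> (A 0 *\<^sub>v x)" using row_vec_total[OF u_carrier x] by simp
  also have "\<dots> = u \<bullet> (T *\<^sub>v x - A 0 *\<^sub>v x)"
    by (rule scalar_prod_minus_distrib[symmetric, of _ d])
      (use mult_mat_vec_carrier[OF total_mat_carrier x] mult_mat_vec_carrier[OF A0 x] in auto)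
  also have "T *\<^sub>v x - A 0 *\<^sub>v x = (T - A 0) *\<^sub>v x"
    by (rule minus_mult_distrib_mat_vec[symmetric, OF total_mat_carrier A0 x])
  finally show ?thesis unfolding block_sum_eq x_def .
qed

end


section \<open>Peripheral eigenvalues of nonnegative matrices\<close>

lemma matrix_power_tendsto_0:
  fixes B :: "complex mat"
  assumes B: "B \<in> carrier_mat d d"
    and ev: "\<And>z. eigenvalue B z \<Longrightarrow> cmod z < \<sigma>" and \<sigma>: "0 < \<sigma>"
    and ab: "a < d" "b < d"
  shows "(\<lambda>n. (B ^\<^sub>m n) $$ (a, b) / of_real \<sigma> ^ n) \<longlonglongrightarrow> 0"
proof -
  obtain n_as where jnf: "jordan_nf B n_as"
    using jordan_nf_exists[OF B] char_poly_factorized[OF B] by blast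
  obtain S Q where w: "similar_mat_wit B (jordan_matrix n_as) S Q"
    using jnf unfolding jordan_nf_def similar_mat_def by blast
  interpret jw: jordan_wit d B S Q n_as \<sigma> by unfold_locales (use B jnf w \<sigma> in auto)
  have ent: "(\<lambda>n. (jw.J ^\<^sub>m n) $$ (x, y) / of_real \<sigma> ^ n) \<longlonglongrightarrow> 0" if xy: "x < d" "y < d" for x y
  proof -
    from jw.J_entries[OF xy] consider "\<And>N. (jw.J ^\<^sub>m N) $$ (x, y) = 0"
      | "x \<le> y" "\<And>N. (jw.J ^\<^sub>m N) $$ (x, y) = of_nat (N choose (y - x)) * jw.ev y ^ (N + x - y)" by blast
    then show ?thesis
    proof cases
      case 2
      have "N + x - y = N - (y - x)" for N using 2(1) by simp
      then show ?thesis
        using binomial_geometric_tendsto_0[OF ev[OF jw.ev_eigenvalue[OF xy(2)]], of "y - x"] 2(2) by simp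
    qed simp
  qed
  have "(B ^\<^sub>m n) $$ (a, b) / of_real \<sigma> ^ n =
     (\<Sum>y<d. \<Sum>x<d. (S $$ (a, x) * Q $$ (y, b)) * ((jw.J ^\<^sub>m n) $$ (x, y) / of_real \<sigma> ^ n))" for n
    unfolding jw.pow_eq using triple_product_entry[of S d "jw.J ^\<^sub>m n" Q a b] ab
    by (simp add: sum_divide_distrib mult_ac)
  then show ?thesis
    by (simp only:) (intro tendsto_null_sum tendsto_mult_right_zero ent; simp)
qed

lemma unit_complex_Re_1: "cmod z = 1 \<Longrightarrow> Re z = 1 \<Longrightarrow> z = 1"
  using cmod_power2[of z] by (simp add: complex_eq_iff)

text \<open>A Collatz-Wielandt argument. With w extended by 0 off \<open>S\<close>, nonnegativity
  gives B^N w >= \<sigma>^N w on \<open>S\<close>, whereas B^N = o(\<sigma>^N) because all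
  eigenvalues have modulus below \<sigma>.\<close>

lemma strict_subinvariant_contradiction:
  fixes B :: "real mat"
  assumes B: "B \<in> carrier_mat d d" and nonneg: "\<And>i j. i < d \<Longrightarrow> j < d \<Longrightarrow> 0 \<le> B $$ (i, j)"
    and ev: "\<And>z. eigenvalue (cmat B) z \<Longrightarrow> cmod z < \<sigma>" and \<sigma>: "0 < \<sigma>"
    and S: "S \<subseteq> {..<d}" "S \<noteq> {}" and w: "\<And>i. i \<in> S \<Longrightarrow> 0 < w i"
    and sub: "\<And>i. i \<in> S \<Longrightarrow> \<sigma> * w i \<le> (\<Sum>j\<in>S. B $$ (i, j) * w j)"
  shows False
proof -
  define w' where "w' = Matrix.vec d (\<lambda>i. if i \<in> S then w i else 0)"
  have w': "w' \<in> carrier_vec d" by (simp add: w'_def)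
  have pw: "B ^\<^sub>m N *\<^sub>v w' \<in> carrier_vec d" for N
    by (rule mult_mat_vec_carrier[OF pow_carrier_mat[OF B] w'])
  have step: "(B ^\<^sub>m Suc N *\<^sub>v w') $ i = (\<Sum>j<d. B $$ (i, j) * (B ^\<^sub>m N *\<^sub>v w') $ j)" if "i < d" for N i
  proof -
    have "B ^\<^sub>m Suc N *\<^sub>v w' = B *\<^sub>v (B ^\<^sub>m N *\<^sub>v w')"
      unfolding pow_mat_Suc_left[OF B] by (rule assoc_mult_mat_vec[OF B pow_carrier_mat[OF B] w'])
    then show ?thesis using that B carrier_vecD[OF pw]
      by (simp add: scalar_prod_def lessThan_atLeast0 del: pow_mat.simps)
  qed
  have main: "(\<forall>i<d. 0 \<le> (B ^\<^sub>m N *\<^sub>v w') $ i) \<and> (\<forall>i\<in>S. \<sigma> ^ N * w i \<le> (B ^\<^sub>m N *\<^sub>v w') $ i)" for N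
  proof (induction N)
    case 0
    have "B ^\<^sub>m 0 *\<^sub>v w' = w'" using B w' by simp
    then show ?case using S w by (auto simp: w'_def less_imp_le)
  next
    case (Suc N)
    have n: "0 \<le> (B ^\<^sub>m Suc N *\<^sub>v w') $ i" if "i < d" for i
      unfolding step[OF that] using that nonneg Suc by (intro sum_nonneg mult_nonneg_nonneg) auto
    have "\<sigma> ^ Suc N * w i \<le> (B ^\<^sub>m Suc N *\<^sub>v w') $ i" if i: "i \<in> S" for i
    proof -
      have id: "i < d" using i S by auto
      have "\<sigma> ^ Suc N * w i = \<sigma> ^ N * (\<sigma> * w i)" by simp
      also have "\<dots> \<le> \<sigma> ^ N * (\<Sum>j\<in>S. B $$ (i, j) * w j)"
        using sub[OF i] \<sigma> by (intro mult_left_mono) auto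
      also have "\<dots> = (\<Sum>j\<in>S. B $$ (i, j) * (\<sigma> ^ N * w j))" by (simp add: sum_distrib_left mult_ac)
      also have "\<dots> \<le> (\<Sum>j\<in>S. B $$ (i, j) * (B ^\<^sub>m N *\<^sub>v w') $ j)"
        using Suc S nonneg id by (intro sum_mono mult_left_mono) auto
      also have "\<dots> \<le> (\<Sum>j<d. B $$ (i, j) * (B ^\<^sub>m N *\<^sub>v w') $ j)"
        using Suc S nonneg id by (intro sum_mono2 mult_nonneg_nonneg) auto
      finally show ?thesis unfolding step[OF id] .
    qed
    with n show ?case by blast
  qed
  obtain i where i: "i \<in> S" using S by blast
  then have id: "i < d" using S by auto
  have "(\<lambda>n. \<Sum>j<d. ((cmat B ^\<^sub>m n) $$ (i, j) / of_real \<sigma> ^ n) * of_real (w' $ j)) \<longlonglongrightarrow> 0"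
    by (intro tendsto_null_sum tendsto_mult_left_zero matrix_power_tendsto_0[OF _ ev \<sigma> id]) (use B in auto)
  moreover have "(\<Sum>j<d. ((cmat B ^\<^sub>m n) $$ (i, j) / of_real \<sigma> ^ n) * of_real (w' $ j))
      = of_real ((B ^\<^sub>m n *\<^sub>v w') $ i / \<sigma> ^ n)" for n
  proof -
    have c: "B ^\<^sub>m n \<in> carrier_mat d d" using B by simp
    have e: "cmat B ^\<^sub>m n = cmat (B ^\<^sub>m n)" by (rule of_real_hom.mat_hom_pow[OF B, symmetric])
    show ?thesis unfolding e using id c w' carrier_matD[OF c]
      by (simp add: scalar_prod_def lessThan_atLeast0 sum_divide_distrib)
  qed
  ultimately have "(\<lambda>n. complex_of_real ((B ^\<^sub>m n *\<^sub>v w') $ i / \<sigma> ^ n)) \<longlonglongrightarrow> of_real 0" by (simp only: of_real_0)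
  then have "(\<lambda>n. (B ^\<^sub>m n *\<^sub>v w') $ i / \<sigma> ^ n) \<longlonglongrightarrow> 0" by (simp only: tendsto_of_real_iff)
  moreover have "w i \<le> (B ^\<^sub>m n *\<^sub>v w') $ i / \<sigma> ^ n" for n
    using main[of n] i \<sigma> by (simp add: pos_le_divide_eq mult.commute del: index_mult_mat_vec)
  ultimately have "w i \<le> 0" by (intro LIMSEQ_le_const[of _ 0 "w i"]) auto
  then show False using w[OF i] by simp
qed

text \<open>On a smallest index set \<open>S\<close> whose principal submatrix still has the eigenvalue \<open>\<mu>\<close>, the matrix is
  irreducible and the moduli \<open>y\<close> of the eigenvector form a positive eigenvector for \<open>\<rho>\<close>. Equality
  in the triangle inequality then makes the \<open>m\<close>-th powers of the phases, weighted by \<open>y\<close>, an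
  eigenvector for \<open>\<rho> g\<^sup>m\<close> for every \<open>m\<close>, where \<open>g = \<mu> / \<rho>\<close>; there are only finitely many
  eigenvalues.\<close>

lemma peripheral_eigenvalue_root_of_unity:
  fixes B :: "real mat"
  assumes B: "B \<in> carrier_mat d d" and nonneg: "\<And>i j. i < d \<Longrightarrow> j < d \<Longrightarrow> 0 \<le> B $$ (i, j)"
    and \<rho>: "0 < \<rho>" and ev: "\<And>z. eigenvalue (cmat B) z \<Longrightarrow> cmod z \<le> \<rho>"
    and lam: "eigenvalue (cmat B) \<mu>" "cmod \<mu> = \<rho>"
  shows "\<exists>n\<ge>1. \<mu> ^ n = of_real \<rho> ^ n"
proof -
  define a where "a i j = B $$ (i, j)" for i j
  have a0: "0 \<le> a i j" if "i < d" "j < d" for i j using nonneg that by (simp add: a_def)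
  define EV where "EV S x \<longleftrightarrow> S \<subseteq> {..<d} \<and> (\<exists>i\<in>S. x i \<noteq> 0) \<and>
    (\<forall>i\<in>S. (\<Sum>j\<in>S. of_real (a i j) * x j) = \<mu> * x i)" for S and x :: "nat \<Rightarrow> complex"
  obtain x0 where x0: "x0 \<in> carrier_vec d" "x0 \<noteq> 0\<^sub>v d" "cmat B *\<^sub>v x0 = \<mu> \<cdot>\<^sub>v x0"
    using lam(1) B unfolding eigenvalue_def eigenvector_def by auto
  have "EV {..<d} (\<lambda>i. x0 $ i)"
    unfolding EV_def
  proof (intro conjI ballI)
    show "\<exists>i\<in>{..<d}. x0 $ i \<noteq> 0"
    proof (rule ccontr)
      assume "\<not> ?thesis"
      then have "x0 = 0\<^sub>v d" using x0(1) by (intro eq_vecI) auto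
      then show False using x0(2) by simp
    qed
    fix i assume i: "i \<in> {..<d}"
    have "(cmat B *\<^sub>v x0) $ i = (\<Sum>j<d. of_real (a i j) * x0 $ j)"
      using i B x0(1) by (simp add: scalar_prod_def lessThan_atLeast0 a_def)
    then show "(\<Sum>j<d. of_real (a i j) * x0 $ j) = \<mu> * x0 $ i" using x0(1,3) i by simp
  qed simp
  then have "\<exists>S. \<exists>x. EV S x" by blast
  then obtain S where S: "\<exists>x. EV S x" and min: "\<And>S'. \<exists>x. EV S' x \<Longrightarrow> card S \<le> card S'"
    using ex_has_least_nat[of "\<lambda>S. \<exists>x. EV S x" _ card] by blast
  obtain x where x: "EV S x" using S by blast
  have Sd: "S \<subseteq> {..<d}" using x by (simp add: EV_def)
  have finS: "finite S" using Sd finite_subset by blast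
  have minimal: "S' = S" if "EV S' x'" "S' \<subseteq> S" for S' x'
    using card_seteq[OF finS that(2)] min[of S'] that(1) by blast
  have eq: "(\<Sum>j\<in>S. of_real (a i j) * x j) = \<mu> * x i" if "i \<in> S" for i using x that by (simp add: EV_def)
  \<comment> \<open>Dropping the zero coordinates changes none of the sums, so a minimal
    \<open>S\<close> carries an eigenvector without zeros.\<close>
  have "EV {i \<in> S. x i \<noteq> 0} x"
  proof -
    have "(\<Sum>j\<in>{i \<in> S. x i \<noteq> 0}. of_real (a i j) * x j) = (\<Sum>j\<in>S. of_real (a i j) * x j)" for i
      using finS by (intro sum.mono_neutral_left) auto
    then show ?thesis using x by (auto simp: EV_def)
  qed
  from minimal[OF this] have supp: "x i \<noteq> 0" if "i \<in> S" for i using that by blast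
  have Sne: "S \<noteq> {}" using x by (auto simp: EV_def)
  \<comment> \<open>Irreducibility: no edge leaves U, so the restriction of x to U satisfies the
    same eigenvalue equation and minimality of \<open>S\<close> applies.\<close>
  have closed_eq: "U = S" if U: "U \<subseteq> S" "U \<noteq> {}" and cl: "\<And>i j. i \<in> U \<Longrightarrow> j \<in> S - U \<Longrightarrow> a i j = 0" for U
  proof -
    have "(\<Sum>j\<in>U. of_real (a i j) * x j) = \<mu> * x i" if i: "i \<in> U" for i
    proof -
      have "(\<Sum>j\<in>U. of_real (a i j) * x j) = (\<Sum>j\<in>S. of_real (a i j) * x j)"
        using finS U(1) cl[OF i] by (intro sum.mono_neutral_left) auto
      then show ?thesis using eq[of i] i U(1) by auto
    qed
    moreover obtain i where "i \<in> U" using U(2) by blast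
    moreover have "x i \<noteq> 0" using supp[of i] \<open>i \<in> U\<close> U(1) by auto
    moreover have "U \<subseteq> {..<d}" using U(1) Sd by simp
    ultimately have "EV U x" unfolding EV_def by (intro conjI) auto
    then show ?thesis using minimal U(1) by blast
  qed
  define y where "y i = cmod (x i)" for i
  have y: "0 < y i" if "i \<in> S" for i using supp[OF that] by (simp add: y_def)
  have aS: "0 \<le> a i j" if "i \<in> S" "j \<in> S" for i j using that Sd a0 by blast
  have sub: "\<rho> * y i \<le> (\<Sum>j\<in>S. a i j * y j)" if i: "i \<in> S" for i
  proof -
    have "\<rho> * y i = cmod (\<Sum>j\<in>S. of_real (a i j) * x j)" unfolding eq[OF i] by (simp add: norm_mult lam(2) y_def)
    also have "\<dots> \<le> (\<Sum>j\<in>S. cmod (of_real (a i j) * x j))" by (rule norm_sum)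
    also have "\<dots> = (\<Sum>j\<in>S. a i j * y j)" using aS[OF i] by (intro sum.cong) (auto simp: norm_mult y_def)
    finally show ?thesis .
  qed
  define F where "F z = (\<lambda>i. \<Sum>j\<in>S. a i j * z j)" for z :: "nat \<Rightarrow> real"
  have F_app: "F z i = (\<Sum>j\<in>S. a i j * z j)" for z i by (simp add: F_def)
  have FS: "(F ^^ Suc l) z i = (\<Sum>j\<in>S. a i j * (F ^^ l) z j)" for l z i
    using F_app[of "(F ^^ l) z" i] by simp
  define e where "e i = F y i - \<rho> * y i" for i
  have e0: "0 \<le> e i" if "i \<in> S" for i using sub[OF that] by (simp add: e_def F_def)
  have Fpos: "0 \<le> (F ^^ l) z i" if "\<And>i. i \<in> S \<Longrightarrow> 0 \<le> z i" "i \<in> S" for l z i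
    using that(2) by (induction l arbitrary: i) (auto simp: F_def that(1) intro!: sum_nonneg mult_nonneg_nonneg aS)
  have Fe: "(F ^^ l) e i = (F ^^ Suc l) y i - \<rho> * (F ^^ l) y i" if "i \<in> S" for l i
    using that
  proof (induction l arbitrary: i)
    case 0 then show ?case by (simp add: e_def)
  next
    case (Suc l)
    have "(F ^^ Suc l) e i = (\<Sum>j\<in>S. a i j * ((F ^^ Suc l) y j - \<rho> * (F ^^ l) y j))"
      unfolding FS[of l e i] using Suc.IH by (intro sum.cong refl) (simp only:)
    also have "\<dots> = (\<Sum>j\<in>S. a i j * (F ^^ Suc l) y j) - \<rho> * (\<Sum>j\<in>S. a i j * (F ^^ l) y j)"
      by (simp only: right_diff_distrib sum_subtractf sum_distrib_left mult_ac)
    also have "\<dots> = (F ^^ Suc (Suc l)) y i - \<rho> * (F ^^ Suc l) y i"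
      unfolding FS[of "Suc l" y i] FS[of l y i] ..
    finally show ?case .
  qed
  \<comment> \<open>Equality in the triangle inequality. If the defect e = F y - \<rho> y were
    positive somewhere, irreducibility would spread it over \<open>S\<close> and yield a positive w
    with F w > \<rho> w everywhere.\<close>
  have e_eq: "e i = 0" if "i \<in> S" for i
  proof (rule ccontr)
    assume "e i \<noteq> 0"
    then have ei: "0 < e i" using e0[OF that] by simp
    \<comment> \<open>The indices that the defect never reaches. An edge from U to an index outside
      would make the next iterate positive, so U is closed in the sense of
      \<open>closed_eq\<close>.\<close>
    define U where "U = {i \<in> S. \<forall>l. \<not> 0 < (F ^^ l) e i}"
    have "U = {}"
    proof (rule ccontr)
      assume "U \<noteq> {}"
      moreover have "a i' j = 0" if i': "i' \<in> U" and j: "j \<in> S - U" for i' j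
      proof (rule ccontr)
        assume n: "a i' j \<noteq> 0"
        obtain l where l: "0 < (F ^^ l) e j" using j by (auto simp: U_def)
        have i'S: "i' \<in> S" and jS: "j \<in> S" using i' j by (auto simp: U_def)
        have "0 < a i' j * (F ^^ l) e j" using n aS[OF i'S jS] l by simp
        also have "\<dots> \<le> (\<Sum>j\<in>S. a i' j * (F ^^ l) e j)"
          by (rule member_le_sum[OF jS _ finS]) (auto intro!: mult_nonneg_nonneg aS i'S Fpos e0)
        also have "\<dots> = (F ^^ Suc l) e i'" by (simp add: F_def)
        finally show False using i' unfolding U_def by blast
      qed
      ultimately have "U = S" using closed_eq[of U] by (auto simp: U_def)
      moreover have "i \<notin> U" using ei by (auto simp: U_def intro!: exI[of _ 0])
      ultimately show False using that by simp
    qed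
    then have "\<forall>i\<in>S. \<exists>l. 0 < (F ^^ l) e i" by (auto simp: U_def)
    then obtain l where l: "\<And>i. i \<in> S \<Longrightarrow> 0 < (F ^^ l i) e i" by metis
    define L where "L = Max (l ` S)"
    have lL: "l i \<le> L" if "i \<in> S" for i using finS that by (simp add: L_def)
    \<comment> \<open>Since F^m e = F^(m+1) y - \<rho> F^m y, the quantity F w - \<rho> w is the sum
      of the iterates of e up to L, and it contains a positive term for every i.\<close>
    define w where "w i = (\<Sum>m\<le>L. (F ^^ m) y i)" for i
    have wpos: "0 < w i" if "i \<in> S" for i
    proof -
      have "y i \<le> w i" unfolding w_def
        using member_le_sum[of 0 "{..L}" "\<lambda>m. (F ^^ m) y i"] Fpos[of y i] that y by (auto simp: less_imp_le)
      then show ?thesis using y[OF that] by simp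
    qed
    have strict: "\<rho> * w i < F w i" if i: "i \<in> S" for i
    proof -
      have "F w i = (\<Sum>m\<le>L. (F ^^ Suc m) y i)"
        unfolding F_def w_def by (simp add: sum_distrib_left) (subst sum.swap, simp add: F_def)
      then have "F w i - \<rho> * w i = (\<Sum>m\<le>L. (F ^^ m) e i)"
        unfolding w_def by (simp add: Fe[OF i] sum_subtractf sum_distrib_left del: funpow.simps)
      also have "\<dots> > 0"
        using member_le_sum[of "l i" "{..L}" "\<lambda>m. (F ^^ m) e i"] lL[OF i] Fpos[OF e0 i] l[OF i] by fastforce
      finally show ?thesis by simp
    qed
    \<comment> \<open>Finiteness of \<open>S\<close> turns the strict inequalities into one factor
      above \<rho>, as \<open>strict_subinvariant_contradiction\<close> requires.\<close>
    define \<sigma> where "\<sigma> = Min ((\<lambda>i. F w i / w i) ` S)"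
    have "\<rho> < F w i / w i" if "i \<in> S" for i using strict[OF that] wpos[OF that] by (simp add: pos_less_divide_eq)
    then have \<sigma>: "\<rho> < \<sigma>" unfolding \<sigma>_def using finS Sne by (subst Min_gr_iff) auto
    have sub': "\<sigma> * w i \<le> (\<Sum>j\<in>S. B $$ (i, j) * w j)" if "i \<in> S" for i
    proof -
      have "\<sigma> \<le> F w i / w i" unfolding \<sigma>_def using finS that by (intro Min_le) auto
      then show ?thesis using wpos[OF that] by (simp add: pos_le_divide_eq F_def a_def)
    qed
    show False
      by (rule strict_subinvariant_contradiction[where B = B and w = w, OF B nonneg _ _ Sd Sne wpos sub'])
        (use ev \<sigma> \<rho> in force)+
  qed
  have inv: "(\<Sum>j\<in>S. a i j * y j) = \<rho> * y i" if "i \<in> S" for i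
    using e_eq[OF that] by (simp add: e_def F_def)
  define D where "D i = x i / of_real (y i)" for i
  have D1: "cmod (D i) = 1" if "i \<in> S" for i using y[OF that] by (simp add: D_def norm_divide y_def)
  have xD: "x i = of_real (y i) * D i" if "i \<in> S" for i using y[OF that] by (simp add: D_def)
  define g where "g = \<mu> / of_real \<rho>"
  have g1: "cmod g = 1" using lam(2) \<rho> by (simp add: g_def norm_divide)
  have lg: "\<mu> = of_real \<rho> * g" using \<rho> by (simp add: g_def)
  \<comment> \<open>After division by the phase c of the right-hand side, an average of real parts
    at most 1 with weights \<open>a i j * y j\<close> equals 1. Each term of positive weight must
    then be 1.\<close>
  have align: "D j = g * D i" if i: "i \<in> S" and j: "j \<in> S" and n: "a i j \<noteq> 0" for i j
  proof -
    define c where "c = g * D i"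
    have c1: "cmod c = 1" using D1[OF i] g1 by (simp add: c_def norm_mult)
    then have cc: "cnj c * c = 1" using complex_norm_square[of c] by (simp add: mult.commute)
    have "cnj c * (\<Sum>j\<in>S. of_real (a i j) * x j) = of_real (\<rho> * y i) * (cnj c * c)"
      unfolding eq[OF i] xD[OF i] lg c_def by (simp add: mult_ac)
    then have "(\<Sum>j\<in>S. of_real (a i j * y j) * (cnj c * D j)) = of_real (\<rho> * y i)"
      unfolding cc using xD by (simp add: sum_distrib_left mult_ac cong: sum.cong)
    moreover have re: "Re (of_real r * z) = r * Re z" for r z by simp
    ultimately have "Re (\<Sum>j\<in>S. of_real (a i j * y j) * (cnj c * D j)) = \<rho> * y i" by simp
    then have "(\<Sum>j\<in>S. a i j * y j * Re (cnj c * D j)) = (\<Sum>j\<in>S. a i j * y j)"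
      unfolding inv[OF i] by (simp only: Re_sum re)
    then have z: "(\<Sum>j\<in>S. a i j * y j * (1 - Re (cnj c * D j))) = 0"
      by (simp add: right_diff_distrib sum_subtractf)
    have le: "Re (cnj c * D j) \<le> 1" if "j \<in> S" for j
      using complex_Re_le_cmod[of "cnj c * D j"] D1[OF that] c1 by (simp only: norm_mult complex_mod_cnj)
    have "a i j * y j * (1 - Re (cnj c * D j)) = 0"
      using z finS j sum_nonneg_eq_0_iff[OF finS, of "\<lambda>j. a i j * y j * (1 - Re (cnj c * D j))"] aS[OF i] y le
      by (auto simp: less_imp_le simp del: times_complex.simps)
    then have "Re (cnj c * D j) = 1" using n y[OF j] by simp
    then have "cnj c * D j = 1"
      using D1[OF j] c1 by (intro unit_complex_Re_1) (simp_all add: norm_mult)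
    then have "(cnj c * c) * D j = c" by (metis mult.assoc mult.commute mult.right_neutral)
    then show ?thesis unfolding cc by (simp add: c_def)
  qed
  \<comment> \<open>The principal submatrix padded with zeros to size d, so that finiteness of the
    spectrum can be quoted for it. Only this finiteness is wanted of its eigenvalues.\<close>
  define C where "C = Matrix.mat d d (\<lambda>(i, j). if i \<in> S \<and> j \<in> S then complex_of_real (a i j) else 0)"
  have C: "C \<in> carrier_mat d d" by (simp add: C_def)
  have "of_real \<rho> * g ^ m \<in> spectrum C" for m
  proof -
    \<comment> \<open>By \<open>align\<close>, passing from i to j along an edge multiplies the m-th
      power of the phase by g^m, and \<open>inv\<close> sums the weights to \<rho> y.\<close>
    define z where "z = Matrix.vec d (\<lambda>i. if i \<in> S then D i ^ m * of_real (y i) else 0)"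
    have z: "z \<in> carrier_vec d" by (simp add: z_def)
    obtain i where i: "i \<in> S" using Sne by blast
    then have "z $ i \<noteq> 0" "i < d" using D1[OF i] y[OF i] Sd by (auto simp: z_def)
    then have "z \<noteq> 0\<^sub>v d" by auto
    moreover have "C *\<^sub>v z = (of_real \<rho> * g ^ m) \<cdot>\<^sub>v z"
    proof (rule eq_vecI)
      fix i assume "i < dim_vec ((of_real \<rho> * g ^ m) \<cdot>\<^sub>v z)"
      then have i: "i < d" using z by simp
      have "(C *\<^sub>v z) $ i = (\<Sum>j<d. C $$ (i, j) * z $ j)"
        using i z C by (simp add: scalar_prod_def lessThan_atLeast0)
      also have "\<dots> = (\<Sum>j\<in>S. C $$ (i, j) * z $ j)"
        using Sd by (intro sum.mono_neutral_right) (auto simp: z_def)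
      also have "\<dots> = of_real \<rho> * g ^ m * z $ i"
      proof (cases "i \<in> S")
        case False
        then show ?thesis using i Sd by (auto simp: C_def z_def intro!: sum.neutral)
      next
        case True
        have "(\<Sum>j\<in>S. C $$ (i, j) * z $ j) = (\<Sum>j\<in>S. of_real (a i j * y j) * (g ^ m * D i ^ m))"
        proof (rule sum.cong[OF refl])
          fix j assume j: "j \<in> S"
          then have "j < d" using Sd by auto
          then have "C $$ (i, j) * z $ j = of_real (a i j * y j) * D j ^ m"
            using i True j by (simp add: C_def z_def)
          also have "\<dots> = of_real (a i j * y j) * (g ^ m * D i ^ m)"
            using align[OF True j] by (cases "a i j = 0") (auto simp: power_mult_distrib)
          finally show "C $$ (i, j) * z $ j = of_real (a i j * y j) * (g ^ m * D i ^ m)" .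
        qed
        also have "\<dots> = of_real (\<Sum>j\<in>S. a i j * y j) * (g ^ m * D i ^ m)" by (simp add: sum_distrib_right)
        finally show ?thesis unfolding inv[OF True] using True i by (simp add: z_def)
      qed
      finally show "(C *\<^sub>v z) $ i = ((of_real \<rho> * g ^ m) \<cdot>\<^sub>v z) $ i" using i z by simp
    qed (use C z in simp)
    ultimately show ?thesis using z C unfolding spectrum_def eigenvalue_def eigenvector_def by auto
  qed
  then have "range (\<lambda>m. of_real \<rho> * g ^ m) \<subseteq> spectrum C" by blast
  then have "finite (range (\<lambda>m :: nat. of_real \<rho> * g ^ m))"
    using card_finite_spectrum(1)[OF C] finite_subset by blast
  then have "\<not> inj (\<lambda>m :: nat. of_real \<rho> * g ^ m)" using finite_imageD infinite_UNIV_nat by blast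
  then obtain m n :: nat where "m \<noteq> n" "g ^ m = g ^ n" using \<rho> by (auto simp: inj_def)
  then obtain m n :: nat where mn: "m < n" "g ^ m = g ^ n" by (metis linorder_neqE_nat)
  have "g \<noteq> 0" using g1 by auto
  then have "g ^ (n - m) = 1" using mn by (simp add: power_diff)
  then show ?thesis using mn(1) unfolding lg by (intro exI[of _ "n - m"]) (simp add: power_mult_distrib)
qed

text \<open>The product of the exponents of the finitely many peripheral eigenvalues serves them
  all, so the \<open>LEAST\<close> in \<open>mat_period\<close> is attained. A positive real number
  of modulus \<rho>^p is \<rho>^p itself.\<close>

lemma mat_period_props:
  fixes B :: "real mat"
  assumes B: "B \<in> carrier_mat d d" and nonneg: "\<And>i j. i < d \<Longrightarrow> j < d \<Longrightarrow> 0 \<le> B $$ (i, j)"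
    and \<rho>: "0 < spectral_radius (cmat B)"
  shows "0 < mat_period B"
    and "\<And>z. eigenvalue (cmat B) z \<Longrightarrow> cmod z = spectral_radius (cmat B) \<Longrightarrow>
      z ^ mat_period B = of_real (spectral_radius (cmat B)) ^ mat_period B"
proof -
  let ?\<rho> = "spectral_radius (cmat B)"
  let ?E = "{z. eigenvalue (cmat B) z \<and> cmod z = ?\<rho>}"
  have cB: "cmat B \<in> carrier_mat d d" using B by simp
  have le: "cmod z \<le> ?\<rho>" if "eigenvalue (cmat B) z" for z
    using cB that by (rule eigenvalue_le_spectral_radius)
  have "\<exists>n\<ge>1. z ^ n = of_real ?\<rho> ^ n" if "z \<in> ?E" for z
    using peripheral_eigenvalue_root_of_unity[OF B nonneg \<rho> le] that by blast
  then obtain n where n: "\<And>z. z \<in> ?E \<Longrightarrow> 1 \<le> n z \<and> z ^ n z = of_real ?\<rho> ^ n z" by metis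
  have fin: "finite ?E" using card_finite_spectrum(1)[OF cB] by (rule rev_finite_subset) (auto simp: spectrum_def)
  define p where "p = prod n ?E"
  have p1: "1 \<le> p" unfolding p_def using n by (intro prod_ge_1) auto
  have "z ^ p = of_real ?\<rho> ^ p" if z: "z \<in> ?E" for z
  proof -
    obtain q where "p = n z * q" using dvd_prodI[OF fin z, of n] unfolding p_def by blast
    then show ?thesis using n[OF z] by (simp add: power_mult)
  qed
  then have pp: "p \<ge> 1 \<and> (\<forall>ev\<in>spectrum (cmat B). cmod ev = ?\<rho> \<longrightarrow> ev ^ p \<in> \<real> \<and> 0 < Re (ev ^ p))"
    using p1 \<rho> by (auto simp: spectrum_def simp flip: of_real_power)
  let ?P = "\<lambda>n. n \<ge> 1 \<and> (\<forall>ev\<in>spectrum (cmat B). cmod ev = ?\<rho> \<longrightarrow> ev ^ n \<in> \<real> \<and> 0 < Re (ev ^ n))"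
  have P: "?P (mat_period B)" unfolding mat_period_def by (rule LeastI[of ?P, OF pp])
  then show "0 < mat_period B" by simp
  fix z assume z: "eigenvalue (cmat B) z" "cmod z = ?\<rho>"
  then have r: "z ^ mat_period B \<in> \<real>" "0 < Re (z ^ mat_period B)" using P by (auto simp: spectrum_def)
  then obtain t where t: "z ^ mat_period B = of_real t" by (auto elim: Reals_cases)
  then have "0 < t" using r by simp
  then have "t = ?\<rho> ^ mat_period B" using arg_cong[OF t, of cmod] z(2) by (simp add: norm_power)
  then show "z ^ mat_period B = of_real ?\<rho> ^ mat_period B" unfolding t by simp
qed


section \<open>Growth of block sums\<close>

lemma growth_normalizer_eq:
  assumes "1 \<le> peripheral_block_size B" "0 < spectral_radius B"
  defines "s \<equiv> peripheral_block_size B - 1"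
  shows "growth_normalizer B n = (fact s * spectral_radius B ^ s) / (real n ^ s * spectral_radius B ^ n)"
proof -
  have e: "int n - int (peripheral_block_size B) + 1 = int n - int s" using assms(1) by (simp add: s_def)
  show ?thesis
    unfolding growth_normalizer_def Let_def e s_def[symmetric]
    using assms(2) by (simp add: power_int_diff)
qed

lemma mult_mat_mat_vec_entry:
  fixes X Y :: "'a :: comm_semiring_0 mat"
  assumes "X \<in> carrier_mat d d" "Y \<in> carrier_mat d d" "y \<in> carrier_vec d" "i < d"
  shows "(X *\<^sub>v (Y *\<^sub>v y)) $ i = (\<Sum>a<d. X $$ (i, a) * (\<Sum>b<d. Y $$ (a, b) * y $ b))"
  using assms by (auto simp: scalar_prod_def lessThan_atLeast0 intro!: sum.cong)

lemma smult_mat_mult_vec: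
  fixes X :: "'a :: comm_semiring_0 mat"
  assumes "X \<in> carrier_mat d d" "y \<in> carrier_vec d"
  shows "(a \<cdot>\<^sub>m X) *\<^sub>v y = a \<cdot>\<^sub>v (X *\<^sub>v y)"
  using assms by (intro eq_vecI) (auto simp: scalar_prod_def sum_distrib_left mult.assoc)

text \<open>Otherwise a subsequence stays below 1/(m+1), and the limit along any further subsequence
  is at most 0. This is how positivity on the whole phase group becomes uniform.\<close>

lemma eventually_pos_lower_bound:
  fixes t :: "nat \<Rightarrow> real"
  assumes "\<And>r. strict_mono (r :: nat \<Rightarrow> nat) \<Longrightarrow> \<exists>r' l. strict_mono r' \<and> 0 < l \<and> (t \<circ> r \<circ> r') \<longlonglongrightarrow> l"
  shows "\<exists>a>0. \<forall>\<^sub>F n in sequentially. a \<le> t n"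
proof (rule ccontr)
  assume "\<not> ?thesis"
  then have "\<not> (\<forall>\<^sub>F n in sequentially. inverse (real (Suc m)) \<le> t n)" for m by simp
  then have ex: "\<exists>n\<ge>N. t n < inverse (real (Suc m))" for m N
    unfolding eventually_sequentially by (meson not_le)
  have "\<exists>r. \<forall>m. t (r m) < inverse (real (Suc m)) \<and> r m < r (Suc m)"
  proof (rule dependent_nat_choice)
    show "\<exists>x. t x < inverse (real (Suc 0))" using ex[of 0 0] by blast
    fix x m show "\<exists>y. t y < inverse (real (Suc (Suc m))) \<and> x < y"
      using ex[of "Suc x" "Suc m"] by (auto simp: Suc_le_eq)
  qed
  then obtain r where r: "\<And>m. t (r m) < inverse (real (Suc m))" "\<And>m. r m < r (Suc m)" by blast
  have "strict_mono r" using r(2) by (simp add: strict_mono_Suc_iff)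
  then obtain r' l where r': "strict_mono (r' :: nat \<Rightarrow> nat)" "0 < l" "(t \<circ> r \<circ> r') \<longlonglongrightarrow> l" using assms by blast
  have "(\<lambda>m. inverse (real (Suc m))) \<longlonglongrightarrow> 0" by (rule LIMSEQ_inverse_real_of_nat)
  moreover have "(t \<circ> r \<circ> r') m \<le> inverse (real (Suc m))" for m
  proof -
    have "m \<le> r' m" using seq_suble[OF r'(1)] .
    then have "inverse (real (Suc (r' m))) \<le> inverse (real (Suc m))" by simp
    then have "t (r (r' m)) \<le> inverse (real (Suc m))" using r(1)[of "r' m"] by linarith
    then show ?thesis by (simp only: o_apply)
  qed
  ultimately have "l \<le> 0" using r'(3) by (intro LIMSEQ_le) auto
  then show False using r'(2) by simp
qed

context lin_rep
begin

text \<open>Rotating R^N M^N back by the N-th power of the phases returns M^N. The normalised block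
  sum is therefore the nondegeneracy expression with h the N-th phase power and c_N R^N M^N in place
  of its limit; along a subsequence with convergent phases it tends to that expression at a point of
  the phase group.\<close>

lemma nondegenerate_growth:
  assumes nd: "nondegenerate_rep k d u A v"
  shows "\<exists>s a b \<rho>. 0 < \<rho> \<and> 0 < a \<and>
    (\<forall>\<^sub>F N in sequentially. a * (real N ^ s * \<rho> ^ N) \<le> block_sum k f N \<and> block_sum k f N \<le> b * (real N ^ s * \<rho> ^ N))"
proof -
  define \<rho> where "\<rho> = spectral_radius cM"
  define L where "L = leading_part d V cM"
  define C where "C = cmat (T - A 0)"
  have A0: "A 0 \<in> carrier_mat d d" using k2 by simp
  have TA: "T - A 0 \<in> carrier_mat d d" by (rule minus_carrier_mat[OF A0])
  then have C: "C \<in> carrier_mat d d" by (simp add: C_def)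
  have L: "L \<in> carrier_mat d d" by (simp add: L_def leading_part_def Let_def)
  have \<rho>: "0 < \<rho>" using nd by (simp add: nondegenerate_rep_def Let_def \<rho>_def)
  define z where "z h = scalar_prod (cvec u) ((C * phase_rotation d V cM h * L) *\<^sub>v cvec v)" for h
  have zG: "\<forall>h\<in>phase_group cM. z h \<in> \<real> \<and> 0 < Re (z h)"
    using nd unfolding nondegenerate_rep_def Let_def C_def L_def z_def by (rule conjunct2)
  have pos: "0 < Re (z h)" if "h \<in> phase_group cM" for h
    using conjunct2[OF bspec[OF zG that]] .
  have pp: "phase_power cM N \<in> phase_group cM" if "1 \<le> N" for N
    unfolding phase_group_def by (rule subsetD[OF closure_subset]) (use that in blast)
  \<comment> \<open>For d = 0 the expression that nondegeneracy makes positive is an empty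
    sum.\<close>
  have d: "0 < d"
  proof (rule ccontr)
    assume "\<not> 0 < d"
    then have "z (phase_power cM 1) = 0"
      unfolding z_def using v_carrier C by (simp add: scalar_prod_def)
    then show False using pos[OF pp[of 1]] by simp
  qed
  obtain n_as where J: "jordan_nf cM n_as" and r1: "1 \<le> peripheral_block_size cM"
    and size: "\<And>m z. (m, z) \<in> set n_as \<Longrightarrow> cmod z = \<rho> \<Longrightarrow> m \<le> peripheral_block_size cM"
    using peripheral_jordan_nf[OF cM_carrier d] unfolding \<rho>_def by blast
  obtain S Q where w: "similar_mat_wit cM (jordan_matrix n_as) S Q"
    using J unfolding jordan_nf_def similar_mat_def by blast
  interpret jw: jordan_wit d cM S Q n_as \<rho> by unfold_locales (use J w \<rho> in auto)
  have rot: "phase_rotation d V cM h = jw.rot h" for h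
    using phase_rotation_eq[of S Q n_as] jw.jordan_wit_axioms unfolding \<rho>_def by blast
  define s where "s = peripheral_block_size cM - 1"
  define c where "c N = growth_normalizer cM N" for N
  define \<kappa> where "\<kappa> = fact s * \<rho> ^ s"
  have \<kappa>: "0 < \<kappa>" using \<rho> by (simp add: \<kappa>_def)
  have c: "c N = \<kappa> / (real N ^ s * \<rho> ^ N)" for N
    unfolding c_def \<kappa>_def \<rho>_def s_def by (rule growth_normalizer_eq) (use r1 \<rho> in \<open>auto simp: \<rho>_def\<close>)
  let ?pi = "phase_inverse cM"
  have evb: "cmod (jw.ev i) \<le> \<rho>" if "i < d" for i
    unfolding \<rho>_def by (rule eigenvalue_le_spectral_radius[OF cM_carrier jw.ev_eigenvalue[OF that]])
  have ph: "jw.ev i / of_real \<rho> \<in> phases cM" if "i < d" "cmod (jw.ev i) = \<rho>" for i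
    using jw.ev_eigenvalue[OF that(1)] that(2) \<rho> by (simp add: phases_def \<rho>_def[symmetric] norm_divide)
  have conv: "convergent (\<lambda>n. (jw.rot ?pi ^\<^sub>m n * cM ^\<^sub>m n) $$ (i, j) / (of_nat n ^ s * of_real \<rho> ^ n))"
    if "i < d" "j < d" for i j
    by (rule jw.rotated_growth_convergent)
      (use ph evb size r1 that in \<open>auto simp: phase_inverse_def s_def\<close>)
  define X where "X N = Matrix.mat d d (\<lambda>(i, j). complex_of_real (c N) * (jw.rot ?pi ^\<^sub>m N * cM ^\<^sub>m N) $$ (i, j))" for N
  have X: "X N \<in> carrier_mat d d" for N by (simp add: X_def)
  have Xlim: "(\<lambda>N. X N $$ (i, j)) \<longlonglongrightarrow> L $$ (i, j)" if ij: "i < d" "j < d" for i j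
  proof -
    have "convergent (\<lambda>n. of_real \<kappa> * ((jw.rot ?pi ^\<^sub>m n * cM ^\<^sub>m n) $$ (i, j) / (of_nat n ^ s * of_real \<rho> ^ n)))"
      by (intro convergent_mult convergent_const conv ij)
    then have "convergent (\<lambda>n. complex_of_real (c n) * (jw.rot ?pi ^\<^sub>m n * cM ^\<^sub>m n) $$ (i, j))"
      by (simp add: c)
    then show ?thesis
      unfolding L_def leading_part_def Let_def X_def rot using ij
      by (simp add: c_def convergent_LIMSEQ_iff)
  qed
  \<comment> \<open>In Jordan coordinates the expression splits into a fixed functional, the
    diagonal phases and a vector depending on the matrix. The tuple h enters only through scalars,
    so limits may be taken factor by factor.\<close>
  define \<alpha> where "\<alpha> = transpose_mat (C * S) *\<^sub>v cvec u"
  define \<beta> where "\<beta> Y = Q *\<^sub>v (Y *\<^sub>v cvec v)" for Y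
  have cu: "cvec u \<in> carrier_vec d" and cv: "cvec v \<in> carrier_vec d" by simp_all
  have CS: "C * S \<in> carrier_mat d d" by (rule mult_carrier_mat[OF C jw.carriers(2)])
  have \<beta>c: "\<beta> Y \<in> carrier_vec d" if "Y \<in> carrier_mat d d" for Y
    unfolding \<beta>_def by (intro mult_mat_vec_carrier[OF jw.carriers(3)] mult_mat_vec_carrier[OF that] cv)
  have form: "scalar_prod (cvec u) (C *\<^sub>v (S *\<^sub>v y)) = (\<Sum>i<d. \<alpha> $ i * y $ i)" if y: "y \<in> carrier_vec d" for y
  proof -
    have "C *\<^sub>v (S *\<^sub>v y) = (C * S) *\<^sub>v y" by (rule assoc_mult_mat_vec[OF C jw.carriers(2) y, symmetric])
    then have "scalar_prod (cvec u) (C *\<^sub>v (S *\<^sub>v y)) = scalar_prod \<alpha> y"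
      unfolding \<alpha>_def by (simp only: transpose_vec_mult_scalar[OF CS y cu])
    then show ?thesis using y by (simp add: scalar_prod_def lessThan_atLeast0)
  qed
  have quad: "scalar_prod (cvec u) ((C * jw.rot h * Y) *\<^sub>v cvec v)
      = (\<Sum>i<d. \<alpha> $ i * (jw.phase_val h (jw.ev i) * \<beta> Y $ i))" if Y: "Y \<in> carrier_mat d d" for h Y
  proof -
    have Yv: "Y *\<^sub>v cvec v \<in> carrier_vec d" by (rule mult_mat_vec_carrier[OF Y cv])
    have D: "jw.diag_phase h *\<^sub>v \<beta> Y \<in> carrier_vec d" by (rule mult_mat_vec_carrier[OF jw.diag_phase_carrier \<beta>c[OF Y]])
    have "(C * jw.rot h * Y) *\<^sub>v cvec v = C *\<^sub>v (jw.rot h *\<^sub>v (Y *\<^sub>v cvec v))"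
      using assoc_mult_mat_vec[OF mult_carrier_mat[OF C jw.rot_carrier] Y cv]
        assoc_mult_mat_vec[OF C jw.rot_carrier Yv] by simp
    also have "jw.rot h *\<^sub>v (Y *\<^sub>v cvec v) = S *\<^sub>v (jw.diag_phase h *\<^sub>v \<beta> Y)"
      unfolding \<beta>_def by (rule jw.rot_mult[OF Yv])
    finally have "scalar_prod (cvec u) ((C * jw.rot h * Y) *\<^sub>v cvec v)
       = (\<Sum>i<d. \<alpha> $ i * (jw.diag_phase h *\<^sub>v \<beta> Y) $ i)" using form[OF D] by simp
    then show ?thesis using jw.diag_phase_mult[OF \<beta>c[OF Y]] by simp
  qed
  have \<beta>lim: "(\<lambda>N. \<beta> (X N) $ i) \<longlonglongrightarrow> \<beta> L $ i" if i: "i < d" for i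
  proof -
    have e: "\<beta> Y $ i = (\<Sum>a<d. Q $$ (i, a) * (\<Sum>b<d. Y $$ (a, b) * cvec v $ b))" if "Y \<in> carrier_mat d d" for Y
      unfolding \<beta>_def by (rule mult_mat_mat_vec_entry[OF jw.carriers(3) that cv i])
    show ?thesis unfolding e[OF L] e[OF X]
      by (intro tendsto_sum tendsto_mult tendsto_const Xlim) auto
  qed
  define t where "t N = c N * block_sum k f N" for N
  have t: "complex_of_real (t N) = (\<Sum>i<d. \<alpha> $ i * (jw.phase_val (phase_power cM N) (jw.ev i) * \<beta> (X N) $ i))" for N
  proof -
    have Mv: "M ^\<^sub>m N *\<^sub>v v \<in> carrier_vec d" by (rule pow_mult_vec_carrier) simp
    have Mp: "M ^\<^sub>m N \<in> carrier_mat d d" by (rule pow_carrier_mat[OF restr_carrier[OF total_mat_carrier]])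
    define y where "y = Q *\<^sub>v cvec v"
    have y: "y \<in> carrier_vec d" unfolding y_def by (rule mult_mat_vec_carrier[OF jw.carriers(3) cv])
    have JN: "jw.J ^\<^sub>m N \<in> carrier_mat d d" by (rule pow_carrier_mat[OF jw.carriers(1)])
    have Jy: "jw.J ^\<^sub>m N *\<^sub>v y \<in> carrier_vec d" by (rule mult_mat_vec_carrier[OF JN y])
    have "complex_of_real (block_sum k f N) = scalar_prod (cvec u) (cvec ((T - A 0) *\<^sub>v (M ^\<^sub>m N *\<^sub>v v)))"
      unfolding block_sum_total using cvec_scalar_prod[OF u_carrier mult_mat_vec_carrier[OF TA Mv]] by simp
    also have "cvec ((T - A 0) *\<^sub>v (M ^\<^sub>m N *\<^sub>v v)) = C *\<^sub>v (cM ^\<^sub>m N *\<^sub>v cvec v)"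
      unfolding C_def using cmat_mult_vec[OF TA Mv] cmat_mult_vec[OF Mp v_carrier]
        cmat_pow[OF restr_carrier[OF total_mat_carrier]] by simp
    also have "cM ^\<^sub>m N *\<^sub>v cvec v = S *\<^sub>v (jw.J ^\<^sub>m N *\<^sub>v y)"
      unfolding jw.pow_eq y_def
      using assoc_mult_mat_vec[OF mult_carrier_mat[OF jw.carriers(2) JN] jw.carriers(3) cv]
        assoc_mult_mat_vec[OF jw.carriers(2) JN y] by (simp add: y_def)
    finally have 1: "complex_of_real (t N) = (\<Sum>i<d. \<alpha> $ i * (of_real (c N) * (jw.J ^\<^sub>m N *\<^sub>v y) $ i))"
      unfolding t_def using form[OF Jy] by (simp add: sum_distrib_left mult_ac del: index_mult_mat_vec)
    let ?W = "Matrix.mat d d (\<lambda>(i, j). jw.phase_val ?pi (jw.ev i) ^ N * (jw.J ^\<^sub>m N) $$ (i, j))"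
    have W: "?W \<in> carrier_mat d d" by simp
    have Wy: "(?W *\<^sub>v y) $ i = jw.phase_val ?pi (jw.ev i) ^ N * (jw.J ^\<^sub>m N *\<^sub>v y) $ i" if "i < d" for i
      using that y carrier_matD[OF JN] by (simp add: scalar_prod_def sum_distrib_left mult.assoc)
    have "X N = of_real (c N) \<cdot>\<^sub>m (jw.rot ?pi ^\<^sub>m N * cM ^\<^sub>m N)"
      using carrier_matD[OF mult_carrier_mat[OF pow_carrier_mat[OF jw.rot_carrier, of ?pi N] pow_carrier_mat[OF cM_carrier, of N]]]
      by (intro eq_matI) (simp_all add: X_def)
    then have XS: "X N = of_real (c N) \<cdot>\<^sub>m (S * ?W * Q)" unfolding jw.rot_pow_mult .
    have SWQ: "S * ?W * Q \<in> carrier_mat d d"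
      by (rule mult_carrier_mat[OF mult_carrier_mat[OF jw.carriers(2) W] jw.carriers(3)])
    have Wyc: "?W *\<^sub>v y \<in> carrier_vec d" by (rule mult_mat_vec_carrier[OF W y])
    have "(S * ?W * Q) *\<^sub>v cvec v = S *\<^sub>v (?W *\<^sub>v y)"
      unfolding y_def
      using assoc_mult_mat_vec[OF mult_carrier_mat[OF jw.carriers(2) W] jw.carriers(3) cv]
        assoc_mult_mat_vec[OF jw.carriers(2) W y] by (simp add: y_def)
    then have "X N *\<^sub>v cvec v = of_real (c N) \<cdot>\<^sub>v (S *\<^sub>v (?W *\<^sub>v y))"
      unfolding XS using smult_mat_mult_vec[OF SWQ cv] by simp
    then have "\<beta> (X N) = of_real (c N) \<cdot>\<^sub>v (Q *\<^sub>v (S *\<^sub>v (?W *\<^sub>v y)))"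
      unfolding \<beta>_def using mult_mat_vec[OF jw.carriers(3) mult_mat_vec_carrier[OF jw.carriers(2) Wyc]] by simp
    then have \<beta>X: "\<beta> (X N) = of_real (c N) \<cdot>\<^sub>v (?W *\<^sub>v y)" using jw.QS[OF Wyc] by simp
    have "of_real (c N) * (jw.J ^\<^sub>m N *\<^sub>v y) $ i = jw.phase_val (phase_power cM N) (jw.ev i) * \<beta> (X N) $ i"
      if i: "i < d" for i
    proof -
      \<comment> \<open>On the circle of radius \<rho>, g^N meets the N-th power of the inverse of
        g; elsewhere both factors are 1.\<close>
      have one: "jw.phase_val (phase_power cM N) (jw.ev i) * jw.phase_val ?pi (jw.ev i) ^ N = 1"
      proof (cases "cmod (jw.ev i) = \<rho>")
        case True
        have "jw.ev i / of_real \<rho> \<noteq> 0" using True \<rho> by auto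
        then show ?thesis using True ph[OF i True]
          by (simp add: jw.phase_val_def phase_power_def phase_inverse_def flip: power_mult_distrib)
      qed (simp add: jw.phase_val_def)
      have \<beta>i: "\<beta> (X N) $ i = of_real (c N) * (?W *\<^sub>v y) $ i"
        unfolding \<beta>X using i by (intro index_smult_vec(1)) simp
      have "a * z = x * (a * (w * z))" if "x * w = 1" for x a w z :: complex
        using arg_cong[OF that, of "\<lambda>y. y * (a * z)"] by (simp add: mult_ac)
      from this[OF one] show ?thesis unfolding \<beta>i Wy[OF i] .
    qed
    then show ?thesis unfolding 1 by (intro sum.cong refl arg_cong[where f = "(*) _"]) (simp only: lessThan_iff)
  qed
  have pv1: "cmod (jw.phase_val (phase_power cM N) (jw.ev i)) \<le> 1" for N i
    by (auto simp: jw.phase_val_def phase_power_def phases_def norm_power)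
  have "\<exists>a>0. \<forall>\<^sub>F N in sequentially. a \<le> t N"
  proof (rule eventually_pos_lower_bound)
    fix r :: "nat \<Rightarrow> nat" assume r: "strict_mono r"
    have finp: "finite (phases cM)"
    proof (rule finite_imageD)
      show "finite ((\<lambda>g. g * complex_of_real \<rho>) ` phases cM)"
        by (rule finite_subset[OF _ card_finite_spectrum(1)[OF cM_carrier]])
          (auto simp: phases_def spectrum_def \<rho>_def)
      show "inj_on (\<lambda>g. g * complex_of_real \<rho>) (phases cM)" using \<rho> by (auto simp: inj_on_def)
    qed
    have "\<exists>r'. strict_mono (r' :: nat \<Rightarrow> nat) \<and> (\<forall>g\<in>phases cM. convergent ((\<lambda>n. g ^ r n) \<circ> r'))"
      by (rule finite_family_convergent_subseq[OF finp])
        (auto simp: bounded_iff phases_def norm_power intro!: exI[of _ 1])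
    then obtain r' where r': "strict_mono (r' :: nat \<Rightarrow> nat)"
      and cg: "\<And>g. g \<in> phases cM \<Longrightarrow> convergent (\<lambda>n. g ^ r (r' n))" by (auto simp: o_def)
    \<comment> \<open>The value 1 off the phases agrees with \<open>phase_power\<close>, which makes
      the convergence pointwise everywhere and puts h into the closure.\<close>
    define h where "h g = (if g \<in> phases cM then lim (\<lambda>n. g ^ r (r' n)) else 1)" for g
    have hlim: "(\<lambda>n. phase_power cM (r (r' n))) \<longlonglongrightarrow> h"
      by (rule tendsto_funI) (use cg in \<open>auto simp: phase_power_def h_def convergent_LIMSEQ_iff\<close>)
    have rr: "strict_mono (r \<circ> r')" using r r' by (rule strict_mono_o)
    have ge: "\<forall>\<^sub>F n in sequentially. phase_power cM (r (r' n)) \<in> phase_group cM"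
      using eventually_ge_at_top[of 1]
    proof eventually_elim
      case (elim n)
      then have "1 \<le> r (r' n)" using seq_suble[OF rr, of n] by simp
      then show ?case by (rule pp)
    qed
    have hG: "h \<in> phase_group cM"
      by (rule Lim_in_closed_set[OF _ ge _ hlim]) (simp_all add: phase_group_def)
    have zpos: "0 < Re (z h)" by (rule pos[OF hG])
    have "(\<lambda>n. complex_of_real (t (r (r' n)))) \<longlonglongrightarrow> z h"
      unfolding t z_def rot quad[OF L]
    proof (intro tendsto_sum tendsto_mult tendsto_const)
      fix i assume "i \<in> {..<d}"
      then have i: "i < d" by simp
      show "(\<lambda>n. \<beta> (X (r (r' n))) $ i) \<longlonglongrightarrow> \<beta> L $ i"
        using LIMSEQ_subseq_LIMSEQ[OF \<beta>lim[OF i] rr] by (simp add: o_def)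
      show "(\<lambda>n. jw.phase_val (phase_power cM (r (r' n))) (jw.ev i)) \<longlonglongrightarrow> jw.phase_val h (jw.ev i)"
        using ph[OF i] cg by (auto simp: jw.phase_val_def phase_power_def h_def convergent_LIMSEQ_iff)
    qed
    then have "(\<lambda>n. Re (complex_of_real (t (r (r' n))))) \<longlonglongrightarrow> Re (z h)" by (rule tendsto_Re)
    then show "\<exists>r' l. strict_mono r' \<and> 0 < l \<and> (t \<circ> r \<circ> r') \<longlonglongrightarrow> l"
      using r' zpos by (intro exI[of _ r'] exI[of _ "Re (z h)"]) (simp add: o_def)
  qed
  then obtain a where a: "0 < a" "\<forall>\<^sub>F N in sequentially. a \<le> t N" by blast
  \<comment> \<open>For the upper bound the phases have modulus at most 1, and the remaining factors
    converge.\<close>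
  have "\<exists>b. \<forall>N. t N \<le> b"
  proof -
    have "Bseq (\<lambda>N. \<Sum>i<d. cmod (\<alpha> $ i) * cmod (\<beta> (X N) $ i))"
      by (intro convergent_imp_Bseq convergent_sum convergent_mult convergent_const convergentI[OF tendsto_norm[OF \<beta>lim]]) auto
    then obtain b where b: "\<And>N. norm (\<Sum>i<d. cmod (\<alpha> $ i) * cmod (\<beta> (X N) $ i)) \<le> b"
      by (auto simp: Bseq_def)
    have "t N \<le> b" for N
    proof -
      have "t N \<le> cmod (complex_of_real (t N))" by simp
      also have "\<dots> \<le> (\<Sum>i<d. cmod (\<alpha> $ i * (jw.phase_val (phase_power cM N) (jw.ev i) * \<beta> (X N) $ i)))"
        unfolding t by (rule norm_sum)
      also have "\<dots> \<le> (\<Sum>i<d. cmod (\<alpha> $ i) * cmod (\<beta> (X N) $ i))"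
        unfolding norm_mult using pv1 by (intro sum_mono mult_left_mono mult_left_le_one_le) auto
      also have "\<dots> \<le> b" using b[of N] by simp
      finally show ?thesis .
    qed
    then show ?thesis by blast
  qed
  then obtain b where b: "\<And>N. t N \<le> b" by blast
  have "\<forall>\<^sub>F N in sequentially. (a / \<kappa>) * (real N ^ s * \<rho> ^ N) \<le> block_sum k f N \<and>
     block_sum k f N \<le> (b / \<kappa>) * (real N ^ s * \<rho> ^ N)"
    using a(2) eventually_ge_at_top[of 1]
  proof eventually_elim
    case (elim N)
    have p: "0 < real N ^ s * \<rho> ^ N" using elim(2) \<rho> by simp
    have "block_sum k f N = (t N / \<kappa>) * (real N ^ s * \<rho> ^ N)"
    proof -
      have "x = (\<kappa> / y * x) / \<kappa> * y" if "0 < y" for x y using that \<kappa> by simp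
      from this[OF p] show ?thesis unfolding t_def c .
    qed
    moreover have "(a / \<kappa>) * (real N ^ s * \<rho> ^ N) \<le> (t N / \<kappa>) * (real N ^ s * \<rho> ^ N)"
      "(t N / \<kappa>) * (real N ^ s * \<rho> ^ N) \<le> (b / \<kappa>) * (real N ^ s * \<rho> ^ N)"
      using elim(1) b[of N] p \<kappa> by (intro mult_right_mono divide_right_mono; simp)+
    ultimately show ?case by simp
  qed
  then show ?thesis using \<rho> a(1) \<kappa> by (intro exI[of _ s] exI[of _ "a / \<kappa>"] exI[of _ "b / \<kappa>"] exI[of _ \<rho>]) simp
qed

end


section \<open>Canonical representations\<close>

lemma digit_length_exists:
  assumes "2 \<le> k" "1 \<le> (n :: nat)"
  shows "\<exists>L. k ^ L \<le> n \<and> n < k ^ (L + 1)"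
proof -
  have "\<exists>L. n < k ^ L" using assms power_gt_expt[of k n] by auto
  define L where "L = (LEAST L. n < k ^ L)"
  have L: "n < k ^ L" unfolding L_def by (rule LeastI_ex) fact
  obtain L' where L': "L = Suc L'" using L assms by (cases L) auto
  have "\<not> n < k ^ L'" using not_less_Least[of L' "\<lambda>L. n < k ^ L"] L' unfolding L_def by simp
  then show ?thesis using L L' by (intro exI[of _ L']) auto
qed

text \<open>The sampled indices are distinct and have exactly N + l + L + 1 digits: n has L + 1 of
  them, r stands for N and r0 for l. They all lie in one block, and f is nonnegative.\<close>

lemma subsampled_block_le:
  assumes k: "2 \<le> k" and f: "\<And>n. 0 \<le> f n" and L: "k ^ L \<le> n" "n < k ^ (L + 1)" and r0: "r0 < k ^ l"
  shows "(\<Sum>r<k ^ N. f (k ^ l * (n * k ^ N + r) + r0)) \<le> block_sum k f (N + l + L)"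
proof -
  let ?g = "\<lambda>r. k ^ l * (n * k ^ N + r) + r0"
  have kl: "0 < k ^ l" using k by simp
  have "inj_on ?g {..<k ^ N}" using kl by (auto simp: inj_on_def)
  then have "(\<Sum>r<k ^ N. f (?g r)) = sum f (?g ` {..<k ^ N})" by (simp add: sum.reindex o_def)
  also have "\<dots> \<le> sum f {k ^ (N + l + L)..<k ^ (N + l + L + 1)}"
  proof (rule sum_mono2)
    show "?g ` {..<k ^ N} \<subseteq> {k ^ (N + l + L)..<k ^ (N + l + L + 1)}"
    proof (rule image_subsetI)
      fix r assume "r \<in> {..<k ^ N}"
      then have r: "Suc r \<le> k ^ N" by simp
      have "k ^ (N + l + L) = k ^ l * (k ^ L * k ^ N)" by (simp add: power_add mult_ac)
      also have "\<dots> \<le> k ^ l * (n * k ^ N)" using L(1) by (intro mult_le_mono) auto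
      also have "\<dots> \<le> ?g r" by (simp add: algebra_simps)
      finally have 1: "k ^ (N + l + L) \<le> ?g r" .
      have "?g r < k ^ l * (n * k ^ N + Suc r)" using r0 by (simp add: algebra_simps)
      also have "\<dots> \<le> k ^ l * (n * k ^ N + k ^ N)" using r by (intro mult_le_mono2 add_left_mono)
      also have "\<dots> = k ^ l * (Suc n * k ^ N)" by (simp add: algebra_simps)
      also have "\<dots> \<le> k ^ l * (k ^ (L + 1) * k ^ N)" using L(2) by (intro mult_le_mono2 mult_le_mono1) simp
      also have "\<dots> = k ^ (N + l + L + 1)" by (simp add: power_add mult_ac)
      finally show "?g r \<in> {k ^ (N + l + L)..<k ^ (N + l + L + 1)}" using 1 by simp
    qed
  qed (use f in auto)
  finally show ?thesis using block_sum_interval[OF k, of f "N + l + L"] by simp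
qed

text \<open>Expanding x in unit vectors leaves real pairings, which can be estimated by sums of f
  even though x is complex.\<close>

lemma cvec_row_pow:
  fixes y :: "real vec" and B :: "real mat" and x :: "complex vec"
  assumes y: "y \<in> carrier_vec d" and B: "B \<in> carrier_mat d d" and x: "x \<in> carrier_vec d"
  shows "scalar_prod (cvec y) (cmat B *\<^sub>v x) = (\<Sum>i<d. x $ i * of_real (y \<bullet> (B *\<^sub>v unit_vec d i)))"
proof -
  have B': "dim_row B = d" "dim_col B = d" using B by auto
  have y': "dim_vec y = d" using y by simp
  have x': "dim_vec x = d" using x by simp
  have "scalar_prod (cvec y) (cmat B *\<^sub>v x) = (\<Sum>a<d. \<Sum>i<d. x $ i * of_real (y $ a * B $$ (a, i)))"
    using B' y' x' by (auto simp: scalar_prod_def lessThan_atLeast0 sum_distrib_left mult_ac intro!: sum.cong)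
  also have "\<dots> = (\<Sum>i<d. \<Sum>a<d. x $ i * of_real (y $ a * B $$ (a, i)))" by (rule sum.swap)
  also have "\<dots> = (\<Sum>i<d. x $ i * of_real (y \<bullet> (B *\<^sub>v unit_vec d i)))"
  proof (rule sum.cong[OF refl])
    fix i assume "i \<in> {..<d}"
    then have i: "i < d" by simp
    have c: "(B *\<^sub>v unit_vec d i) $ a = B $$ (a, i)" if "a < d" for a
      using i that B B' by (simp add: scalar_prod_right_unit)
    have "y \<bullet> (B *\<^sub>v unit_vec d i) = (\<Sum>a<d. y $ a * (B *\<^sub>v unit_vec d i) $ a)"
      using B' by (simp add: scalar_prod_def lessThan_atLeast0)
    then have "y \<bullet> (B *\<^sub>v unit_vec d i) = (\<Sum>a<d. y $ a * B $$ (a, i))" using c by simp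
    then show "(\<Sum>a<d. x $ i * of_real (y $ a * B $$ (a, i))) = x $ i * of_real (y \<bullet> (B *\<^sub>v unit_vec d i))"
      by (simp add: sum_distrib_left)
  qed
  finally show ?thesis .
qed

lemma scalar_prod_mat_entries:
  fixes y z :: "real vec"
  assumes y: "y \<in> carrier_vec d" and B: "B \<in> carrier_mat d d" and z: "z \<in> carrier_vec d"
  shows "y \<bullet> (B *\<^sub>v z) = (\<Sum>a<d. \<Sum>b<d. (y $ a * z $ b) * B $$ (a, b))"
  using y B z by (auto simp: scalar_prod_def lessThan_atLeast0 sum_distrib_left mult_ac intro!: sum.cong)

text \<open>The constants \<open>s\<close>, \<open>a\<close>, \<open>b\<close> and \<rho> come from
  a nondegenerate representation that may differ from this one. Only the resulting bounds on block
  sums are carried over, and at first nothing relates \<rho> to the spectrum of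
  \<open>M\<close>.\<close>

locale canonical_growth = lin_rep k d f u v A
  for k d :: nat and f :: "nat \<Rightarrow> real" and u v :: "real vec" and A :: "nat \<Rightarrow> real mat" +
  fixes s :: nat and a b \<rho> :: real
  assumes f_nonneg: "\<And>n. 0 \<le> f n"
    and canonical: "canonical_rep k f d u A v"
    and nonneg: "\<And>i. i < k \<Longrightarrow> nonneg_entries (restr_mat k d u A (A i))"
    and \<rho>: "0 < \<rho>" and a: "0 < a"
    and lower: "\<forall>\<^sub>F N in sequentially. a * (real N ^ s * \<rho> ^ N) \<le> block_sum k f N"
    and upper: "\<forall>\<^sub>F N in sequentially. block_sum k f N \<le> b * (real N ^ s * \<rho> ^ N)"
begin

text \<open>The vector of basis sequences starts at \<open>u\<close> and obeys the same recursion
  under appending a digit as the rows, so the two agree.\<close>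

lemma row_vec_entry_kernel:
  "\<exists>l r. \<forall>i<d. r i < k ^ l i \<and> (\<forall>n. row_vec n $ i = f (k ^ l i * n + r i))"
proof -
  obtain F :: "nat \<Rightarrow> nat \<Rightarrow> real" where F: "F ` {..<d} \<subseteq> kernel_seqs k f"
    "\<And>n j. j < k \<Longrightarrow> Matrix.vec d (\<lambda>i. F i (k * n + j)) = transpose_mat (A j) *\<^sub>v Matrix.vec d (\<lambda>i. F i n)"
    "u = Matrix.vec d (\<lambda>i. F i 0)"
    using canonical unfolding canonical_rep_def by blast
  have row: "Matrix.vec d (\<lambda>i. F i n) = row_vec n" for n
  proof (induction n rule: less_induct)
    case (less n)
    show ?case
    proof (cases "n = 0")
      case True
      have "row_vec 0 = u" unfolding row_vec_def by (subst digit_mat.simps) simp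
      then show ?thesis using F(3)[symmetric] True by simp
    next
      case False
      have m: "n mod k < k" "n div k < n" using k2 False by auto
      have e: "k * (n div k) + n mod k = n" by simp
      have "Matrix.vec d (\<lambda>i. F i n) = transpose_mat (A (n mod k)) *\<^sub>v row_vec (n div k)"
        using F(2)[OF m(1), of "n div k"] less[OF m(2)] unfolding e by simp
      then show ?thesis using row_vec_step[OF m(1), of "n div k"] False unfolding e by simp
    qed
  qed
  have "\<exists>l r. r < k ^ l \<and> (\<forall>n. row_vec n $ i = f (k ^ l * n + r))" if i: "i < d" for i
  proof -
    have "F i \<in> kernel_seqs k f" using F(1) i by blast
    then obtain l r where lr: "F i = (\<lambda>n. f (k ^ l * n + r))" "r < k ^ l" by (auto simp: kernel_seqs_def)
    then have "row_vec n $ i = f (k ^ l * n + r)" for n using i by (simp add: row[symmetric])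
    then show ?thesis using lr(2) by blast
  qed
  then show ?thesis by metis
qed

lemma upper_shift_tendsto_0:
  assumes "\<rho> < \<sigma>"
  shows "(\<lambda>N. block_sum k f (N + e) / \<sigma> ^ N) \<longlonglongrightarrow> 0"
proof (rule tendsto_sandwich[OF _ _ tendsto_const])
  have \<sigma>: "0 < \<sigma>" using \<rho> assms by simp
  show "\<forall>\<^sub>F N in sequentially. 0 \<le> block_sum k f (N + e) / \<sigma> ^ N"
    using \<sigma> f_nonneg by (intro always_eventually allI divide_nonneg_nonneg) (auto simp: block_sum_def intro!: sum_nonneg)
  have "\<forall>\<^sub>F N in sequentially. block_sum k f (N + e) \<le> b * (real (N + e) ^ s * \<rho> ^ (N + e))"
    using upper eventually_sequentially_seg[of "\<lambda>N. block_sum k f N \<le> b * (real N ^ s * \<rho> ^ N)" e] by blast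
  then show "\<forall>\<^sub>F N in sequentially. block_sum k f (N + e) / \<sigma> ^ N \<le> (b * \<sigma> ^ e) * (real (N + e) ^ s * (\<rho> / \<sigma>) ^ (N + e))"
  proof eventually_elim
    case (elim N)
    then have "block_sum k f (N + e) / \<sigma> ^ N \<le> b * (real (N + e) ^ s * \<rho> ^ (N + e)) / \<sigma> ^ N"
      using \<sigma> by (intro divide_right_mono) auto
    also have "\<dots> = (b * \<sigma> ^ e) * (real (N + e) ^ s * (\<rho> / \<sigma>) ^ (N + e))"
      using \<sigma> by (simp add: power_add power_divide)
    finally show ?case .
  qed
  have "(\<lambda>N. real N ^ s * (\<rho> / \<sigma>) ^ N) \<longlonglongrightarrow> 0"
    using \<rho> \<sigma> assms by (intro power_times_geometric_tendsto_0) auto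
  then have "(\<lambda>N. real (N + e) ^ s * (\<rho> / \<sigma>) ^ (N + e)) \<longlonglongrightarrow> 0" by (rule LIMSEQ_ignore_initial_segment)
  then show "(\<lambda>N. (b * \<sigma> ^ e) * (real (N + e) ^ s * (\<rho> / \<sigma>) ^ (N + e))) \<longlonglongrightarrow> 0"
    by (rule tendsto_mult_right_zero)
qed

text \<open>The entries of \<^term>\<open>row_vec n\<close> are kernel sequences, so pairing it with \<open>M\<^sup>N\<close> applied to a unit
  vector sums nonnegative values of \<open>f\<close> over part of a single block.\<close>

lemma eigenvalue_le:
  assumes z: "eigenvalue cM z"
  shows "cmod z \<le> \<rho>"
proof (rule ccontr)
  assume "\<not> cmod z \<le> \<rho>"
  then have gt: "\<rho> < cmod z" by simp
  then have z0: "z \<noteq> 0" using \<rho> by auto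
  have Mc: "M \<in> carrier_mat d d" by simp
  obtain x where xe: "eigenvector cM x z" using z unfolding eigenvalue_def by blast
  then have x: "x \<in> carrier_vec d" "x \<noteq> 0\<^sub>v d" "cM *\<^sub>v x = z \<cdot>\<^sub>v x"
    using carrier_matD[OF Mc] unfolding eigenvector_def by auto
  obtain n where n: "n \<ge> 1" "scalar_prod (cvec (row_vec n)) x \<noteq> 0"
    using eigenvector_detected[OF x z0] by blast
  obtain L where L: "k ^ L \<le> n" "n < k ^ (L + 1)" using digit_length_exists[OF k2 n(1)] by blast
  obtain l r where lr: "\<And>i. i < d \<Longrightarrow> r i < k ^ l i" "\<And>i n. i < d \<Longrightarrow> row_vec n $ i = f (k ^ l i * n + r i)"
    using row_vec_entry_kernel by blast
  \<comment> \<open>A nonzero pairing of the eigenvector with a row. Applying \<open>M^N\<close>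
    multiplies it by z^N, while the block sums that dominate it are o(|z|^N).\<close>
  define \<delta> where "\<delta> = scalar_prod (cvec (row_vec n)) x"
  have bnd: "cmod \<delta> \<le> (\<Sum>i<d. cmod (x $ i) * (block_sum k f (N + (l i + L)) / cmod z ^ N))" for N
  proof -
    have "cM ^\<^sub>m N *\<^sub>v x = z ^ N \<cdot>\<^sub>v x" by (rule eigenvector_pow[OF cM_carrier xe])
    then have "z ^ N * \<delta> = scalar_prod (cvec (row_vec n)) (cM ^\<^sub>m N *\<^sub>v x)"
      unfolding \<delta>_def using x(1) by (simp add: scalar_prod_smult_distrib[of _ d])
    also have "\<dots> = (\<Sum>i<d. x $ i * of_real (row_vec n \<bullet> (M ^\<^sub>m N *\<^sub>v unit_vec d i)))"
      unfolding cmat_pow[OF Mc, symmetric]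
      by (rule cvec_row_pow[OF row_vec_carrier pow_carrier_mat[OF Mc] x(1)])
    finally have "cmod z ^ N * cmod \<delta> = cmod (\<Sum>i<d. x $ i * of_real (row_vec n \<bullet> (M ^\<^sub>m N *\<^sub>v unit_vec d i)))"
      by (metis norm_mult norm_power)
    also have "\<dots> \<le> (\<Sum>i<d. cmod (x $ i * of_real (row_vec n \<bullet> (M ^\<^sub>m N *\<^sub>v unit_vec d i))))"
      by (rule norm_sum)
    also have "\<dots> \<le> (\<Sum>i<d. cmod (x $ i) * block_sum k f (N + (l i + L)))"
    proof (rule sum_mono)
      fix i assume "i \<in> {..<d}"
      then have i: "i < d" by simp
      have "row_vec n \<bullet> (M ^\<^sub>m N *\<^sub>v unit_vec d i) = (\<Sum>r<k ^ N. row_vec (n * k ^ N + r) \<bullet> unit_vec d i)"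
        by (rule row_vec_pow[OF n(1)]) simp
      also have "\<dots> = (\<Sum>r'<k ^ N. f (k ^ l i * (n * k ^ N + r') + r i))"
        using i by (simp add: scalar_prod_right_unit lr(2))
      finally have e: "row_vec n \<bullet> (M ^\<^sub>m N *\<^sub>v unit_vec d i) = (\<Sum>r'<k ^ N. f (k ^ l i * (n * k ^ N + r') + r i))" .
      have "0 \<le> row_vec n \<bullet> (M ^\<^sub>m N *\<^sub>v unit_vec d i)"
        unfolding e using f_nonneg by (intro sum_nonneg) auto
      moreover have "row_vec n \<bullet> (M ^\<^sub>m N *\<^sub>v unit_vec d i) \<le> block_sum k f (N + (l i + L))"
        unfolding e using subsampled_block_le[OF k2 f_nonneg L lr(1)[OF i], where N = N] by (simp add: add.assoc)
      ultimately show "cmod (x $ i * of_real (row_vec n \<bullet> (M ^\<^sub>m N *\<^sub>v unit_vec d i))) \<le> cmod (x $ i) * block_sum k f (N + (l i + L))"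
        by (simp add: norm_mult mult_left_mono)
    qed
    finally have "cmod \<delta> \<le> (\<Sum>i<d. cmod (x $ i) * block_sum k f (N + (l i + L))) / cmod z ^ N"
      using z0 by (simp add: pos_le_divide_eq mult.commute)
    then show ?thesis by (simp add: sum_divide_distrib)
  qed
  have "(\<lambda>N. \<Sum>i<d. cmod (x $ i) * (block_sum k f (N + (l i + L)) / cmod z ^ N)) \<longlonglongrightarrow> 0"
    by (intro tendsto_null_sum tendsto_mult_right_zero upper_shift_tendsto_0 gt)
  then have "cmod \<delta> \<le> 0" by (rule LIMSEQ_le_const) (use bnd in auto)
  then show False using n(2) by (simp add: \<delta>_def)
qed

text \<open>If all eigenvalues had modulus below \<rho>, the block sums would be o(\<rho>^N),
  against the lower bound. The other inequality is \<open>eigenvalue_le\<close>.\<close>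

lemma spectral_radius_eq: "spectral_radius cM = \<rho>"
proof -
  have "\<not> (\<forall>z. eigenvalue cM z \<longrightarrow> cmod z < \<rho>)"
  proof
    assume lt: "\<forall>z. eigenvalue cM z \<longrightarrow> cmod z < \<rho>"
    have ent: "(\<lambda>N. (M ^\<^sub>m N) $$ (i, j) / \<rho> ^ N) \<longlonglongrightarrow> 0" if "i < d" "j < d" for i j
    proof -
      have "(\<lambda>N. (cM ^\<^sub>m N) $$ (i, j) / of_real \<rho> ^ N) \<longlonglongrightarrow> 0"
        using lt \<rho> that by (intro matrix_power_tendsto_0[OF cM_carrier]) auto
      moreover have "(cM ^\<^sub>m N) $$ (i, j) / of_real \<rho> ^ N = of_real ((M ^\<^sub>m N) $$ (i, j) / \<rho> ^ N)" for N
        using that carrier_matD[OF pow_carrier_mat[OF restr_carrier[OF total_mat_carrier], of N]]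
        by (simp add: cmat_pow[OF restr_carrier[OF total_mat_carrier], symmetric] del: pow_mat_dim_square)
      ultimately have "(\<lambda>N. complex_of_real ((M ^\<^sub>m N) $$ (i, j) / \<rho> ^ N)) \<longlonglongrightarrow> of_real 0" by (simp only: of_real_0)
      then show ?thesis by (simp only: tendsto_of_real_iff)
    qed
    have "block_sum k f N / \<rho> ^ N = (\<Sum>m=1..<k. \<Sum>i<d. \<Sum>j<d. (row_vec m $ i * v $ j) * ((M ^\<^sub>m N) $$ (i, j) / \<rho> ^ N))" for N
      unfolding block_sum_eq
      using scalar_prod_mat_entries[OF row_vec_carrier pow_carrier_mat[OF restr_carrier[OF total_mat_carrier]] v_carrier]
      by (simp add: sum_divide_distrib)
    then have "(\<lambda>N. block_sum k f N / \<rho> ^ N) \<longlonglongrightarrow> 0"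
      by (simp only:) (intro tendsto_null_sum tendsto_mult_right_zero ent; simp)
    moreover have "\<forall>\<^sub>F N in sequentially. a \<le> block_sum k f N / \<rho> ^ N"
      using lower eventually_ge_at_top[of 1]
    proof eventually_elim
      case (elim N)
      have "a * 1 \<le> a * real N ^ s" using a elim(2) by (intro mult_left_mono one_le_power) auto
      also have "\<dots> \<le> block_sum k f N / \<rho> ^ N" using elim(1) \<rho> by (simp add: pos_le_divide_eq mult_ac)
      finally show ?case by simp
    qed
    ultimately have "a \<le> 0" by (rule tendsto_lowerbound) simp
    then show False using a by simp
  qed
  then obtain z where z: "eigenvalue cM z" "\<rho> \<le> cmod z" by force
  have d: "0 < d" using eigenvalue_imp_nonzero_dim[OF cM_carrier z(1)] by simp
  have "spectral_radius cM \<le> \<rho>"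
    using spectral_radius_mem_max(1)[OF cM_carrier d] eigenvalue_le by (auto simp: spectrum_def)
  moreover have "\<rho> \<le> spectral_radius cM" using eigenvalue_le_spectral_radius[OF cM_carrier z(1)] z(2) by simp
  ultimately show ?thesis by simp
qed

text \<open>Restriction is linear in the matrix, so \<open>M\<close> is the sum of the restricted
  digit matrices.\<close>

lemma M_nonneg:
  assumes "i < d" "j < d" shows "0 \<le> M $$ (i, j)"
proof -
  note P = orth_proj_carrier
  have "M $$ (i, j) = (\<Sum>y<d. \<Sum>x<d. Prj $$ (i, x) * (\<Sum>l<k. A l $$ (x, y)) * Prj $$ (y, j))"
    unfolding restr_mat_def using triple_product_entry[OF P total_mat_carrier P assms] by (simp add: total_mat_def)
  also have "\<dots> = (\<Sum>y<d. \<Sum>x<d. \<Sum>l<k. Prj $$ (i, x) * A l $$ (x, y) * Prj $$ (y, j))"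
    by (simp add: sum_distrib_left sum_distrib_right)
  also have "\<dots> = (\<Sum>y<d. \<Sum>l<k. \<Sum>x<d. Prj $$ (i, x) * A l $$ (x, y) * Prj $$ (y, j))"
    by (rule sum.cong[OF refl], rule sum.swap)
  also have "\<dots> = (\<Sum>l<k. \<Sum>y<d. \<Sum>x<d. Prj $$ (i, x) * A l $$ (x, y) * Prj $$ (y, j))"
    by (rule sum.swap)
  also have "\<dots> \<ge> 0"
  proof (rule sum_nonneg)
    fix l assume "l \<in> {..<k}"
    then have l: "l < k" by simp
    have "0 \<le> restr_mat k d u A (A l) $$ (i, j)"
      using nonneg[OF l] carrier_matD[OF restr_carrier[OF A_carrier[OF l]]] assms by (simp add: nonneg_entries_def)
    then show "0 \<le> (\<Sum>y<d. \<Sum>x<d. Prj $$ (i, x) * A l $$ (x, y) * Prj $$ (y, j))"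
      unfolding restr_mat_def using triple_product_entry[OF P A_carrier[OF l] P assms] by simp
  qed
  finally show ?thesis .
qed

section \<open>Limits of arc masses along residue classes modulo the period\<close>

abbreviation p where "p \<equiv> mat_period M"

lemma period: "0 < p" "eigenvalue cM z \<Longrightarrow> cmod z = \<rho> \<Longrightarrow> z ^ p = of_real \<rho> ^ p"
  using mat_period_props[of M d] M_nonneg spectral_radius_eq \<rho> by auto

definition prefix_sum :: "nat \<Rightarrow> nat \<Rightarrow> real" where
  "prefix_sum n N = (\<Sum>r<k ^ N. f (n * k ^ N + r))"

lemma prefix_sum_convergent:
  assumes n: "1 \<le> n"
  shows "convergent (\<lambda>m. prefix_sum n (p * m + j) / (real m ^ s * \<rho> ^ (p * m)))"
proof -
  have Mc: "M \<in> carrier_mat d d" by simp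
  obtain L where L: "k ^ L \<le> n" "n < k ^ (L + 1)" using digit_length_exists[OF k2 n] by blast
  define g where "g m = complex_of_real (prefix_sum n (p * m + j)) / of_real \<rho> ^ (p * m)" for m
  have ge: "g m = (\<Sum>a<d. \<Sum>b<d. of_real (row_vec n $ a * v $ b) * ((cM ^\<^sub>m (p * m + j)) $$ (a, b) / of_real \<rho> ^ (p * m)))" for m
  proof -
    have "prefix_sum n (p * m + j) = row_vec n \<bullet> (M ^\<^sub>m (p * m + j) *\<^sub>v v)"
      unfolding prefix_sum_def by (rule row_vec_pow_v[OF n, symmetric])
    also have "\<dots> = (\<Sum>a<d. \<Sum>b<d. (row_vec n $ a * v $ b) * (M ^\<^sub>m (p * m + j)) $$ (a, b))"
      by (rule scalar_prod_mat_entries[OF row_vec_carrier pow_carrier_mat[OF Mc] v_carrier])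
    finally have e: "complex_of_real (prefix_sum n (p * m + j)) = (\<Sum>a<d. \<Sum>b<d. of_real (row_vec n $ a * v $ b) * of_real ((M ^\<^sub>m (p * m + j)) $$ (a, b)))"
      by simp
    have c: "(cM ^\<^sub>m (p * m + j)) $$ (a, b) = of_real ((M ^\<^sub>m (p * m + j)) $$ (a, b))" if "a < d" "b < d" for a b
      unfolding cmat_pow[OF Mc, symmetric]
      using index_map_mat(1)[of a "M ^\<^sub>m (p * m + j)" b complex_of_real] that
      unfolding carrier_matD[OF pow_carrier_mat[OF Mc, of "p * m + j"]] by blast
    show ?thesis unfolding g_def e using c by (simp add: sum_divide_distrib)
  qed
  have pa: "poly_asymp g"
    unfolding ge
    by (intro poly_asymp_sum poly_asymp_cmult matrix_power_poly_asymp[OF cM_carrier \<rho> period(1)])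
      (use eigenvalue_le period(2) in auto)
  \<comment> \<open>A prefix n of L + 1 digits followed by pm + j digits falls into block number pm
    + j + L.\<close>
  define e where "e = j + L"
  have bnd: "\<forall>\<^sub>F m in sequentially. cmod (g m) \<le> (\<bar>b\<bar> * real (p + e) ^ s * \<rho> ^ e) * real m ^ s"
  proof -
    have "filterlim (\<lambda>m. p * m + e) sequentially sequentially"
      using period(1) by (intro filterlim_subseq) (auto simp: strict_mono_def)
    then have "\<forall>\<^sub>F m in sequentially. block_sum k f (p * m + e) \<le> b * (real (p * m + e) ^ s * \<rho> ^ (p * m + e))"
      using upper unfolding filterlim_iff by blast
    then show ?thesis using eventually_ge_at_top[of 1]
    proof eventually_elim
      case (elim m)
      have 0: "0 \<le> prefix_sum n (p * m + j)" unfolding prefix_sum_def using f_nonneg by (intro sum_nonneg) auto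
      have "prefix_sum n (p * m + j) \<le> block_sum k f (p * m + e)"
        using subsampled_block_le[OF k2 f_nonneg L, where N = "p * m + j" and l = 0 and ?r0.0 = 0] by (simp add: prefix_sum_def e_def add.assoc)
      \<comment> \<open>No sign is assumed for \<open>b\<close>; the absolute value makes the
        subsequent monotonicity steps possible.\<close>
      also have "\<dots> \<le> \<bar>b\<bar> * (real (p * m + e) ^ s * \<rho> ^ (p * m + e))"
        using elim(1) \<rho> by (elim order_trans) (intro mult_right_mono; simp)
      also have "\<dots> \<le> \<bar>b\<bar> * ((real (p + e) * real m) ^ s * \<rho> ^ (p * m + e))"
      proof -
        have "p * m + e \<le> (p + e) * m" using elim(2) by (cases m) (auto simp: algebra_simps)
        then have "real (p * m + e) \<le> real (p + e) * real m" by (metis of_nat_le_iff of_nat_mult)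
        then show ?thesis using \<rho> by (intro mult_left_mono mult_right_mono power_mono) auto
      qed
      also have "\<dots> = (\<bar>b\<bar> * real (p + e) ^ s * \<rho> ^ e) * real m ^ s * \<rho> ^ (p * m)"
        by (simp only: power_mult_distrib power_add mult_ac)
      finally show ?case using \<rho> 0 unfolding g_def
        by (simp only: norm_divide norm_of_real norm_power abs_of_nonneg abs_of_pos)
          (simp add: pos_divide_le_eq)
    qed
  qed
  from poly_asymp_convergent[OF pa bnd] obtain l where "(\<lambda>m. g m / of_nat m ^ s) \<longlonglongrightarrow> l" by (auto simp: convergent_def)
  then have "(\<lambda>m. Re (g m / of_nat m ^ s)) \<longlonglongrightarrow> Re l" by (rule tendsto_Re)
  moreover have "Re (g m / of_nat m ^ s) = prefix_sum n (p * m + j) / (real m ^ s * \<rho> ^ (p * m))" for m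
  proof -
    have "g m / of_nat m ^ s = of_real (prefix_sum n (p * m + j) / (real m ^ s * \<rho> ^ (p * m)))"
      by (simp add: g_def mult.commute)
    then show ?thesis by (simp only: Re_complex_of_real)
  qed
  ultimately show ?thesis by (auto simp: convergent_def)
qed

lemma block_sum_prefix: "block_sum k f N = (\<Sum>i=1..<k. prefix_sum i N)"
  unfolding block_sum_eq prefix_sum_def by (intro sum.cong refl row_vec_pow_v) simp

text \<open>Existence of the limit follows from the prefixes of one digit. It is positive because m
  <= pm + j turns the lower growth bound into the constant \<open>a * \<rho> ^ j\<close>.\<close>

lemma block_sum_limit:
  "\<exists>l>0. (\<lambda>m. block_sum k f (p * m + j) / (real m ^ s * \<rho> ^ (p * m))) \<longlonglongrightarrow> l"
proof -
  have "convergent (\<lambda>m. \<Sum>i=1..<k. prefix_sum i (p * m + j) / (real m ^ s * \<rho> ^ (p * m)))"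
    by (intro convergent_sum prefix_sum_convergent) auto
  then obtain l where l: "(\<lambda>m. block_sum k f (p * m + j) / (real m ^ s * \<rho> ^ (p * m))) \<longlonglongrightarrow> l"
    unfolding block_sum_prefix sum_divide_distrib convergent_def by blast
  have "filterlim (\<lambda>m. p * m + j) sequentially sequentially"
    using period(1) by (intro filterlim_subseq) (auto simp: strict_mono_def)
  then have "\<forall>\<^sub>F m in sequentially. a * (real (p * m + j) ^ s * \<rho> ^ (p * m + j)) \<le> block_sum k f (p * m + j)"
    using lower unfolding filterlim_iff by blast
  then have "\<forall>\<^sub>F m in sequentially. a * \<rho> ^ j \<le> block_sum k f (p * m + j) / (real m ^ s * \<rho> ^ (p * m))"
    using eventually_ge_at_top[of 1]
  proof eventually_elim
    case (elim m)
    have "m \<le> p * m + j" using period(1) by (simp add: trans_le_add1)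
    then have "a * (real m ^ s * \<rho> ^ (p * m + j)) \<le> a * (real (p * m + j) ^ s * \<rho> ^ (p * m + j))"
      using a \<rho> by (intro mult_left_mono mult_right_mono power_mono of_nat_mono) simp_all
    also note elim(1)
    finally have "a * \<rho> ^ j * (real m ^ s * \<rho> ^ (p * m)) \<le> block_sum k f (p * m + j)"
      by (simp only: power_add mult_ac)
    moreover have "0 < real m ^ s * \<rho> ^ (p * m)" using elim(2) \<rho> by simp
    ultimately show ?case by (simp only: pos_le_divide_eq)
  qed
  with l have "a * \<rho> ^ j \<le> l" by (intro tendsto_lowerbound[OF l]) auto
  moreover have "0 < a * \<rho> ^ j" using a \<rho> by simp
  ultimately show ?thesis using l by (intro exI[of _ l]) auto
qed

lemma prefix_ratio_convergent:
  assumes n: "1 \<le> n"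
  shows "convergent (\<lambda>m. prefix_sum n (p * m + j - L) / block_sum k f (p * m + j))"
proof -
  \<comment> \<open>Replacing m by m + L shifts the argument far enough that subtracting L does not
    truncate: p is positive, hence L <= pL.\<close>
  define j' where "j' = p * L + j - L"
  have pL: "L \<le> p * L" using period(1) by simp
  have e: "p * (m + L) + j - L = p * m + j'" "p * (m + L) + j = p * m + (p * L + j)" for m
  proof -
    have "p * (m + L) = p * m + p * L" by (simp add: algebra_simps)
    then show "p * (m + L) + j - L = p * m + j'" "p * (m + L) + j = p * m + (p * L + j)"
      using pL unfolding j'_def by linarith+
  qed
  obtain l1 where l1: "(\<lambda>m. prefix_sum n (p * m + j') / (real m ^ s * \<rho> ^ (p * m))) \<longlonglongrightarrow> l1"
    using prefix_sum_convergent[OF n] by (auto simp: convergent_def)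
  obtain l2 where l2: "0 < l2" "(\<lambda>m. block_sum k f (p * m + (p * L + j)) / (real m ^ s * \<rho> ^ (p * m))) \<longlonglongrightarrow> l2"
    using block_sum_limit by blast
  have "(\<lambda>m. (prefix_sum n (p * m + j') / (real m ^ s * \<rho> ^ (p * m))) /
     (block_sum k f (p * m + (p * L + j)) / (real m ^ s * \<rho> ^ (p * m)))) \<longlonglongrightarrow> l1 / l2"
    using l2(1) by (intro tendsto_divide l1 l2) simp
  moreover have "\<forall>\<^sub>F m in sequentially. (prefix_sum n (p * m + j') / (real m ^ s * \<rho> ^ (p * m))) /
     (block_sum k f (p * m + (p * L + j)) / (real m ^ s * \<rho> ^ (p * m)))
     = prefix_sum n (p * (m + L) + j - L) / block_sum k f (p * (m + L) + j)"
    using eventually_ge_at_top[of 1]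
  proof eventually_elim
    case (elim m)
    have y: "0 < real m ^ s * \<rho> ^ (p * m)" using elim \<rho> by simp
    have "(x / y) / (w / y) = x / w" if "0 < y" for x y w :: real using that by simp
    from this[OF y] show ?case unfolding e(1) unfolding e(2) .
  qed
  ultimately have "(\<lambda>m. prefix_sum n (p * (m + L) + j - L) / block_sum k f (p * (m + L) + j)) \<longlonglongrightarrow> l1 / l2"
    by (rule Lim_transform_eventually)
  then have "(\<lambda>m. prefix_sum n (p * m + j - L) / block_sum k f (p * m + j)) \<longlonglongrightarrow> l1 / l2"
    by (rule LIMSEQ_offset[where k = L])
  then show ?thesis by (auto simp: convergent_def)
qed

lemma block_sum_eventually_pos: "\<forall>\<^sub>F m in sequentially. 0 < block_sum k f m"
  using lower eventually_ge_at_top[of 1]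
proof eventually_elim
  case (elim N)
  have "0 < a * (real N ^ s * \<rho> ^ N)" using a \<rho> elim(2) by simp
  then show ?case using elim(1) by linarith
qed

end


section \<open>Weak convergence on the circle\<close>

text \<open>The weights are kept on the indices, so that the same measure can be pushed to the
  circle, for the claim, and to the line, for the tightness argument.\<close>

definition block_measure :: "nat \<Rightarrow> (nat \<Rightarrow> real) \<Rightarrow> nat \<Rightarrow> nat measure" where
  "block_measure k f N = point_measure {0..k ^ (N + 1) - k ^ N - 1}
     (\<lambda>m. ennreal (f (k ^ N + m) / block_sum k f N))"

definition block_point :: "nat \<Rightarrow> nat \<Rightarrow> nat \<Rightarrow> real" where
  "block_point k N m = real m / (real (k ^ N) * (real k - 1))"

definition block_average :: "nat \<Rightarrow> (nat \<Rightarrow> real) \<Rightarrow> (real \<Rightarrow> real) \<Rightarrow> nat \<Rightarrow> real" where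
  "block_average k f \<phi> N =
     (\<Sum>M\<in>{k ^ N..<k ^ (N + 1)}. f M * \<phi> (block_point k N (M - k ^ N))) / block_sum k f N"

lemma ghost_approx_eq: "ghost_approx k f N = distr (block_measure k f N) circle_borel (block_point k N)"
  unfolding ghost_approx_def block_measure_def block_point_def ..

context
  fixes k :: nat
  assumes k: "2 \<le> k"
begin

lemma block_index: "k ^ N \<le> k ^ (N + 1)" "0 < k ^ (N + 1) - k ^ N"
  "{0..k ^ (N + 1) - k ^ N - 1} = {0..<k ^ (N + 1) - k ^ N}"
proof -
  show "k ^ N \<le> k ^ (N + 1)" using k by simp
  show p: "0 < k ^ (N + 1) - k ^ N" using k by simp
  have "{0..b - 1} = {0..<b}" if "0 < b" for b :: nat using that by auto
  from this[OF p] show "{0..k ^ (N + 1) - k ^ N - 1} = {0..<k ^ (N + 1) - k ^ N}" .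
qed

lemma block_point_range:
  assumes "m < k ^ (N + 1) - k ^ N" shows "block_point k N m \<in> {0..<1}"
proof -
  have "real m < real (k ^ (N + 1) - k ^ N)" using assms by simp
  also have "\<dots> = real (k ^ N) * (real k - 1)"
    using block_index(1) by (simp add: of_nat_diff algebra_simps)
  finally show ?thesis using k by (simp add: block_point_def)
qed

lemma sum_block_shift: "(\<Sum>m\<in>{0..<k ^ (N + 1) - k ^ N}. g (k ^ N + m)) = sum g {k ^ N..<k ^ (N + 1)}"
  for g :: "nat \<Rightarrow> real"
  using sum.shift_bounds_nat_ivl[of g 0 "k ^ N" "k ^ (N + 1) - k ^ N"] block_index(1)[of N]
  by (simp add: add.commute)

lemma space_block_measure: "space (block_measure k f N) = {0..<k ^ (N + 1) - k ^ N}"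
  unfolding block_measure_def block_index by (simp add: space_point_measure)

lemma block_point_measurable: "block_point k N \<in> measurable (block_measure k f N) borel"
  "block_point k N \<in> measurable (block_measure k f N) circle_borel"
proof -
  show b: "block_point k N \<in> measurable (block_measure k f N) borel"
    unfolding block_measure_def by (simp add: measurable_point_measure_eq1)
  show "block_point k N \<in> measurable (block_measure k f N) circle_borel"
    unfolding circle_borel_def
    by (rule measurable_restrict_space2[OF _ b]) (use block_point_range space_block_measure in auto)
qed

context
  fixes f :: "nat \<Rightarrow> real"
  assumes f: "\<And>n. 0 \<le> f n"
begin

lemma block_measure_prob:
  assumes "0 < block_sum k f N"
  shows "prob_space (block_measure k f N)"
proof -
  have "(\<Sum>m\<in>{0..<k ^ (N + 1) - k ^ N}. f (k ^ N + m) / block_sum k f N) = 1"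
    using sum_block_shift[of f N] block_sum_interval[OF k, of f N] assms
    by (simp add: sum_divide_distrib[symmetric])
  then have "(\<Sum>m\<in>{0..<k ^ (N + 1) - k ^ N}. ennreal (f (k ^ N + m) / block_sum k f N)) = 1"
    using f assms by (subst sum_ennreal) (auto intro!: divide_nonneg_pos)
  then show ?thesis
    unfolding block_measure_def block_index by (intro prob_space_point_measure) auto
qed

lemma block_measure_integral:
  assumes "0 < block_sum k f N"
  shows "integral\<^sup>L (block_measure k f N) (\<lambda>m. \<phi> (block_point k N m)) = block_average k f \<phi> N"
proof -
  have "integral\<^sup>L (block_measure k f N) (\<lambda>m. \<phi> (block_point k N m)) =
     (\<Sum>m\<in>{0..<k ^ (N + 1) - k ^ N}. f (k ^ N + m) / block_sum k f N * \<phi> (block_point k N m))"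
    unfolding block_measure_def block_index
    using f assms by (subst lebesgue_integral_point_measure_finite) (auto intro!: divide_nonneg_pos)
  also have "\<dots> = block_average k f \<phi> N"
    using sum_block_shift[of "\<lambda>M. f M * \<phi> (block_point k N (M - k ^ N))" N]
    by (simp add: block_average_def sum_divide_distrib[symmetric])
  finally show ?thesis .
qed

lemma ghost_approx_integral:
  assumes "0 < block_sum k f N" "\<phi> \<in> borel_measurable borel"
  shows "integral\<^sup>L (ghost_approx k f N) \<phi> = block_average k f \<phi> N"
  unfolding ghost_approx_eq block_measure_integral[OF assms(1), symmetric]
  by (rule integral_distr[OF block_point_measurable(2)])
    (use assms(2) in \<open>simp add: circle_borel_def measurable_restrict_space1\<close>)

text \<open>Splitting block \<open>N\<close> by the first \<open>L + 1\<close> digits moves the sampling point by at most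
  \<open>k\<^sup>-\<^sup>L\<close>.\<close>

lemma block_average_step_approx:
  assumes pos: "0 < block_sum k f N" and L: "L \<le> N"
    and unif: "\<And>x y. x \<in> {0..1} \<Longrightarrow> y \<in> {0..1} \<Longrightarrow> \<bar>x - y\<bar> \<le> 1 / real (k ^ L) \<Longrightarrow> \<bar>\<phi> x - \<phi> y\<bar> \<le> \<epsilon>"
  shows "\<bar>block_average k f \<phi> N - (\<Sum>n\<in>{k ^ L..<k ^ (L + 1)}. \<phi> (block_point k L (n - k ^ L)) *
     ((\<Sum>r<k ^ (N - L). f (n * k ^ (N - L) + r)) / block_sum k f N))\<bar> \<le> \<epsilon>"
proof -
  let ?q = "k ^ (N - L)" and ?I = "{k ^ L..<k ^ (L + 1)}"
  have split: "sum g {k ^ N..<k ^ (N + 1)} = (\<Sum>n\<in>?I. \<Sum>r<?q. g (n * ?q + r))" for g :: "nat \<Rightarrow> real"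
  proof -
    have e: "k ^ L * ?q = k ^ N" "k ^ (L + 1) * ?q = k ^ (N + 1)"
      using L by (simp_all add: power_add[symmetric])
    show ?thesis using sum_prefix_blocks[OF block_index(1)[of L], of g ?q] unfolding e .
  qed
  \<comment> \<open>Both points belong to the prefix n; they differ by the contribution of the
    digits in r, which is r / (k^N (k-1)) with r < k^(N-L).\<close>
  have close: "\<bar>\<phi> (block_point k N (n * ?q + r - k ^ N)) - \<phi> (block_point k L (n - k ^ L))\<bar> \<le> \<epsilon>"
    if n: "n \<in> ?I" and r: "r < ?q" for n r
  proof (rule unif)
    have kN: "k ^ N = k ^ L * ?q" using L by (simp add: power_add[symmetric])
    have le: "k ^ N \<le> n * ?q" unfolding kN using n by simp
    have lt: "n * ?q + r < k ^ (N + 1)"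
    proof -
      have "n * ?q + r < Suc n * ?q" using r by simp
      also have "\<dots> \<le> k ^ (L + 1) * ?q" using n by (intro mult_le_mono1) simp
      also have "\<dots> = k ^ (N + 1)" using L by (simp add: power_add[symmetric])
      finally show ?thesis .
    qed
    have "block_point k N (n * ?q + r - k ^ N) \<in> {0..<1}" by (rule block_point_range) (use le lt in linarith)
    then show "block_point k N (n * ?q + r - k ^ N) \<in> {0..1}" by simp
    have "block_point k L (n - k ^ L) \<in> {0..<1}" by (rule block_point_range) (use n in auto)
    then show "block_point k L (n - k ^ L) \<in> {0..1}" by simp
    have q: "0 < real ?q" and kL: "0 < real (k ^ L)" and k1: "1 \<le> real k - 1" using k by auto
    have "real (n * ?q + r - k ^ N) = (real n - real (k ^ L)) * real ?q + real r"
    proof -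
      have "real (n * ?q + r - k ^ N) = real (n * ?q + r) - real (k ^ N)"
        using le by (intro of_nat_diff) simp
      then show ?thesis unfolding kN by (simp add: algebra_simps)
    qed
    moreover have "real (n - k ^ L) = real n - real (k ^ L)" using n by (simp add: of_nat_diff)
    moreover have "((x - y) * w + s) / (y * w * c) - (x - y) / (y * c) = s / (y * w * c)"
      if "0 < w" "0 < y" "1 \<le> c" for x y w s c :: real
      using that by (simp add: field_simps)
    from this[OF q kL k1] have "((real n - real (k ^ L)) * real ?q + real r) / (real (k ^ L) * real ?q * (real k - 1))
      - (real n - real (k ^ L)) / (real (k ^ L) * (real k - 1)) = real r / (real (k ^ L) * real ?q * (real k - 1))" .
    moreover have "real (k ^ N) = real (k ^ L) * real ?q" by (simp only: kN of_nat_mult)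
    ultimately have e: "block_point k N (n * ?q + r - k ^ N) - block_point k L (n - k ^ L)
       = real r / (real (k ^ L) * real ?q * (real k - 1))"
      unfolding block_point_def by (simp only:)
    have "real r / (real (k ^ L) * real ?q * (real k - 1)) \<le> real ?q / (real (k ^ L) * real ?q * 1)"
      using r k1 q kL by (intro frac_le mult_left_mono) auto
    also have "\<dots> = 1 / real (k ^ L)"
    proof -
      have "x / (y * x * 1) = 1 / y" if "0 < x" for x y :: real using that by simp
      from this[OF q] show ?thesis .
    qed
    finally show "\<bar>block_point k N (n * ?q + r - k ^ N) - block_point k L (n - k ^ L)\<bar> \<le> 1 / real (k ^ L)"
      unfolding e using k1 by (simp add: abs_of_nonneg)
  qed
  let ?a = "\<lambda>n r. f (n * ?q + r)"
  let ?X = "block_average k f \<phi> N - (\<Sum>n\<in>?I. \<phi> (block_point k L (n - k ^ L)) * ((\<Sum>r<?q. ?a n r) / block_sum k f N))"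
  let ?D = "\<Sum>n\<in>?I. \<Sum>r<?q. ?a n r * (\<phi> (block_point k N (n * ?q + r - k ^ N)) - \<phi> (block_point k L (n - k ^ L)))"
  have "?X = ?D / block_sum k f N"
    unfolding block_average_def split
    by (simp add: sum_divide_distrib sum_subtractf right_diff_distrib diff_divide_distrib sum_distrib_left mult_ac)
  then have "\<bar>?X\<bar> = \<bar>?D\<bar> / block_sum k f N" using pos by simp
  also have "\<dots> \<le> (\<Sum>n\<in>?I. \<Sum>r<?q. ?a n r * \<epsilon>) / block_sum k f N"
  proof (intro divide_right_mono)
    show "\<bar>\<Sum>n\<in>?I. \<Sum>r<?q. ?a n r * (\<phi> (block_point k N (n * ?q + r - k ^ N)) - \<phi> (block_point k L (n - k ^ L)))\<bar>
      \<le> (\<Sum>n\<in>?I. \<Sum>r<?q. ?a n r * \<epsilon>)"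
      by (intro order_trans[OF sum_abs] sum_mono order_trans[OF sum_abs])
        (use close f in \<open>auto simp: abs_mult intro!: mult_left_mono\<close>)
  qed (use pos in simp)
  also have "\<dots> = block_sum k f N * \<epsilon> / block_sum k f N"
    using split[of f] block_sum_interval[OF k, of f N] by (simp add: sum_distrib_right)
  also have "\<dots> = \<epsilon>" using pos by simp
  finally show ?thesis .
qed

end

end

text \<open>The approximant T depends on the tolerance and its limit is not known, so the argument
  shows that S is a Cauchy sequence.\<close>

lemma convergent_of_approximants:
  fixes S :: "nat \<Rightarrow> real"
  assumes "\<And>\<epsilon>. 0 < \<epsilon> \<Longrightarrow> \<exists>T. convergent T \<and> (\<forall>\<^sub>F m in sequentially. \<bar>S m - T m\<bar> \<le> \<epsilon>)"
  shows "convergent S"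
proof -
  have "Cauchy S"
  proof (rule metric_CauchyI)
    fix e :: real assume e: "0 < e"
    obtain T where T: "convergent T" "\<forall>\<^sub>F m in sequentially. \<bar>S m - T m\<bar> \<le> e / 4"
      using assms[of "e / 4"] e by auto
    obtain N1 where N1: "\<And>m. m \<ge> N1 \<Longrightarrow> \<bar>S m - T m\<bar> \<le> e / 4" using T(2) by (auto simp: eventually_sequentially)
    have "Cauchy T" using T(1) Cauchy_convergent_iff by blast
    then obtain N2 where N2: "\<And>m n. m \<ge> N2 \<Longrightarrow> n \<ge> N2 \<Longrightarrow> dist (T m) (T n) < e / 4"
      using e metric_CauchyD[of T "e / 4"] by auto
    have "dist (S m) (S n) < e" if "m \<ge> max N1 N2" "n \<ge> max N1 N2" for m n
    proof -
      have "\<bar>S m - T m\<bar> \<le> e / 4" "\<bar>S n - T n\<bar> \<le> e / 4" "\<bar>T m - T n\<bar> < e / 4"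
        using N1[of m] N1[of n] N2[of m n] that by (auto simp: dist_real_def)
      then show ?thesis using e unfolding dist_real_def by linarith
    qed
    then show "\<exists>M. \<forall>m\<ge>M. \<forall>n\<ge>M. dist (S m) (S n) < e" by blast
  qed
  then show ?thesis using Cauchy_convergent_iff by blast
qed

lemma periodic_frac:
  fixes \<phi> :: "real \<Rightarrow> real"
  assumes per: "\<And>x. \<phi> (x + 1) = \<phi> x"
  shows "\<phi> (frac x) = \<phi> x"
proof -
  have n: "\<phi> (y + real n) = \<phi> y" for n y
  proof (induction n)
    case (Suc n)
    have "\<phi> (y + real (Suc n)) = \<phi> (y + real n + 1)" by (simp add: add.commute add.left_commute)
    then show ?case using per Suc by simp
  qed simp
  show ?thesis
  proof (cases "0 \<le> \<lfloor>x\<rfloor>")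
    case True
    have "x = frac x + real (nat \<lfloor>x\<rfloor>)" using True by (simp add: frac_def)
    then show ?thesis using n[of "frac x" "nat \<lfloor>x\<rfloor>"] by simp
  next
    case False
    have "frac x = x + real (nat (- \<lfloor>x\<rfloor>))" using False by (simp add: frac_def)
    then show ?thesis using n[of x "nat (- \<lfloor>x\<rfloor>)"] by simp
  qed
qed

text \<open>Approximation by finitely many arc masses shows that all integrals of test functions
  converge; a measure with these limits as integrals still has to be found. A weakly convergent
  subsequence on the line provides one, and convergence of the whole sequence is already
  known.\<close>

lemma ghost_limit_exists:
  fixes k p j :: nat and f :: "nat \<Rightarrow> real"
  assumes k: "2 \<le> k" and f: "\<And>n. 0 \<le> f n" and p: "0 < p"
    and pos: "\<forall>\<^sub>F N in sequentially. 0 < block_sum k f N"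
    and ratio: "\<And>n L. 1 \<le> n \<Longrightarrow> convergent (\<lambda>m.
      (\<Sum>r<k ^ (p * m + j - L). f (n * k ^ (p * m + j - L) + r)) / block_sum k f (p * m + j))"
  shows "\<exists>\<mu>. circle_prob \<mu> \<and> circle_weak_conv (\<lambda>m. ghost_approx k f (p * m + j)) \<mu>"
proof -
  have sub: "filterlim (\<lambda>m. p * m + j) sequentially sequentially"
    using p by (intro filterlim_subseq) (auto simp: strict_mono_def)
  have pos': "\<forall>\<^sub>F m in sequentially. 0 < block_sum k f (p * m + j)"
    using pos sub unfolding filterlim_iff by blast
  have conv: "convergent (\<lambda>m. block_average k f \<phi> (p * m + j))" if cont: "continuous_on UNIV \<phi>" for \<phi>
  proof (rule convergent_of_approximants)
    fix \<epsilon> :: real assume \<epsilon>: "0 < \<epsilon>"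
    have "uniformly_continuous_on {0..1} \<phi>"
      by (rule compact_uniformly_continuous[OF continuous_on_subset[OF cont]]) auto
    then obtain \<delta> where \<delta>: "0 < \<delta>" "\<And>x y. x \<in> {0..1} \<Longrightarrow> y \<in> {0..1} \<Longrightarrow> dist y x < \<delta> \<Longrightarrow> dist (\<phi> y) (\<phi> x) < \<epsilon>"
      using \<epsilon> unfolding uniformly_continuous_on_def by blast
    obtain L where L: "inverse \<delta> < real k ^ L" using real_arch_pow[of "real k" "inverse \<delta>"] k by auto
    have "1 / real (k ^ L) < \<delta>"
      using L \<delta>(1) k by (simp add: field_simps inverse_eq_divide)
    then have unif: "\<bar>\<phi> x - \<phi> y\<bar> \<le> \<epsilon>" if "x \<in> {0..1}" "y \<in> {0..1}" "\<bar>x - y\<bar> \<le> 1 / real (k ^ L)" for x y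
      using \<delta>(2)[OF that(2,1)] that(3) by (auto simp: dist_real_def less_imp_le)
    let ?T = "\<lambda>m. \<Sum>n\<in>{k ^ L..<k ^ (L + 1)}. \<phi> (block_point k L (n - k ^ L)) *
       ((\<Sum>r<k ^ (p * m + j - L). f (n * k ^ (p * m + j - L) + r)) / block_sum k f (p * m + j))"
    have "convergent ?T"
    proof (intro convergent_sum convergent_mult convergent_const ratio)
      fix n assume "n \<in> {k ^ L..<k ^ (L + 1)}"
      moreover have "1 \<le> k ^ L" using k by simp
      ultimately show "1 \<le> n" by auto
    qed
    moreover have "\<forall>\<^sub>F m in sequentially. \<bar>block_average k f \<phi> (p * m + j) - ?T m\<bar> \<le> \<epsilon>"
      using pos' eventually_ge_at_top[of L]
    proof eventually_elim
      case (elim m)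
      have "m \<le> p * m" using p by simp
      then have "L \<le> p * m + j" using elim(2) by linarith
      then show ?case by (rule block_average_step_approx[OF k f elim(1)]) (rule unif)
    qed
    ultimately show "\<exists>T. convergent T \<and> (\<forall>\<^sub>F m in sequentially. \<bar>block_average k f \<phi> (p * m + j) - T m\<bar> \<le> \<epsilon>)"
      by blast
  qed
  obtain m0 where m0: "\<And>m. m \<ge> m0 \<Longrightarrow> 0 < block_sum k f (p * m + j)"
    using pos' by (auto simp: eventually_sequentially)
  \<comment> \<open>The initial indices are skipped because tightness requires every member of the
    sequence to be a probability measure.\<close>
  define N where "N m = p * (m + m0) + j" for m
  have posN: "0 < block_sum k f (N m)" for m unfolding N_def by (rule m0) simp
  define E where "E m = distr (block_measure k f (N m)) borel (block_point k (N m))" for m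
  have E: "real_distribution (E m)" for m
    unfolding E_def
    by (rule prob_space.real_distribution_distr[OF block_measure_prob[OF k f posN] block_point_measurable(1)[OF k]])
  have Eint: "integral\<^sup>L (E m) \<phi> = block_average k f \<phi> (N m)" if "\<phi> \<in> borel_measurable borel" for \<phi> m
    unfolding E_def block_measure_integral[OF k f posN, symmetric]
    by (rule integral_distr[OF block_point_measurable(1)[OF k] that])
  have "tight E"
    unfolding tight_def
  proof (intro conjI allI impI)
    show "real_distribution (E m)" for m by (rule E)
    fix \<epsilon> :: real assume \<epsilon>: "0 < \<epsilon>"
    have "measure (E m) {-1<..1} = 1" for m
    proof -
      interpret P: prob_space "block_measure k f (N m)" by (rule block_measure_prob[OF k f posN])
      have "block_point k (N m) -` {-1<..1} \<inter> space (block_measure k f (N m)) = space (block_measure k f (N m))"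
      proof -
        have "block_point k (N m) x \<in> {-1<..1}" if "x \<in> space (block_measure k f (N m))" for x
          using block_point_range[OF k, of x "N m"] that by (auto simp: space_block_measure[OF k])
        then show ?thesis by auto
      qed
      then show ?thesis unfolding E_def using P.prob_space
        by (subst measure_distr[OF block_point_measurable(1)[OF k]]) auto
    qed
    then show "\<exists>a b. a < b \<and> (\<forall>n. 1 - \<epsilon> < measure (E n) {a<..b})"
      using \<epsilon> by (intro exI[of _ "-1"] exI[of _ 1]) auto
  qed
  from tight_imp_convergent_subsubsequence[OF this strict_mono_id]
  obtain r M where r: "strict_mono (r :: nat \<Rightarrow> nat)" and M: "real_distribution M"
    and w: "weak_conv_m (E \<circ> id \<circ> r) M" by blast
  interpret M: real_distribution M by (rule M)
  have fm: "frac \<in> measurable M circle_borel"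
  proof -
    have "(\<lambda>x. x - real_of_int \<lfloor>x\<rfloor>) \<in> borel_measurable borel"
      by (intro borel_measurable_diff borel_measurable_real_floor) simp
    then have "(frac :: real \<Rightarrow> real) \<in> borel_measurable borel" by (simp add: frac_def[abs_def])
    then have "frac \<in> measurable M borel" by (simp cong: measurable_cong_sets)
    then show ?thesis unfolding circle_borel_def
      by (intro measurable_restrict_space2) (auto simp: frac_ge_0 frac_lt_1)
  qed
  \<comment> \<open>The limit on the line may charge the point 1, which is not in [0,1). The
    fractional part moves this mass to 0, and a 1-periodic test function does not notice.\<close>
  define \<mu> where "\<mu> = distr M circle_borel frac"
  have "circle_prob \<mu>"
    unfolding circle_prob_def \<mu>_def using M.prob_space_distr[OF fm] by simp
  moreover have "circle_weak_conv (\<lambda>m. ghost_approx k f (p * m + j)) \<mu>"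
    unfolding circle_weak_conv_def
  proof (intro allI impI)
    fix \<phi> :: "real \<Rightarrow> real" assume cont: "continuous_on UNIV \<phi>" and "\<forall>x. \<phi> (x + 1) = \<phi> x"
    then have fr: "\<phi> (frac x) = \<phi> x" for x by (intro periodic_frac) auto
    have meas: "\<phi> \<in> borel_measurable borel" using cont by (rule borel_measurable_continuous_onI)
    obtain l where l: "(\<lambda>m. block_average k f \<phi> (p * m + j)) \<longlonglongrightarrow> l" using conv[OF cont] by (auto simp: convergent_def)
    have "bounded (\<phi> ` {0..1})"
      by (intro compact_imp_bounded compact_continuous_image continuous_on_subset[OF cont]) auto
    then obtain B where B: "\<And>x. x \<in> {0..1} \<Longrightarrow> norm (\<phi> x) \<le> B" unfolding bounded_iff by blast
    have Bd: "norm (\<phi> x) \<le> B" for x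
      using B[of "frac x"] unfolding fr by (simp add: frac_ge_0 frac_lt_1 less_imp_le)
    have "(\<lambda>n. integral\<^sup>L ((E \<circ> id \<circ> r) n) \<phi>) \<longlonglongrightarrow> integral\<^sup>L M \<phi>"
      by (rule weak_conv_imp_integral_bdd_continuous_conv[OF _ M w _ Bd])
        (use E cont in \<open>auto simp: continuous_on_eq_continuous_at\<close>)
    then have "(\<lambda>n. block_average k f \<phi> (N (r n))) \<longlonglongrightarrow> integral\<^sup>L M \<phi>" by (simp add: Eint[OF meas])
    moreover have "(\<lambda>n. block_average k f \<phi> (N (r n))) \<longlonglongrightarrow> l"
      using LIMSEQ_subseq_LIMSEQ[OF LIMSEQ_ignore_initial_segment[OF l, of m0] r] by (simp add: N_def o_def)
    \<comment> \<open>The limit l belongs to the full sequence, so identifying it along one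
      subsequence is enough.\<close>
    ultimately have "l = integral\<^sup>L M \<phi>" using LIMSEQ_unique by blast
    also have "\<dots> = integral\<^sup>L \<mu> \<phi>"
      unfolding \<mu>_def using meas
      by (subst integral_distr[OF fm]) (auto simp: fr circle_borel_def measurable_restrict_space1)
    finally have "(\<lambda>m. block_average k f \<phi> (p * m + j)) \<longlonglongrightarrow> integral\<^sup>L \<mu> \<phi>" using l by simp
    moreover have "\<forall>\<^sub>F m in sequentially. block_average k f \<phi> (p * m + j) = integral\<^sup>L (ghost_approx k f (p * m + j)) \<phi>"
      using pos' by eventually_elim (rule ghost_approx_integral[OF k f _ meas, symmetric])
    ultimately show "(\<lambda>m. integral\<^sup>L (ghost_approx k f (p * m + j)) \<phi>) \<longlonglongrightarrow> integral\<^sup>L \<mu> \<phi>"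
      by (rule Lim_transform_eventually)
  qed
  ultimately show ?thesis by blast
qed

theorem theorem2:
  fixes k d p :: nat and f :: "nat \<Rightarrow> real"
    and u v :: "real vec" and A :: "nat \<Rightarrow> real mat"
  assumes "k \<ge> 2"
    and "\<And>n. 0 \<le> f n"
    and "regular_seq k f"
    and "nondegenerate_seq k f"
    and "canonical_rep k f d u A v"
    and "\<And>i. i < k \<Longrightarrow> nonneg_entries (restr_mat k d u A (A i))"
    and "p = mat_period (restr_mat k d u A (total_mat k d A))"
  shows "\<exists>\<mu> :: nat \<Rightarrow> real measure.
           (\<forall>j<p. circle_prob (\<mu> j)) \<and>
           (\<forall>j<p. circle_weak_conv (\<lambda>n. ghost_approx k f (p * n + j)) (\<mu> j))"
proof -
  obtain d' u' A' v' where rep': "linear_rep k f d' u' A' v'" and nd: "nondegenerate_rep k d' u' A' v'"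
    using assms(4) unfolding nondegenerate_seq_def minimal_rep_def by blast
  have "lin_rep k d' f u' v' A'" by (rule lin_rep.intro[OF assms(1) rep'])
  from lin_rep.nondegenerate_growth[OF this nd] obtain s a b \<rho> where g: "0 < \<rho>" "0 < a"
    "\<forall>\<^sub>F N in sequentially. a * (real N ^ s * \<rho> ^ N) \<le> block_sum k f N \<and> block_sum k f N \<le> b * (real N ^ s * \<rho> ^ N)"
    by blast
  have "linear_rep k f d u A v" using assms(5) by (simp add: canonical_rep_def)
  then interpret canonical_growth k d f u v A s a b \<rho>
    using assms(1,2,5,6) g by unfold_locales (auto elim: eventually_mono)
  have "\<exists>\<mu>. circle_prob \<mu> \<and> circle_weak_conv (\<lambda>n. ghost_approx k f (p * n + j)) \<mu>" for j
    unfolding assms(7)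
    by (rule ghost_limit_exists[OF assms(1,2) period(1) block_sum_eventually_pos prefix_ratio_convergent[unfolded prefix_sum_def]])
  then obtain \<mu> where "\<And>j. circle_prob (\<mu> j) \<and> circle_weak_conv (\<lambda>n. ghost_approx k f (p * n + j)) (\<mu> j)"
    by metis
  then show ?thesis by blast
qed

end
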